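(* Let $z\sim\mathcal D=\mathcal N(0,I_d)$. Let $\mathcal F$ be the class of all non-constant functions $\sigma:\mathbb{R}\to\mathbb{R}$ that are square-integrable under the standard Gaussian measure on $\mathbb{R}$, and let $\mathcal F_+\subset\mathcal F$ be the subset of all strictly increasing and locally Lipschitz functions in $\mathcal F$. Fix any $x^*\in\mathbb{S}^{d-1}$. 1. For any $\sigma^*\in\mathcal F$, the function $f_{2}(x)=\min_{\sigma\in\mathcal F}\mathbb{E}_{z\sim\mathcal D}[(\sigma(x\cdot z)-\sigma^*(x^*\cdot z))^2]$ is $1$-RGA at $(x,x^* )$ for every $x\in\mathbb{S}^{d-1}$ with $\theta(x,x^* )\in(0,\pi/2)$. 2. For any $\sigma^*\in\mathcal F_+$, the function $f_{1}(x)=\min_{\sigma\in\mathcal F_+}\mathbb{E}_{z\sim\mathcal D}[|\sigma(x\cdot z)-\sigma^*(x^*\cdot z)|]$ is $1$-RGA at $(x,x^* )$ for every $x\in\mathbb{S}^{d-1}$ with $\theta(x,x^* )\in(0,\pi/2)$. 3. For any $r^*\in\mathcal F_+$, the function $f_{1,\mathrm{PR}}(x)=\min_{r\in\mathcal F_+}\mathbb{E}_{z\sim\mathcal D}[|r(|x\cdot z|)-r^*(|x^*\cdot z|)|]$ is $1$-RGA at $(x,x^* )$ for every $x\in\mathbb{S}^{d-1}$ with $\theta(x,x^* )\in(0,\pi/2)$.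
   Context: $\mathbb{S}^{d-1}$ is the unit sphere of $\mathbb{R}^d$; $\theta(x,y)=\arccos(x\cdot y)$ for unit vectors. Functions in $\mathcal F$ are considered up to almost-everywhere equality under the Gaussian measure (so "non-constant" means not a.e. equal to a constant). For a locally Lipschitz $f$ on the sphere with locally Lipschitz extension to a neighborhood, $\partial^Cf(x)$ is the Clarke subdifferential of the extension and $\partial^{C,R}f(x)=\{(I-xx^\top)\xi:\xi\in\partial^Cf(x)\}$; when $f$ is continuously differentiable this is $\{\nabla^Rf(x)\}$, the Riemannian gradient. $f$ is $\mu$-RGA at $(x,x^* )$ if every $g(x)\in\partial^{C,R}f(x)$ satisfies: $g(x)\neq0$ whenever $x\ne x^*$, and $g(x)\cdot x^*\le-\mu\,\sin(\theta(x,x^* ))\,\|g(x)\|_2$. *)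

theory Defs
  imports "HOL-Probability.Probability"
begin

subsection \<open>Gaussian measures and the function classes\<close>

definition gauss1 :: "real measure" where
  "gauss1 = density lborel (\<lambda>t. ennreal (std_normal_density t))"

definition gauss :: "(real ^ 'n) measure" where
  "gauss = density lborel (\<lambda>z. ennreal (\<Prod>i\<in>UNIV. std_normal_density (z $ i)))"

definition lipschitz_near :: "'a::metric_space set \<Rightarrow> ('a \<Rightarrow> real) \<Rightarrow> 'a \<Rightarrow> bool" where
  "lipschitz_near S f x \<longleftrightarrow> (\<exists>e>0. \<exists>L. L-lipschitz_on (cball x e \<inter> S) f)"

text \<open>
  The classes consist of honest functions. Identifying functions that agree almost everywhere
  only matters for the meaning of ``non-constant'', since the risks below depend on the
  almost-everywhere classes alone; for the same reason Borel representatives suffice.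
\<close>

definition F_class :: "(real \<Rightarrow> real) set" where
  "F_class = {\<sigma> \<in> borel_measurable borel.
     integrable gauss1 (\<lambda>t. (\<sigma> t)\<^sup>2) \<and> \<not> (\<exists>c. AE t in gauss1. \<sigma> t = c)}"

definition F_plus :: "(real \<Rightarrow> real) set" where
  "F_plus = {\<sigma> \<in> F_class. strict_mono \<sigma> \<and> (\<forall>t. lipschitz_near UNIV \<sigma> t)}"

subsection \<open>Riemannian gradient alignment\<close>

definition theta :: "'a::real_inner \<Rightarrow> 'a \<Rightarrow> real" where
  "theta x y = arccos (x \<bullet> y)"

text \<open>
  Clarke's definition by limits of gradients; it is the intended notion for functions that are
  Lipschitz near the point.
\<close>

definition clarke_subdiff :: "('a::euclidean_space \<Rightarrow> real) \<Rightarrow> 'a \<Rightarrow> 'a set" where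
  "clarke_subdiff F x = convex hull
     {\<xi>. \<exists>u g. u \<longlonglongrightarrow> x \<and> (\<forall>n. GDERIV F (u n) :> g n) \<and> g \<longlonglongrightarrow> \<xi>}"

text \<open>
  The projected Clarke subdifferential depends in general on the extension of \<open>f\<close> off the sphere,
  even for smooth \<open>f\<close>. The extension used here is the radial one, \<open>y \<mapsto> f (y / \<parallel>y\<parallel>)\<close>: it is
  Lipschitz near \<open>x\<close> iff \<open>f\<close> is Lipschitz near \<open>x\<close> on the sphere, and for continuously
  differentiable \<open>f\<close> it yields exactly the Riemannian gradient.
\<close>

definition riem_clarke_subdiff :: "('a::euclidean_space \<Rightarrow> real) \<Rightarrow> 'a \<Rightarrow> 'a set" where
  "riem_clarke_subdiff f x =
     (\<lambda>\<xi>. \<xi> - (x \<bullet> \<xi>) *\<^sub>R x) ` clarke_subdiff (\<lambda>y. f (y /\<^sub>R norm y)) x"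

text \<open>
  The Lipschitz requirement, under which the subdifferential is defined, is part of the
  definition; it also prevents the quantifier over \<open>g\<close> from being vacuous.
\<close>

definition RGA :: "real \<Rightarrow> ('a::euclidean_space \<Rightarrow> real) \<Rightarrow> 'a \<Rightarrow> 'a \<Rightarrow> bool" where
  "RGA \<mu> f x xs \<longleftrightarrow>
     lipschitz_near (sphere 0 1) f x \<and>
     (\<forall>g \<in> riem_clarke_subdiff f x.
        (x \<noteq> xs \<longrightarrow> g \<noteq> 0) \<and> g \<bullet> xs \<le> - \<mu> * sin (theta x xs) * norm g)"

subsection \<open>Risks and their optimal values\<close>

definition risk2 :: "(real \<Rightarrow> real) \<Rightarrow> real ^ 'n \<Rightarrow> real ^ 'n \<Rightarrow> (real \<Rightarrow> real) \<Rightarrow> real" where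
  "risk2 \<sigma>s xs x \<sigma> = (LINT z|gauss. (\<sigma> (x \<bullet> z) - \<sigma>s (xs \<bullet> z))\<^sup>2)"

definition risk1 :: "(real \<Rightarrow> real) \<Rightarrow> real ^ 'n \<Rightarrow> real ^ 'n \<Rightarrow> (real \<Rightarrow> real) \<Rightarrow> real" where
  "risk1 \<sigma>s xs x \<sigma> = (LINT z|gauss. \<bar>\<sigma> (x \<bullet> z) - \<sigma>s (xs \<bullet> z)\<bar>)"

definition risk1PR :: "(real \<Rightarrow> real) \<Rightarrow> real ^ 'n \<Rightarrow> real ^ 'n \<Rightarrow> (real \<Rightarrow> real) \<Rightarrow> real" where
  "risk1PR rs xs x r = (LINT z|gauss. \<bar>r (\<bar>x \<bullet> z\<bar>) - rs (\<bar>xs \<bullet> z\<bar>)\<bar>)"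

text \<open>
  The minima are written as infima so that they are defined on the whole sphere: the minimum
  need not exist when \<open>\<theta>(x, x\<^sup>*) \<ge> \<pi>/2\<close> (for example, at \<open>\<pi>/2\<close> the best \<open>\<sigma>\<close> is constant).
\<close>

definition f2 :: "(real \<Rightarrow> real) \<Rightarrow> real ^ 'n \<Rightarrow> real ^ 'n \<Rightarrow> real" where
  "f2 \<sigma>s xs x = (INF \<sigma>\<in>F_class. risk2 \<sigma>s xs x \<sigma>)"

definition f1 :: "(real \<Rightarrow> real) \<Rightarrow> real ^ 'n \<Rightarrow> real ^ 'n \<Rightarrow> real" where
  "f1 \<sigma>s xs x = (INF \<sigma>\<in>F_plus. risk1 \<sigma>s xs x \<sigma>)"

definition f1PR :: "(real \<Rightarrow> real) \<Rightarrow> real ^ 'n \<Rightarrow> real ^ 'n \<Rightarrow> real" where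
  "f1PR rs xs x = (INF r\<in>F_plus. risk1PR rs xs x r)"

end

theory Submission
  imports Defs
begin

text \<open>All three risks depend on \<open>x\<close> only through the correlation \<open>r = x \<bullet> xs\<close>. If the optimal value is \<open>H r\<close>, where
  the difference quotients of \<open>H\<close> near \<open>r\<close> lie between two negative constants, then every gradient of the
  radial extension near \<open>x\<close> is a negative multiple, bounded away from zero, of the projection of \<open>xs\<close> onto the
  tangent space; this survives limits, convex hulls and the projection, and gives alignment with constant 1
  without any differentiability of \<open>H\<close>. The two-sided bounds come from three sources:

  \<^item> for the squared loss, \<open>H r = \<parallel>\<sigma>s\<parallel>\<^sup>2 - \<parallel>OU r \<sigma>s\<parallel>\<^sup>2\<close> with the Ornstein-Uhlenbeck operator \<open>OU\<close>, and
    \<open>\<parallel>OU r \<sigma>s\<parallel>\<^sup>2\<close> is convex in \<open>- ln r\<close> and strictly decreases to its limit;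
  \<^item> for the absolute loss, the conditional median of \<open>\<sigma>s\<close> is \<open>\<sigma>s (r * s)\<close>, and a reflection of the plane turns
    the optimal value into a one-dimensional integral in which \<open>r\<close> appears only inside the normal
    distribution function;
  \<^item> for phase retrieval, an envelope argument reduces to fixed links, and a layer-cake decomposition
    to the probabilities of rectangles, whose derivative in the correlation is a difference of densities.\<close>

text \<open>The targets are only square-integrable or locally Lipschitz, so an integral with the
  target evaluated at \<open>r * s + kap r * w\<close> cannot simply be differentiated in
  \<open>r\<close>. Each case therefore looks for a form of the optimal value in which
  \<open>r\<close> no longer sits inside the target. The uniform rate \<open>c > 0\<close> matters
  as much as the sign: without it the limits of gradients could reach zero, which \<open>RGA\<close>
  excludes. The logarithm comes from the composition law
  \<open>OU a (OU b g) = OU (a * b) g\<close>, which is additive in \<open>- ln r\<close>: expanding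
  the square norm of \<open>OU a f - OU b f\<close> gives midpoint convexity, and convexity turns
  mere decay to a limit into bounds on slopes. For the absolute loss, strict monotonicity makes the
  sign of the error at the optimal link equal to the sign of the independent noise. With absolute
  values around both coordinates the conditional median is only implicit and varies with
  \<open>r\<close>, so the link has to be frozen before the dependence on \<open>r\<close> is
  studied.\<close>

lemmas integral_cong_pointwise = Bochner_Integration.integral_cong[OF refl]
lemmas integrable_bound_L = Bochner_Integration.integrable_bound

subsection \<open>Gradients of functions of the correlation\<close>

text \<open>All pairs near \<open>r\<close> are compared, not only increments starting at
  \<open>r\<close>, because the gradients in Clarke's definition are taken at neighbouring
  points.\<close>

definition steep_at :: "(real \<Rightarrow> real) \<Rightarrow> real \<Rightarrow> bool" where
  "steep_at H r \<longleftrightarrow> (\<exists>e>0. \<exists>c>0. \<exists>L. \<forall>a b. r - e < a \<and> a \<le> b \<and> b < r + e \<longrightarrow>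
     - L * (b - a) \<le> H b - H a \<and> H b - H a \<le> - c * (b - a))"

lemma steep_atI:
  assumes "e > 0" "c > 0"
    and "\<And>a b. r - e < a \<Longrightarrow> a \<le> b \<Longrightarrow> b < r + e \<Longrightarrow>
      - L * (b - a) \<le> H b - H a \<and> H b - H a \<le> - c * (b - a)"
  shows "steep_at H r"
  using assms unfolding steep_at_def by blast

lemma steep_at_cong:
  assumes "steep_at H r" "open S" "r \<in> S" "\<And>t. t \<in> S \<Longrightarrow> G t = H t"
  shows "steep_at G r"
proof -
  obtain e c L where e: "e > 0" "c > 0" and *: "\<And>a b. r - e < a \<Longrightarrow> a \<le> b \<Longrightarrow> b < r + e \<Longrightarrow>
     - L * (b - a) \<le> H b - H a \<and> H b - H a \<le> - c * (b - a)"
    using assms(1) unfolding steep_at_def by metis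
  obtain d where d: "d > 0" "ball r d \<subseteq> S" using assms(2,3) openE by blast
  have GH: "G t = H t" if "r - d < t" "t < r + d" for t
    using assms(4)[of t] d that by (auto simp: subset_eq dist_real_def)
  show ?thesis
  proof (rule steep_atI)
    fix a b assume "r - min e d < a" "a \<le> b" "b < r + min e d"
    then show "- L * (b - a) \<le> G b - G a \<and> G b - G a \<le> - c * (b - a)"
      using *[of a b] GH[of a] GH[of b] by auto
  qed (use e d in auto)
qed

text \<open>For changes of variable: \<open>h\<close> rises at a controlled rate near
  \<open>tau r\<close> while \<open>tau\<close> falls near \<open>r\<close>. Continuity of
  \<open>tau'\<close> and the mean value theorem keep the difference quotients of \<open>tau\<close>
  between \<open>- 2 * k\<close> and \<open>- k / 2\<close>, where
  \<open>k = - tau' r\<close>.\<close>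

lemma steep_at_compose:
  assumes h: "steep_at (\<lambda>t. - h t) (tau r)"
    and S: "open S" "r \<in> S"
    and tau: "\<And>t. t \<in> S \<Longrightarrow> (tau has_real_derivative tau' t) (at t)"
    and cont: "isCont tau' r" and neg: "tau' r < 0"
  shows "steep_at (\<lambda>t. h (tau t)) r"
proof -
  obtain e c L where e: "e > 0" "c > 0" and *: "\<And>a b. tau r - e < a \<Longrightarrow> a \<le> b \<Longrightarrow> b < tau r + e \<Longrightarrow>
     - L * (b - a) \<le> h a - h b \<and> h a - h b \<le> - c * (b - a)"
    using h unfolding steep_at_def by (metis diff_minus_eq_add uminus_add_conv_diff)
  define k where "k = - tau' r"
  have "isCont tau r" using tau S by (meson DERIV_isCont)
  then obtain d1 where d1: "d1 > 0" "\<And>t. \<bar>t - r\<bar> < d1 \<Longrightarrow> \<bar>tau t - tau r\<bar> < e"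
    using e unfolding continuous_at_eps_delta dist_real_def by blast
  have "k > 0" using neg k_def by simp
  then have "k / 2 > 0" by simp
  then obtain d2 where d2: "d2 > 0" "\<And>t. \<bar>t - r\<bar> < d2 \<Longrightarrow> \<bar>tau' t - tau' r\<bar> < k / 2"
    using cont unfolding continuous_at_eps_delta dist_real_def by blast
  obtain d3 where d3: "d3 > 0" "ball r d3 \<subseteq> S" using S openE by blast
  define d where "d = min d1 (min d2 d3)"
  \<comment> \<open>The two bounds on one nondegenerate increment force \<open>c \<le> L\<close>;
    the sign is needed below to multiply an upper bound for \<open>tau a - tau b\<close> by
    \<open>L\<close>.\<close>
  have L: "L \<ge> 0"
  proof -
    have "- L * (tau r + e/2 - tau r) \<le> h (tau r) - h (tau r + e/2) \<and>
      h (tau r) - h (tau r + e/2) \<le> - c * (tau r + e/2 - tau r)"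
      by (rule *) (use e in auto)
    then have "c * (e/2) \<le> L * (e/2)" by (simp only: add_diff_cancel_left') linarith
    then have "c \<le> L" by (rule mult_right_le_imp_le) (use e in auto)
    then show ?thesis using e by simp
  qed
  show ?thesis
  proof (rule steep_atI)
    fix a b assume ab: "r - d < a" "a \<le> b" "b < r + d"
    have rng: "- (2 * k) * (b - a) \<le> tau b - tau a \<and> tau b - tau a \<le> - (k / 2) * (b - a)"
    proof (cases "a = b")
      case False
      then have "a < b" using ab by auto
      moreover have "(tau has_real_derivative tau' t) (at t)" if "a \<le> t" "t \<le> b" for t
        using that ab d3(2) by (intro tau) (auto simp: subset_eq dist_real_def d_def)
      ultimately obtain z where z: "a < z" "z < b" "tau b - tau a = (b - a) * tau' z"
        using MVT2[of a b tau tau'] by auto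
      have "\<bar>z - r\<bar> < d2" using z ab by (auto simp: d_def abs_less_iff)
      then have "\<bar>tau' z - tau' r\<bar> < k / 2" by (rule d2(2))
      then have "\<bar>tau' z + k\<bar> < k / 2" by (simp add: k_def)
      then have "- (2 * k) \<le> tau' z" "tau' z \<le> - (k / 2)" by linarith+
      then have "(b - a) * (- (2 * k)) \<le> (b - a) * tau' z" "(b - a) * tau' z \<le> (b - a) * (- (k / 2))"
        using \<open>a < b\<close> by (intro mult_left_mono; simp)+
      then show ?thesis using z by (simp only: mult.commute)
    qed auto
    have "\<bar>a - r\<bar> < d1" "\<bar>b - r\<bar> < d1" using ab by (auto simp: d_def abs_less_iff)
    then have "\<bar>tau a - tau r\<bar> < e" "\<bar>tau b - tau r\<bar> < e" using d1(2) by auto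
    moreover have "(k / 2) * (b - a) \<ge> 0" using ab \<open>k > 0\<close> by simp
    then have "tau b \<le> tau a" using rng by simp
    ultimately have "- L * (tau a - tau b) \<le> h (tau b) - h (tau a)" "h (tau b) - h (tau a) \<le> - c * (tau a - tau b)"
      using *[of "tau b" "tau a"] by (auto simp: abs_less_iff)
    moreover have "L * (tau a - tau b) \<le> L * (2 * k * (b - a))"
      using rng L by (intro mult_left_mono) auto
    moreover have "c * (tau a - tau b) \<ge> c * (k / 2 * (b - a))"
      using rng e by (intro mult_left_mono) auto
    ultimately show "- (L * (2 * k)) * (b - a) \<le> h (tau b) - h (tau a) \<and>
      h (tau b) - h (tau a) \<le> - (c * (k / 2)) * (b - a)"
      by (auto simp: algebra_simps)
  qed (use e d1 d2 d3 \<open>k > 0\<close> d_def in auto)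
qed

lemma steep_imp_lipschitz:
  fixes H :: "real \<Rightarrow> real"
  assumes H: "\<And>a b. r - e < a \<Longrightarrow> a \<le> b \<Longrightarrow> b < r + e \<Longrightarrow>
       - L * (b - a) \<le> H b - H a \<and> H b - H a \<le> - c * (b - a)"
    and e: "e > 0" "c > 0"
  shows "L \<ge> 0" and "\<bar>a - r\<bar> < e \<Longrightarrow> \<bar>b - r\<bar> < e \<Longrightarrow> \<bar>H a - H b\<bar> \<le> L * \<bar>a - b\<bar>"
proof -
  have "- L * (r + e/2 - r) \<le> H (r + e/2) - H r \<and> H (r + e/2) - H r \<le> - c * (r + e/2 - r)"
    by (rule H) (use e in auto)
  then have "c * (e/2) \<le> L * (e/2)" by (simp only: add_diff_cancel_left') linarith
  then have "c \<le> L" by (rule mult_right_le_imp_le) (use e in auto)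
  then show "L \<ge> 0" using e by simp
  have *: "\<bar>H a - H b\<bar> \<le> L * \<bar>a - b\<bar>" if "\<bar>a - r\<bar> < e" "\<bar>b - r\<bar> < e" "a \<le> b" for a b
  proof -
    have "c * (b - a) \<ge> 0" using e that by auto
    moreover have "- L * (b - a) \<le> H b - H a \<and> H b - H a \<le> - c * (b - a)"
      by (rule H) (use that in \<open>auto simp: abs_less_iff\<close>)
    ultimately have "H b \<le> H a" "H a - H b \<le> L * (b - a)" by (simp_all only: mult_minus_left) linarith+
    then show ?thesis using that by simp
  qed
  show "\<bar>H a - H b\<bar> \<le> L * \<bar>a - b\<bar>" if "\<bar>a - r\<bar> < e" "\<bar>b - r\<bar> < e"
    using *[of a b] *[of b a] that by (metis abs_minus_commute linear)
qed

text \<open>The gradient is the component of \<open>v\<close> orthogonal to \<open>u\<close>,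
  divided by \<open>norm u\<close>.\<close>

lemma GDERIV_normalized_inner:
  fixes u v :: "'a::real_inner"
  assumes "u \<noteq> 0"
  shows "GDERIV (\<lambda>y. (y /\<^sub>R norm y) \<bullet> v) u :> v /\<^sub>R norm u - ((u \<bullet> v) / norm u ^ 3) *\<^sub>R u"
  unfolding gderiv_def
  apply (rule has_derivative_eq_rhs)
   apply (auto intro!: derivative_eq_intros has_derivative_norm simp: assms)
  apply (rule ext)
  using assms
  by (simp add: inner_diff_right inner_diff_left field_simps power3_eq_cube sgn_div_norm inner_commute power2_eq_square)

lemma directional_derivative:
  fixes F :: "'a::real_inner \<Rightarrow> real"
  assumes "GDERIV F u :> g"
  shows "((\<lambda>t. F (u + t *\<^sub>R d)) has_real_derivative d \<bullet> g) (at 0)"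
proof -
  have 1: "((\<lambda>t. u + t *\<^sub>R d) has_derivative (\<lambda>t. t *\<^sub>R d)) (at 0)"
    by (auto intro!: derivative_eq_intros)
  have 2: "(F has_derivative (\<lambda>h. h \<bullet> g)) (at (u + 0 *\<^sub>R d))"
    using assms by (simp add: gderiv_def)
  have "((\<lambda>t. F (u + t *\<^sub>R d)) has_derivative (\<lambda>t. (t *\<^sub>R d) \<bullet> g)) (at 0)"
    using has_derivative_compose[where f = "\<lambda>t. u + t *\<^sub>R d" and f' = "\<lambda>t. t *\<^sub>R d" and x = 0
        and s = UNIV and g = F and g' = "\<lambda>h. h \<bullet> g", OF 1 2] .
  moreover have "(\<lambda>t. (t *\<^sub>R d) \<bullet> g) = (*) (d \<bullet> g)" by (auto simp: mult.commute)
  ultimately show ?thesis by (simp only: has_field_derivative_def)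
qed

text \<open>The profile \<open>H\<close> need not be differentiable: comparing difference quotients along
  a direction \<open>d\<close> is enough to pin down a gradient of the composition.\<close>

lemma gradient_through_steep_profile:
  fixes F k :: "'a::real_inner \<Rightarrow> real"
  assumes F: "GDERIV F u :> g" and k: "GDERIV k u :> p" and p: "p \<noteq> 0"
    and e: "e > 0" "c > 0"
    and H: "\<And>a b. k u - e < a \<Longrightarrow> a \<le> b \<Longrightarrow> b < k u + e \<Longrightarrow>
       - L * (b - a) \<le> H b - H a \<and> H b - H a \<le> - c * (b - a)"
    and FH: "eventually (\<lambda>y. F y = H (k y)) (nhds u)"
  shows "\<exists>l\<le>-c. g = l *\<^sub>R p"
proof -
  have dF: "((\<lambda>t. (F (u + t *\<^sub>R d) - F u) / t) \<longlongrightarrow> d \<bullet> g) (at_right 0)" for d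
    using directional_derivative[OF F, of d] unfolding DERIV_def
    by (auto intro: tendsto_mono[OF at_le])
  have dk: "((\<lambda>t. (k (u + t *\<^sub>R d) - k u) / t) \<longlongrightarrow> d \<bullet> p) (at_right 0)" for d
    using directional_derivative[OF k, of d] unfolding DERIV_def
    by (auto intro: tendsto_mono[OF at_le])
  have lim: "((\<lambda>t. u + t *\<^sub>R d) \<longlongrightarrow> u) (at_right 0)" for d
    by (auto intro!: tendsto_eq_intros)
  have evF: "\<forall>\<^sub>F t in at_right 0. F (u + t *\<^sub>R d) = H (k (u + t *\<^sub>R d))" for d
    using filterlim_iff[THEN iffD1, OF lim] FH by blast
  have Fu: "F u = H (k u)" by (rule eventually_nhds_x_imp_x[OF FH])
  have "isCont k u" using k unfolding gderiv_def by (rule has_derivative_continuous)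
  then have "((\<lambda>t. k (u + t *\<^sub>R d)) \<longlongrightarrow> k u) (at_right 0)" for d
    using isCont_tendsto_compose lim by blast
  then have evk: "\<forall>\<^sub>F t in at_right 0. \<bar>k (u + t *\<^sub>R d) - k u\<bar> < e" for d
    using e(1) by (auto simp: tendsto_iff dist_real_def)
  have L: "L \<ge> 0" by (rule steep_imp_lipschitz[OF H e])
  \<comment> \<open>In directions orthogonal to \<open>p\<close> this gives
    \<open>d \<bullet> g = 0\<close>, so \<open>g\<close> is parallel to \<open>p\<close>; fact 2,
    taken along \<open>p\<close> itself, then bounds the factor \<open>l\<close>.\<close>
  have 1: "\<bar>d \<bullet> g\<bar> \<le> L * \<bar>d \<bullet> p\<bar>" for d
  proof (rule tendsto_le[OF _ tendsto_mult_left[OF tendsto_rabs[OF dk]] tendsto_rabs[OF dF]])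
    show "\<forall>\<^sub>F t in at_right 0. \<bar>(F (u + t *\<^sub>R d) - F u) / t\<bar> \<le> L * \<bar>(k (u + t *\<^sub>R d) - k u) / t\<bar>"
      using evF[of d] evk[of d] eventually_at_right_less[of 0]
    proof eventually_elim
      case (elim t)
      have "\<bar>H (k (u + t *\<^sub>R d)) - H (k u)\<bar> \<le> L * \<bar>k (u + t *\<^sub>R d) - k u\<bar>"
        by (rule steep_imp_lipschitz(2)[OF H e]) (use elim e in auto)
      then show ?case using elim Fu by (auto simp: divide_simps)
    qed
  qed simp
  have 2: "p \<bullet> g \<le> - c * (p \<bullet> p)"
  proof (rule tendsto_le[OF _ tendsto_mult_left[OF dk] dF])
    have "p \<bullet> p > 0" using p by simp
    then have "\<forall>\<^sub>F t in at_right 0. (k (u + t *\<^sub>R p) - k u) / t > 0"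
      using dk[of p] order_tendstoD(1) by blast
    then show "\<forall>\<^sub>F t in at_right 0. (F (u + t *\<^sub>R p) - F u) / t \<le> - c * ((k (u + t *\<^sub>R p) - k u) / t)"
      using evF[of p] evk[of p] eventually_at_right_less[of 0]
    proof eventually_elim
      case (elim t)
      then have "k (u + t *\<^sub>R p) > k u" by (simp add: zero_less_divide_iff)
      then have "H (k (u + t *\<^sub>R p)) - H (k u) \<le> - c * (k (u + t *\<^sub>R p) - k u)"
        using H[of "k u" "k (u + t *\<^sub>R p)"] elim e by (auto simp: abs_if split: if_splits)
      then show ?case using elim Fu by (simp add: divide_simps)
    qed
  qed simp
  define l where "l = (p \<bullet> g) / (p \<bullet> p)"
  have "(g - l *\<^sub>R p) \<bullet> p = 0" using p by (simp add: l_def inner_diff_left inner_commute[of p g])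
  then have "(g - l *\<^sub>R p) \<bullet> g = 0" using 1[of "g - l *\<^sub>R p"] L by auto
  then have "(g - l *\<^sub>R p) \<bullet> (g - l *\<^sub>R p) = 0"
    using \<open>(g - l *\<^sub>R p) \<bullet> p = 0\<close> by (simp add: inner_diff_right)
  then have "g = l *\<^sub>R p" by simp
  moreover have "l \<le> - c" using 2 p by (simp add: l_def divide_simps)
  ultimately show ?thesis by blast
qed

text \<open>Gradients near \<open>x\<close> lie on rays along \<open>P u\<close>, and
  \<open>P u\<close> tends to the tangential part \<open>p\<close> of \<open>xs\<close>, so their
  limits lie in the ray \<open>A\<close>. This set is convex and is fixed by the tangential
  projection because \<open>x \<bullet> p = 0\<close>. On it the alignment inequality is an
  equality, since \<open>p \<bullet> xs\<close> is the square of \<open>norm p\<close> and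
  \<open>norm p\<close> is the sine of the angle.\<close>

lemma RGA_of_steep_profile:
  fixes f :: "'a::euclidean_space \<Rightarrow> real"
  assumes x: "norm x = 1" and xs: "norm xs = 1" and \<rho>: "0 < x \<bullet> xs" "x \<bullet> xs < 1"
    and steep: "steep_at H (x \<bullet> xs)"
    and f: "\<And>y. norm y = 1 \<Longrightarrow> 0 < y \<bullet> xs \<Longrightarrow> y \<bullet> xs < 1 \<Longrightarrow> f y = H (y \<bullet> xs)"
  shows "RGA 1 f x xs"
proof -
  define r where "r = x \<bullet> xs"
  obtain e0 c L where e0: "e0 > 0" "c > 0" and H0: "\<And>a b. r - e0 < a \<Longrightarrow> a \<le> b \<Longrightarrow> b < r + e0 \<Longrightarrow>
     - L * (b - a) \<le> H b - H a \<and> H b - H a \<le> - c * (b - a)"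
    using steep unfolding steep_at_def r_def by metis
  \<comment> \<open>Small enough to keep the correlation strictly between 0 and 1, where
    \<open>f\<close> is known to equal \<open>H\<close> of the correlation.\<close>
  define e where "e = min e0 (min r (1 - r))"
  have e: "e > 0" "e \<le> r" "e \<le> 1 - r" "e \<le> e0" using e0 \<rho> by (auto simp: e_def r_def)
  have H: "- L * (b - a) \<le> H b - H a \<and> H b - H a \<le> - c * (b - a)"
    if "r - e < a" "a \<le> b" "b < r + e" for a b using H0[of a b] that e by auto
  have L: "L \<ge> 0" by (rule steep_imp_lipschitz[OF H e(1) e0(2)])
  have f': "f y = H (y \<bullet> xs)" if "norm y = 1" "\<bar>y \<bullet> xs - r\<bar> < e" for y
    using that e by (intro f) (auto simp: abs_less_iff)

  have lip: "lipschitz_near (sphere 0 1) f x"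
    unfolding lipschitz_near_def
  proof (rule exI[of _ "e/2"], rule conjI, use e in simp, rule exI[of _ L], rule lipschitz_onI)
    fix y z assume yz: "y \<in> cball x (e/2) \<inter> sphere 0 1" "z \<in> cball x (e/2) \<inter> sphere 0 1"
    have close: "\<bar>w \<bullet> xs - r\<bar> < e" if "w \<in> cball x (e/2) \<inter> sphere 0 1" for w
    proof -
      have "\<bar>w \<bullet> xs - r\<bar> = \<bar>(w - x) \<bullet> xs\<bar>" by (simp add: r_def inner_diff_left)
      also have "\<dots> \<le> norm (w - x)" using Cauchy_Schwarz_ineq2[of "w - x" xs] xs by simp
      also have "\<dots> < e" using that e(1) by (auto simp: dist_norm norm_minus_commute)
      finally show ?thesis .
    qed
    have d: "\<bar>y \<bullet> xs - z \<bullet> xs\<bar> \<le> dist y z"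
      using Cauchy_Schwarz_ineq2[of "y - z" xs] xs by (simp add: dist_norm inner_diff_left)
    have "\<bar>f y - f z\<bar> \<le> L * \<bar>y \<bullet> xs - z \<bullet> xs\<bar>"
      using steep_imp_lipschitz(2)[OF H e(1) e0(2) close[OF yz(1)] close[OF yz(2)]] yz f' close by auto
    also have "\<dots> \<le> L * dist y z" using d L by (rule mult_left_mono)
    finally show "dist (f y) (f z) \<le> L * dist y z" by (simp add: dist_real_def)
  qed (use e L in auto)

  define k where "k = (\<lambda>y. (y /\<^sub>R norm y) \<bullet> xs)"
  define P where "P = (\<lambda>u. xs /\<^sub>R norm u - ((u \<bullet> xs) / norm u ^ 3) *\<^sub>R u)"
  define p where "p = xs - r *\<^sub>R x"
  have Px: "P x = p" using x by (simp add: P_def p_def r_def)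
  have xx: "x \<bullet> x = 1" "xs \<bullet> xs = 1" using x xs by (simp_all add: dot_square_norm)
  have pp: "p \<bullet> p = 1 - r\<^sup>2" "x \<bullet> p = 0" "p \<bullet> xs = 1 - r\<^sup>2"
    using xx by (simp_all add: p_def inner_diff_left inner_diff_right power2_eq_square inner_commute r_def)
  have r1: "1 - r\<^sup>2 > 0" using \<rho> by (simp add: r_def power_less_one_iff abs_square_less_1)
  have p0: "p \<noteq> 0" using pp r1 by auto
  define A where "A = {l *\<^sub>R p | l. l \<le> - c}"
  have "convex A"
    unfolding A_def convex_alt
  proof clarify
    fix t l m :: real assume t: "0 \<le> t" "t \<le> 1" "l \<le> - c" "m \<le> - c"
    then have "(1 - t) * l + t * m \<le> - c" by (rule_tac convex_bound_le) auto
    then show "\<exists>n. (1 - t) *\<^sub>R l *\<^sub>R p + t *\<^sub>R m *\<^sub>R p = n *\<^sub>R p \<and> n \<le> - c"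
      by (metis scaleR_left.add scaleR_scaleR)
  qed
  have kx: "k x = r" using x by (simp add: k_def r_def)
  have "isCont k x" unfolding k_def using x by (intro continuous_intros) auto
  have limit: "\<xi> \<in> A" if u: "u \<longlonglongrightarrow> x" and g: "\<And>n. GDERIV (\<lambda>y. f (y /\<^sub>R norm y)) (u n) :> g n"
    and \<xi>: "g \<longlonglongrightarrow> \<xi>" for u g \<xi>
  proof -
    have nx: "x \<noteq> 0" using x by auto
    have "(\<lambda>n. P (u n)) \<longlonglongrightarrow> P x" unfolding P_def using nx
      by (intro tendsto_intros u) auto
    then have Plim: "(\<lambda>n. P (u n)) \<longlonglongrightarrow> p" using Px by simp
    have klim: "(\<lambda>n. k (u n)) \<longlonglongrightarrow> r" using \<open>isCont k x\<close> u kx isCont_tendsto_compose by fastforce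
    have ev: "\<forall>\<^sub>F n in sequentially. u n \<noteq> 0 \<and> P (u n) \<noteq> 0 \<and> dist (k (u n)) r < e / 2"
      using tendsto_imp_eventually_ne[OF u nx] tendsto_imp_eventually_ne[OF Plim p0]
        tendstoD[OF klim, of "e/2"] e by (auto elim: eventually_elim2 intro: eventually_conj)
    have ex: "\<forall>\<^sub>F n in sequentially. \<exists>l\<le>-c. g n = l *\<^sub>R P (u n)"
      using ev
    proof eventually_elim
      case (elim n)
      show ?case
      \<comment> \<open>Since \<open>k (u n)\<close> is within \<open>e / 2\<close> of
        \<open>r\<close>, the window of radius \<open>e / 2\<close> around it stays inside the
        window of radius \<open>e\<close> around \<open>r\<close>.\<close>
      proof (rule gradient_through_steep_profile[OF g _ _ _ e0(2)])
        show "GDERIV k (u n) :> P (u n)" unfolding k_def P_def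
          using elim by (intro GDERIV_normalized_inner) auto
        show "0 < e / 2" using e by simp
        show "- L * (b - a) \<le> H b - H a \<and> H b - H a \<le> - c * (b - a)"
          if "k (u n) - e/2 < a" "a \<le> b" "b < k (u n) + e / 2" for a b
        proof (rule H)
          show "r - e < a" "b < r + e" using that elim by (simp_all add: dist_real_def abs_if split: if_splits)
        qed fact
        have "isCont k (u n)" unfolding k_def using elim by (intro continuous_intros) auto
        then have "\<forall>\<^sub>F y in nhds (u n). dist (k y) (k (u n)) < e / 2"
          using e by (auto simp: isCont_def tendsto_at_iff_tendsto_nhds dest!: tendstoD[of _ _ _ "e/2"])
        moreover have "\<forall>\<^sub>F y in nhds (u n). y \<noteq> 0" using elim
          by (intro t1_space_nhds) auto
        ultimately show "\<forall>\<^sub>F y in nhds (u n). f (y /\<^sub>R norm y) = H (k y)"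
        proof eventually_elim
          case (elim y)
          have "dist (k y) r < e"
            using dist_triangle[of "k y" r "k (u n)"] elim
              \<open>u n \<noteq> 0 \<and> P (u n) \<noteq> 0 \<and> dist (k (u n)) r < e / 2\<close> by linarith
          then show ?case unfolding k_def using elim
            by (intro f') (auto simp: dist_real_def)
        qed
      qed (use elim in auto)
    qed
    \<comment> \<open>The factor is recovered as a quotient of inner products, so that its
      convergence follows from that of \<open>g n\<close> and \<open>P (u n)\<close>.\<close>
    define l where "l = (\<lambda>n. (g n \<bullet> P (u n)) / (P (u n) \<bullet> P (u n)))"
    have l: "\<forall>\<^sub>F n in sequentially. l n \<le> - c \<and> g n = l n *\<^sub>R P (u n)"
      using ex ev by eventually_elim (auto simp: l_def)
    have llim: "l \<longlonglongrightarrow> (\<xi> \<bullet> p) / (p \<bullet> p)"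
      unfolding l_def using p0 by (intro tendsto_intros \<xi> Plim) auto
    have "(\<xi> \<bullet> p) / (p \<bullet> p) \<le> - c"
      by (rule tendsto_upperbound[OF llim]) (use l in \<open>auto elim: eventually_mono\<close>)
    moreover have "(\<lambda>n. l n *\<^sub>R P (u n)) \<longlonglongrightarrow> ((\<xi> \<bullet> p) / (p \<bullet> p)) *\<^sub>R p"
      by (intro tendsto_intros llim Plim)
    then have "g \<longlonglongrightarrow> ((\<xi> \<bullet> p) / (p \<bullet> p)) *\<^sub>R p"
      by (rule Lim_transform_eventually) (use l in \<open>auto elim: eventually_mono\<close>)
    then have "\<xi> = ((\<xi> \<bullet> p) / (p \<bullet> p)) *\<^sub>R p" using \<xi> LIMSEQ_unique by blast
    ultimately show ?thesis unfolding A_def by blast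
  qed
  have "clarke_subdiff (\<lambda>y. f (y /\<^sub>R norm y)) x \<subseteq> A"
    unfolding clarke_subdiff_def by (rule hull_minimal) (use limit \<open>convex A\<close> in auto)
  then have sub: "\<exists>l\<le>-c. g = l *\<^sub>R p" if "g \<in> riem_clarke_subdiff f x" for g
  proof -
    obtain \<xi> where \<xi>: "\<xi> \<in> A" "g = \<xi> - (x \<bullet> \<xi>) *\<^sub>R x"
      using \<open>_ \<subseteq> A\<close> \<open>g \<in> _\<close> unfolding riem_clarke_subdiff_def by blast
    then show ?thesis using pp by (auto simp: A_def)
  qed
  have s: "sin (theta x xs) = sqrt (1 - r\<^sup>2)"
    using \<rho> by (simp add: theta_def r_def sin_arccos)
  show ?thesis unfolding RGA_def
  proof (intro conjI lip ballI)
    fix g assume "g \<in> riem_clarke_subdiff f x"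
    then obtain l where l: "l \<le> - c" "g = l *\<^sub>R p" using sub by blast
    then show "x \<noteq> xs \<longrightarrow> g \<noteq> 0" using p0 e0 by auto
    have "norm p = sqrt (1 - r\<^sup>2)" by (simp add: norm_eq_sqrt_inner pp)
    then have "norm g = - l * sqrt (1 - r\<^sup>2)" using l e0 by simp
    moreover have "g \<bullet> xs = l * (1 - r\<^sup>2)" using l pp by simp
    moreover have "sqrt (1 - r\<^sup>2) * sqrt (1 - r\<^sup>2) = 1 - r\<^sup>2" using r1 by simp
    ultimately show "g \<bullet> xs \<le> - 1 * sin (theta x xs) * norm g"
      unfolding s by (simp add: mult.left_commute[of _ l] algebra_simps)
  qed
qed

subsection \<open>Orthogonal invariance of the Gaussian measure\<close>

text \<open>The change of variables theorems of the library are stated for vectors indexed by a wellordered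
  type; an arbitrary finite index type is copied into one.\<close>

typedef 'a ranked = "UNIV :: 'a set" ..

definition ranked_index :: "'a ranked \<Rightarrow> nat" where
  "ranked_index r = (SOME f::'a \<Rightarrow> nat. inj f) (Rep_ranked r)"

instantiation ranked :: (finite) wellorder
begin
definition "r \<le> s \<longleftrightarrow> ranked_index r \<le> ranked_index (s :: 'a ranked)"
definition "r < s \<longleftrightarrow> ranked_index r < ranked_index (s :: 'a ranked)"
instance
proof
  have "\<exists>f::'a \<Rightarrow> nat. inj f"
    using finite_imp_inj_to_nat_seg[OF finite[of UNIV]] by blast
  then have "inj (SOME f::'a \<Rightarrow> nat. inj f)" by (rule someI_ex)
  then have inj: "ranked_index r = ranked_index s \<Longrightarrow> r = s" for r s :: "'a ranked"
    unfolding ranked_index_def by (metis Rep_ranked_inject injD)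
  fix x y z :: "'a ranked"
  show "(x < y) = (x \<le> y \<and> \<not> y \<le> x)" "x \<le> x" "x \<le> y \<Longrightarrow> y \<le> z \<Longrightarrow> x \<le> z"
    "x \<le> y \<or> y \<le> x"
    by (auto simp: less_eq_ranked_def less_ranked_def)
  show "x \<le> y \<Longrightarrow> y \<le> x \<Longrightarrow> x = y"
    by (rule inj) (simp add: less_eq_ranked_def)
  fix P :: "'a ranked \<Rightarrow> bool" and a :: "'a ranked"
  assume step: "\<And>x. (\<And>y. y < x \<Longrightarrow> P y) \<Longrightarrow> P x"
  show "P a"
  proof (induction a rule: measure_induct_rule[of ranked_index])
    case (less x)
    show ?case by (rule step, rule less) (simp add: less_ranked_def)
  qed
qed
end

instance ranked :: (finite) finite
proof
  have "UNIV = Abs_ranked ` (UNIV :: 'a set)"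
    by (metis Abs_ranked_cases surj_def)
  then show "finite (UNIV :: 'a ranked set)" by (metis finite finite_imageI)
qed

lemma linear_borel_measurable:
  fixes T :: "'a::euclidean_space \<Rightarrow> 'b::euclidean_space"
  shows "linear T \<Longrightarrow> T \<in> borel_measurable borel"
  by (intro borel_measurable_continuous_onI linear_continuous_on linear_conv_bounded_linear[THEN iffD1])

text \<open>Boxes determine the measure, and the preimage of a box is its image under the inverse,
  again orthogonal. The image theorem speaks of Lebesgue measure, hence the passage between
  \<open>lborel\<close> and \<open>lebesgue\<close>.\<close>

lemma lborel_orthogonal_wellorder:
  fixes T :: "real ^ 'n::{finite,wellorder} \<Rightarrow> real ^ 'n::_"
  assumes T: "orthogonal_transformation T"
  shows "distr lborel borel T = lborel"
proof (rule lborel_eqI[symmetric])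
  have [measurable]: "T \<in> borel_measurable borel"
    using T linear_borel_measurable orthogonal_transformation_linear by blast
  fix l u :: "real ^ 'n::_" assume lu: "\<And>b. b \<in> Basis \<Longrightarrow> l \<bullet> b \<le> u \<bullet> b"
  have bij: "bij T" using T orthogonal_transformation_bij by blast
  have S: "orthogonal_transformation (inv T)" using T orthogonal_transformation_inv by blast
  have "T -` box l u = inv T ` box l u" using bij by (simp add: bij_vimage_eq_inv_image)
  then have "emeasure (distr lborel borel T) (box l u) = emeasure lborel (inv T ` box l u)"
    by (simp add: emeasure_distr)
  also have "\<dots> = emeasure lebesgue (inv T ` box l u)"
    using measurable_sets_borel[of T borel "box l u"] \<open>T -` box l u = inv T ` box l u\<close>
    by (simp add: emeasure_completion)
  also have "\<dots> = ennreal (measure lebesgue (inv T ` box l u))"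
    using measurable_orthogonal_image[OF S, of "box l u"] by (simp add: emeasure_eq_measure2 fmeasurableD2)
  also have "\<dots> = ennreal (measure lebesgue (box l u))"
    using measure_orthogonal_image[OF S, of "box l u"] by simp
  also have "\<dots> = (\<Prod>b\<in>Basis. (u - l) \<bullet> b)"
    using lu by (simp add: measure_completion)
  finally show "emeasure (distr lborel borel T) (box l u) = (\<Prod>b\<in>Basis. (u - l) \<bullet> b)" .
qed simp

definition relabel :: "('n \<Rightarrow> 'm) \<Rightarrow> real ^ 'm \<Rightarrow> real ^ 'n" where
  "relabel g z = (\<chi> i. z $ g i)"

lemma linear_relabel: "linear (relabel g)"
  by (rule linearI) (simp_all add: relabel_def vec_eq_iff)

lemma inner_relabel:
  fixes g :: "'n::finite \<Rightarrow> 'm::finite"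
  assumes "bij g"
  shows "relabel g x \<bullet> relabel g y = x \<bullet> y"
  unfolding inner_vec_def relabel_def vec_lambda_beta
  by (rule sum.reindex_bij_betw[OF assms])

lemma prod_Basis_vec: "(\<Prod>b\<in>Basis. f b) = (\<Prod>k\<in>UNIV. f (axis k 1))" for f :: "real ^ 'k \<Rightarrow> 'b::comm_monoid_mult"
proof -
  have *: "Basis = range (\<lambda>k::'k. axis k (1::real))" by (auto simp: Basis_vec_def)
  show ?thesis unfolding * by (simp add: prod.reindex inj_on_def axis_eq_axis)
qed

text \<open>The preimage of a box is the box with its sides permuted, which leaves the product of
  side lengths unchanged.\<close>

lemma lborel_relabel:
  fixes g :: "'n::finite \<Rightarrow> 'm::finite"
  assumes g: "bij g"
  shows "distr lborel borel (relabel g) = lborel"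
proof (rule lborel_eqI[symmetric])
  have [measurable]: "relabel g \<in> borel_measurable borel"
    by (rule linear_borel_measurable[OF linear_relabel])
  fix l u :: "real ^ 'n::_" assume lu: "\<And>b. b \<in> Basis \<Longrightarrow> l \<bullet> b \<le> u \<bullet> b"
  let ?h = "relabel (inv g)"
  have gi: "g (inv g i) = i" "inv g (g j) = j" for i j
    using g by (simp_all add: bij_is_surj surj_f_inv_f bij_is_inj)
  have all: "(\<forall>i. Q (g i) i) \<longleftrightarrow> (\<forall>m. Q m (inv g m))" for Q
    by (metis gi)
  have "x \<in> relabel g -` box l u \<longleftrightarrow> x \<in> box (?h l) (?h u)" for x
    unfolding vimage_eq mem_box_cart relabel_def vec_lambda_beta
    by (rule all)
  then have "relabel g -` box l u = box (?h l) (?h u)" by blast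
  moreover have "emeasure lborel (box (?h l) (?h u)) = (\<Prod>b\<in>Basis. (?h u - ?h l) \<bullet> b)"
  proof (rule emeasure_lborel_box)
    have "l $ i \<le> u $ i" for i
      using lu[of "axis i 1"] by (auto simp: inner_axis Basis_vec_def)
    then show "?h l \<bullet> b \<le> ?h u \<bullet> b" if "b \<in> Basis" for b
      using that by (auto simp: Basis_vec_def inner_axis relabel_def)
  qed
  moreover have "(\<Prod>b\<in>Basis. (?h u - ?h l) \<bullet> b) = (\<Prod>b\<in>Basis. (u - l) \<bullet> b)"
    unfolding prod_Basis_vec by (rule prod.reindex_bij_witness[of _ g "inv g"]) (auto simp: gi relabel_def inner_axis)
  ultimately show "emeasure (distr lborel borel (relabel g)) (box l u) = (\<Prod>b\<in>Basis. (u - l) \<bullet> b)"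
    by (simp add: emeasure_distr)
qed simp

text \<open>\<open>T\<close> is conjugated to an orthogonal map on vectors indexed by the
  wellordered copy; the two relabellings preserve Lebesgue measure.\<close>

lemma lborel_orthogonal:
  fixes T :: "real ^ 'n::finite \<Rightarrow> real ^ 'n::_"
  assumes T: "orthogonal_transformation T"
  shows "distr lborel borel T = lborel"
proof -
  let ?R = "relabel Abs_ranked :: real ^ 'n ranked \<Rightarrow> real ^ 'n"
  let ?L = "relabel Rep_ranked :: real ^ 'n \<Rightarrow> real ^ 'n ranked"
  have bij: "bij (Abs_ranked :: 'n \<Rightarrow> _)" "bij (Rep_ranked :: _ \<Rightarrow> 'n)"
    by (auto intro!: bijI' simp: Abs_ranked_inject Rep_ranked_inject) (metis Rep_ranked_inverse, metis Abs_ranked_inverse UNIV_I)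
  have RL: "?R (?L z) = z" for z by (simp add: relabel_def vec_eq_iff Abs_ranked_inverse)
  have lin: "linear T" using T orthogonal_transformation_linear by blast
  have [measurable]: "T \<in> borel_measurable borel" "?R \<in> borel_measurable borel" "?L \<in> borel_measurable borel"
    by (intro linear_borel_measurable lin linear_relabel)+
  have "linear (?L \<circ> T \<circ> ?R)" by (intro linear_compose lin linear_relabel)
  then have "orthogonal_transformation (?L \<circ> T \<circ> ?R)"
    using T bij by (simp add: orthogonal_transformation_def inner_relabel)
  then have *: "distr lborel borel (?L \<circ> T \<circ> ?R) = lborel" by (rule lborel_orthogonal_wellorder)
  have "distr lborel borel T = distr (distr lborel borel ?R) borel T"
    by (simp add: lborel_relabel bij)
  also have "\<dots> = distr lborel borel (T \<circ> ?R)" by (simp add: distr_distr)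
  also have "\<dots> = distr lborel borel (?R \<circ> (?L \<circ> T \<circ> ?R))"
    by (rule arg_cong[where f = "distr lborel borel"]) (auto simp: RL)
  also have "\<dots> = distr (distr lborel borel (?L \<circ> T \<circ> ?R)) borel ?R" by (simp add: distr_distr)
  also have "\<dots> = lborel" by (simp add: * lborel_relabel bij)
  finally show ?thesis .
qed

abbreviation gauss_density :: "real \<Rightarrow> real" (\<open>\<phi>\<close>) where "\<phi> \<equiv> std_normal_density"

lemma prod_std_normal_density:
  fixes z :: "real ^ 'n"
  shows "(\<Prod>i\<in>UNIV. \<phi> (z $ i)) = (1 / sqrt (2 * pi)) ^ CARD('n) * exp (- (norm z)\<^sup>2 / 2)"
proof -
  have "(norm z)\<^sup>2 = (\<Sum>i\<in>UNIV. (z $ i)\<^sup>2)"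
    unfolding power2_norm_eq_inner inner_vec_def by (simp add: power2_eq_square)
  then show ?thesis
    unfolding std_normal_density_def prod.distrib prod_constant exp_sum[symmetric, OF finite]
    by (simp add: sum_negf sum_divide_distrib)
qed

text \<open>Lebesgue measure is invariant, and so is the density, being a function of the
  norm.\<close>

lemma gauss_orthogonal:
  fixes T :: "real ^ 'n \<Rightarrow> real ^ 'n"
  assumes T: "orthogonal_transformation T"
  shows "distr gauss borel T = gauss"
proof (rule measure_eqI)
  have [measurable]: "T \<in> borel_measurable borel"
    using T linear_borel_measurable orthogonal_transformation_linear by blast
  let ?g = "\<lambda>z::real^'n. ennreal (\<Prod>i\<in>UNIV. \<phi> (z $ i))"
  have [measurable]: "?g \<in> borel_measurable borel" by measurable
  have gT: "?g (T z) = ?g z" for z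
    using T by (simp only: prod_std_normal_density orthogonal_transformation_norm)
  fix A assume "A \<in> sets (distr gauss borel T)"
  then have [measurable]: "A \<in> sets borel" by simp
  have "emeasure (distr gauss borel T) A = (\<integral>\<^sup>+z. ?g z * indicator (T -` A) z \<partial>lborel)"
    by (simp add: emeasure_distr gauss_def emeasure_density measurable_sets_borel[of T borel])
  also have "\<dots> = (\<integral>\<^sup>+z. ?g (T z) * indicator A (T z) \<partial>lborel)"
    by (simp only: gT) (simp add: indicator_def)
  also have "\<dots> = (\<integral>\<^sup>+z. ?g z * indicator A z \<partial>distr lborel borel T)"
    by (subst nn_integral_distr) auto
  also have "\<dots> = emeasure gauss A"
    by (simp add: lborel_orthogonal[OF T] gauss_def emeasure_density)
  finally show "emeasure (distr gauss borel T) A = emeasure gauss A" .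
qed (simp add: gauss_def)

text \<open>Take an orthogonal \<open>T\<close> sending \<open>axis i 1\<close> to \<open>u\<close>,
  and let \<open>w\<close> be the preimage of \<open>v\<close>. The Householder reflection
  \<open>S\<close> along \<open>h = w - axis j 1\<close> sends \<open>axis j 1\<close> to
  \<open>w\<close>, and it fixes \<open>axis i 1\<close>, which is orthogonal to both
  \<open>w\<close> and \<open>axis j 1\<close>. The composition does both jobs.\<close>

lemma orthogonal_transformation_two:
  fixes u v :: "real ^ 'n"
  assumes u: "norm u = 1" and v: "norm v = 1" and uv: "u \<bullet> v = 0" and ij: "i \<noteq> j"
  obtains T :: "real ^ 'n \<Rightarrow> real ^ 'n"
  where "orthogonal_transformation T" "T (axis i 1) = u" "T (axis j 1) = v"
proof -
  obtain T :: "real ^ 'n \<Rightarrow> real ^ 'n" where T: "orthogonal_transformation T" "T (axis i 1) = u"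
    by (rule orthogonal_transformation_exists_1[OF norm_axis_1[of i] u])
  have "surj T" using T orthogonal_transformation_surj by blast
  then obtain w where w: "T w = v" by (metis surjD)
  have nw: "norm w = 1" using w v T by (metis orthogonal_transformation_norm)
  have aw: "axis i 1 \<bullet> w = 0"
    using uv T w by (metis orthogonal_transformation_def)
  define h where "h = w - axis j 1"
  define S where "S y = y - (2 * (y \<bullet> h) / (h \<bullet> h)) *\<^sub>R h" for y
  have ww: "w \<bullet> w = 1" using nw by (simp add: dot_square_norm)
  have jj: "axis j 1 \<bullet> (axis j 1 :: real^'n) = 1" by (simp add: inner_axis)
  have "linear S"
    by (rule linearI) (simp_all add: S_def inner_add_left algebra_simps add_divide_distrib scaleR_add_left)
  moreover have "S y \<bullet> S z = y \<bullet> z" for y z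
    by (cases "h = 0") (simp_all add: S_def inner_diff_left inner_diff_right inner_commute field_simps)
  ultimately have S: "orthogonal_transformation S" by (simp add: orthogonal_transformation_def)
  have Si: "S (axis i 1) = axis i 1"
    using aw ij by (simp add: S_def h_def inner_diff_right inner_axis_axis)
  have Sj: "S (axis j 1) = w"
  proof (cases "h = 0")
    case False
    have "h \<bullet> h = 2 - 2 * (axis j 1 \<bullet> w)"
      using ww jj by (simp add: h_def inner_diff_left inner_diff_right inner_commute)
    moreover have "axis j 1 \<bullet> h = (axis j 1 \<bullet> w) - 1" using jj by (simp add: h_def inner_diff_right)
    ultimately have "2 * (axis j 1 \<bullet> h) = - (h \<bullet> h)" by simp
    then have "2 * (axis j 1 \<bullet> h) / (h \<bullet> h) = -1" using False by simp
    then show ?thesis by (simp add: S_def h_def)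
  qed (simp add: S_def h_def)
  show ?thesis
  proof (rule that[of "T \<circ> S"])
    show "orthogonal_transformation (T \<circ> S)" using T S orthogonal_transformation_compose by blast
  qed (use Si Sj T w in auto)
qed

section \<open>Standard Gaussian measures on the line and in the plane\<close>

lemma sets_gauss1 [simp, measurable_cong]: "sets gauss1 = sets borel"
  and space_gauss1 [simp]: "space gauss1 = UNIV"
  by (simp_all add: gauss1_def)

lemma sets_gauss [simp, measurable_cong]: "sets gauss = sets borel"
  and space_gauss [simp]: "space gauss = UNIV"
  by (simp_all add: gauss_def)

lemma prob_space_gauss1: "prob_space gauss1"
  unfolding gauss1_def by (rule prob_space_normal_density) simp

interpretation gauss1: prob_space gauss1 by (rule prob_space_gauss1)
interpretation gauss11: pair_prob_space gauss1 gauss1 ..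

abbreviation gauss2 :: "(real \<times> real) measure" where "gauss2 \<equiv> gauss1 \<Otimes>\<^sub>M gauss1"

lemma emeasure_gauss1: "A \<in> sets borel \<Longrightarrow> emeasure gauss1 A = (\<integral>\<^sup>+x. ennreal (\<phi> x) * indicator A x \<partial>lborel)"
  by (simp add: gauss1_def emeasure_density)

lemma emeasure_gauss_two:
  fixes i j :: "'n::finite"
  assumes ij: "i \<noteq> j" and [measurable]: "A \<in> sets borel" "B \<in> sets borel"
  shows "emeasure gauss {z. z $ i \<in> A \<and> z $ j \<in> B} = emeasure gauss1 A * emeasure gauss1 B"
proof -
  let ?S = "{z :: real ^ 'n. z $ i \<in> A \<and> z $ j \<in> B}"
  \<comment> \<open>Weights that put the two events into the factorised density; every coordinate
    other than \<open>i\<close> and \<open>j\<close> has weight 1 and contributes total mass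
    1.\<close>
  define w :: "real ^ 'n \<Rightarrow> real \<Rightarrow> ennreal" where
    "w b x = (if b = axis i 1 then indicator A x else 1) * (if b = axis j 1 then indicator B x else 1)" for b x
  have [measurable]: "w b \<in> borel_measurable borel" for b unfolding w_def by measurable
  have S[measurable]: "?S \<in> sets borel" by measurable
  have D: "(\<Prod>k\<in>UNIV. (if k = i then a k else 1) * (if k = j then b k else 1)) = a i * b j"
    for a b :: "'n \<Rightarrow> ennreal" by (simp add: prod.distrib prod.delta)
  have "emeasure gauss ?S = (\<integral>\<^sup>+z. (\<Prod>b\<in>Basis. ennreal (\<phi> (z \<bullet> b)) * w b (z \<bullet> b)) \<partial>lborel)"
    unfolding gauss_def
    by (subst emeasure_density)
       (auto simp: prod_Basis_vec inner_axis prod.distrib w_def axis_eq_axis prod_ennreal indicator_def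
         intro!: nn_integral_cong split: if_splits)
  also have "\<dots> = (\<Prod>b\<in>Basis. (\<integral>\<^sup>+x. ennreal (\<phi> x) * w b x \<partial>lborel))"
    by (rule nn_integral_lborel_prod) auto
  also have "\<dots> = (\<Prod>k\<in>UNIV. (if k = i then emeasure gauss1 A else 1) * (if k = j then emeasure gauss1 B else 1))"
    unfolding prod_Basis_vec
  proof (rule prod.cong)
    fix k :: 'n
    have "(\<integral>\<^sup>+x. ennreal (\<phi> x) \<partial>lborel) = 1"
      using gauss1.emeasure_space_1 by (simp add: emeasure_gauss1)
    then show "(\<integral>\<^sup>+x. ennreal (\<phi> x) * w (axis k 1) x \<partial>lborel) =
        (if k = i then emeasure gauss1 A else 1) * (if k = j then emeasure gauss1 B else 1)"
      using ij by (auto simp: w_def axis_eq_axis emeasure_gauss1)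
  qed simp
  also have "\<dots> = emeasure gauss1 A * emeasure gauss1 B" by (rule D)
  finally show ?thesis .
qed

text \<open>Reduces all risks to two independent standard normal variables, whatever the dimension:
  rotate the orthonormal pair to two coordinate axes.\<close>

lemma gauss_orthonormal_pair:
  fixes u v :: "real ^ 'n"
  assumes u: "norm u = 1" and v: "norm v = 1" and uv: "u \<bullet> v = 0"
  shows "distr gauss (borel \<Otimes>\<^sub>M borel) (\<lambda>z. (u \<bullet> z, v \<bullet> z)) = gauss2"
proof -
  \<comment> \<open>In dimension one two unit vectors cannot be orthogonal.\<close>
  have "\<exists>i j::'n. i \<noteq> j"
  proof (rule ccontr)
    assume "\<not> ?thesis"
    then have U: "UNIV = {k::'n}" for k by auto
    have "u \<bullet> v = u $ k * v $ k" for k by (simp add: inner_vec_def U[of k])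
    then have "u $ k = 0 \<or> v $ k = 0" for k using uv by simp
    then have "u = 0 \<or> v = 0" using U by (metis UNIV_I singletonD vec_eq_iff zero_index)
    then show False using u v by auto
  qed
  then obtain i j :: 'n where ij: "i \<noteq> j" by blast
  obtain T :: "real ^ 'n \<Rightarrow> real ^ 'n"
    where T: "orthogonal_transformation T" "T (axis i 1) = u" "T (axis j 1) = v"
    by (rule orthogonal_transformation_two[OF u v uv ij])
  have [measurable]: "T \<in> borel_measurable borel"
    using T linear_borel_measurable orthogonal_transformation_linear by blast
  have uT: "u \<bullet> T z = z $ i" "v \<bullet> T z = z $ j" for z
    using T by (metis inner_axis inner_commute inner_real_def mult.right_neutral orthogonal_transformation_def)+
  have "distr gauss (borel \<Otimes>\<^sub>M borel) (\<lambda>z. (u \<bullet> z, v \<bullet> z))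
      = distr (distr gauss borel T) (borel \<Otimes>\<^sub>M borel) (\<lambda>z. (u \<bullet> z, v \<bullet> z))"
    by (simp add: gauss_orthogonal T)
  also have "\<dots> = distr gauss (borel \<Otimes>\<^sub>M borel) (\<lambda>z. (z $ i, z $ j))"
    by (subst distr_distr) (auto simp: comp_def uT)
  also have "\<dots> = gauss2"
  proof (rule pair_measure_eqI[symmetric])
    fix A B :: "real set" assume "A \<in> sets gauss1" "B \<in> sets gauss1"
    then show "emeasure gauss1 A * emeasure gauss1 B =
        emeasure (distr gauss (borel \<Otimes>\<^sub>M borel) (\<lambda>z. (z $ i, z $ j))) (A \<times> B)"
      by (subst emeasure_distr) (auto simp: emeasure_gauss_two[OF ij, symmetric] vimage_def)
  qed (auto intro!: sets_pair_measure_cong gauss1.sigma_finite_measure_axioms)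
  finally show ?thesis .
qed

text \<open>The previous lemma applied in dimension two to the rows of a reflection matrix. A
  reflection is used instead of a rotation because it is its own inverse.\<close>

lemma gauss2_reflect:
  fixes c d :: real
  assumes "c\<^sup>2 + d\<^sup>2 = 1"
  shows "distr gauss2 (borel \<Otimes>\<^sub>M borel) (\<lambda>(s, w). (c * s + d * w, d * s - c * w)) = gauss2"
proof -
  have dot: "vector [a, b] \<bullet> z = a * z $ 1 + b * z $ 2" for a b and z :: "real ^ 2"
    by (simp add: inner_vec_def sum_2)
  have nrm: "norm (vector [a, b] :: real ^ 2) = 1" if "a\<^sup>2 + b\<^sup>2 = 1" for a b
    using that by (simp add: norm_eq_sqrt_inner dot power2_eq_square)
  have 1: "distr gauss (borel \<Otimes>\<^sub>M borel) (\<lambda>z::real^2. (z $ 1, z $ 2)) = gauss2"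
    using gauss_orthonormal_pair[of "vector [1, 0] :: real^2" "vector [0, 1]"] by (simp add: nrm dot)
  have 2: "distr gauss (borel \<Otimes>\<^sub>M borel) (\<lambda>z::real^2. (c * z $ 1 + d * z $ 2, d * z $ 1 - c * z $ 2)) = gauss2"
    using gauss_orthonormal_pair[of "vector [c, d] :: real^2" "vector [d, - c]"] assms
    by (simp add: nrm dot add.commute)
  have "distr gauss2 (borel \<Otimes>\<^sub>M borel) (\<lambda>(s, w). (c * s + d * w, d * s - c * w)) =
    distr (distr gauss (borel \<Otimes>\<^sub>M borel) (\<lambda>z::real^2. (z $ 1, z $ 2))) (borel \<Otimes>\<^sub>M borel)
      (\<lambda>(s, w). (c * s + d * w, d * s - c * w))" by (simp add: 1)
  also have "\<dots> = distr gauss (borel \<Otimes>\<^sub>M borel) (\<lambda>z::real^2. (c * z $ 1 + d * z $ 2, d * z $ 1 - c * z $ 2))"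
    by (subst distr_distr) (auto simp: comp_def)
  finally show ?thesis using 2 by simp
qed

text \<open>The standard deviation of one coordinate of a standard normal pair with correlation
  \<open>r\<close>, conditionally on the other.\<close>

abbreviation kap :: "real \<Rightarrow> real" where "kap r \<equiv> sqrt (1 - r\<^sup>2)"

lemma kap_sq: "-1 \<le> r \<Longrightarrow> r \<le> 1 \<Longrightarrow> (kap r)\<^sup>2 = 1 - r\<^sup>2" "-1 \<le> r \<Longrightarrow> r \<le> 1 \<Longrightarrow> r\<^sup>2 + (kap r)\<^sup>2 = 1"
  using abs_le_square_iff[of r 1] by auto

lemma kap_bounds: "0 < r \<Longrightarrow> r < 1 \<Longrightarrow> 0 < kap r" "0 < r \<Longrightarrow> r < 1 \<Longrightarrow> kap r < 1"
  using abs_square_less_1[of r] by (auto simp: zero_less_power)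

text \<open>Gram-Schmidt: \<open>v\<close> is the normalised component of \<open>xs\<close>
  orthogonal to \<open>x\<close>, so \<open>x \<bullet> z\<close> and \<open>v \<bullet> z\<close>
  are independent standard normal variables.\<close>

lemma gauss_pair_integral:
  fixes x xs :: "real ^ 'n" and h :: "real \<times> real \<Rightarrow> real"
  assumes x: "norm x = 1" and xs: "norm xs = 1" and r: "0 < x \<bullet> xs" "x \<bullet> xs < 1"
    and [measurable]: "h \<in> borel_measurable (borel \<Otimes>\<^sub>M borel)"
  shows "(LINT z|gauss. h (x \<bullet> z, xs \<bullet> z)) =
    (LINT p|gauss2. h (fst p, (x \<bullet> xs) * fst p + kap (x \<bullet> xs) * snd p))"
proof -
  define r where "r = x \<bullet> xs"
  have k: "kap r > 0" using kap_bounds r by (simp add: r_def)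
  have xx: "x \<bullet> x = 1" "xs \<bullet> xs = 1" using x xs by (simp_all add: dot_square_norm)
  define v where "v = (xs - r *\<^sub>R x) /\<^sub>R kap r"
  have "(xs - r *\<^sub>R x) \<bullet> (xs - r *\<^sub>R x) = 1 - r\<^sup>2"
    using xx by (simp add: inner_diff_left inner_diff_right r_def inner_commute power2_eq_square)
  then have "norm (xs - r *\<^sub>R x) = kap r" by (simp add: norm_eq_sqrt_inner)
  then have v: "norm v = 1" using k by (simp add: v_def)
  have xv: "x \<bullet> v = 0" using xx by (simp add: v_def inner_diff_right r_def)
  have "xs = r *\<^sub>R x + kap r *\<^sub>R v" using k by (simp add: v_def)
  then have xsz: "xs \<bullet> z = r * (x \<bullet> z) + kap r * (v \<bullet> z)" for z
    by (metis inner_add_left inner_scaleR_left)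
  have "(LINT p|gauss2. h (fst p, r * fst p + kap r * snd p)) =
    (LINT p|distr gauss (borel \<Otimes>\<^sub>M borel) (\<lambda>z. (x \<bullet> z, v \<bullet> z)). h (fst p, r * fst p + kap r * snd p))"
    by (simp add: gauss_orthonormal_pair[OF x v xv])
  also have "\<dots> = (LINT z|gauss. h (x \<bullet> z, r * (x \<bullet> z) + kap r * (v \<bullet> z)))"
    by (subst integral_distr) auto
  finally show ?thesis by (simp add: xsz r_def[symmetric])
qed

lemma
  fixes h :: "real \<times> real \<Rightarrow> real"
  assumes cd: "c\<^sup>2 + d\<^sup>2 = 1" and [measurable]: "h \<in> borel_measurable (borel \<Otimes>\<^sub>M borel)"
  shows gauss2_reflect_integral: "(LINT p|gauss2. h (c * fst p + d * snd p, d * fst p - c * snd p)) = (LINT p|gauss2. h p)"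
    and gauss2_reflect_integrable: "integrable gauss2 (\<lambda>p. h (c * fst p + d * snd p, d * fst p - c * snd p)) \<longleftrightarrow> integrable gauss2 h"
proof -
  let ?R = "\<lambda>(s::real, w). (c * s + d * w, d * s - c * w)"
  have R: "?R = (\<lambda>p. (c * fst p + d * snd p, d * fst p - c * snd p))" by auto
  show "(LINT p|gauss2. h (c * fst p + d * snd p, d * fst p - c * snd p)) = (LINT p|gauss2. h p)"
    by (subst (2) gauss2_reflect[OF cd, symmetric], subst integral_distr) (auto simp: R)
  show "integrable gauss2 (\<lambda>p. h (c * fst p + d * snd p, d * fst p - c * snd p)) \<longleftrightarrow> integrable gauss2 h"
    by (subst (2) gauss2_reflect[OF cd, symmetric], subst integrable_distr_eq) (auto simp: R)
qed

lemma
  fixes f :: "real \<Rightarrow> real"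
  assumes [measurable]: "f \<in> borel_measurable borel"
  shows gauss2_fst_integral: "(LINT p|gauss2. f (fst p)) = (LINT s|gauss1. f s)"
    and gauss2_fst_integrable: "integrable gauss2 (\<lambda>p. f (fst p)) \<longleftrightarrow> integrable gauss1 f"
proof -
  have D: "distr gauss2 gauss1 fst = gauss1" by (rule gauss1.distr_pair_fst)
  show "(LINT p|gauss2. f (fst p)) = (LINT s|gauss1. f s)"
    by (subst (2) D[symmetric], subst integral_distr) auto
  show "integrable gauss2 (\<lambda>p. f (fst p)) \<longleftrightarrow> integrable gauss1 f"
    by (subst (2) D[symmetric], subst integrable_distr_eq) auto
qed

lemma
  fixes f :: "real \<Rightarrow> real"
  assumes cd: "c\<^sup>2 + d\<^sup>2 = 1" and [measurable]: "f \<in> borel_measurable borel"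
  shows gauss2_lin_integral: "(LINT p|gauss2. f (c * fst p + d * snd p)) = (LINT s|gauss1. f s)"
    and gauss2_lin_integrable: "integrable gauss2 (\<lambda>p. f (c * fst p + d * snd p)) \<longleftrightarrow> integrable gauss1 f"
  using gauss2_reflect_integral[OF cd, of "\<lambda>p. f (fst p)"] gauss2_reflect_integrable[OF cd, of "\<lambda>p. f (fst p)"]
  by (simp_all add: gauss2_fst_integral gauss2_fst_integrable)

text \<open>The pair is exchangeable: the reflection with entries \<open>r\<close> and
  \<open>kap r\<close> interchanges its two components.\<close>

lemma gauss2_swap_integral:
  fixes h :: "real \<times> real \<Rightarrow> real"
  assumes r: "-1 \<le> r" "r \<le> 1" and [measurable]: "h \<in> borel_measurable (borel \<Otimes>\<^sub>M borel)"
  shows "(LINT p|gauss2. h (r * fst p + kap r * snd p, fst p)) = (LINT p|gauss2. h (fst p, r * fst p + kap r * snd p))"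
proof -
  have "r * (r * s + kap r * w) + kap r * (kap r * s - r * w) = (r\<^sup>2 + (kap r)\<^sup>2) * s" for s w
    by (simp add: algebra_simps power2_eq_square)
  then have *: "r * (r * s + kap r * w) + kap r * (kap r * s - r * w) = s" for s w
    using kap_sq(2)[OF r] by simp
  show ?thesis
    using gauss2_reflect_integral[OF kap_sq(2)[OF r], of "\<lambda>p. h (fst p, r * fst p + kap r * snd p)"]
    by (simp add: *)
qed

subsection \<open>Square-integrable functions and the Ornstein-Uhlenbeck operator\<close>

definition L2 :: "(real \<Rightarrow> real) \<Rightarrow> bool" where
  "L2 f \<longleftrightarrow> f \<in> borel_measurable borel \<and> integrable gauss1 (\<lambda>t. (f t)\<^sup>2)"

lemma L2_measurable [measurable_dest]: "L2 f \<Longrightarrow> f \<in> borel_measurable borel"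
  by (simp add: L2_def)

lemma L2_bound:
  assumes "L2 g" "f \<in> borel_measurable borel" "\<And>t. \<bar>f t\<bar> \<le> \<bar>g t\<bar>"
  shows "L2 f"
  unfolding L2_def
proof
  show "integrable gauss1 (\<lambda>t. (f t)\<^sup>2)"
    by (rule integrable_bound_L[of _ "\<lambda>t. (g t)\<^sup>2"])
       (use assms in \<open>auto simp: L2_def abs_le_square_iff[symmetric]\<close>)
qed fact

lemma L2_const [simp]: "L2 (\<lambda>_. c)" by (simp add: L2_def)

lemma L2_cmult: "L2 f \<Longrightarrow> L2 (\<lambda>t. c * f t)" by (auto simp: L2_def power_mult_distrib)

lemma L2_add:
  assumes "L2 f" "L2 g" shows "L2 (\<lambda>t. f t + g t)"
  unfolding L2_def
proof
  show "integrable gauss1 (\<lambda>t. (f t + g t)\<^sup>2)"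
  proof (rule integrable_bound_L[of _ "\<lambda>t. 2 * (f t)\<^sup>2 + 2 * (g t)\<^sup>2"])
    have "(a + b)\<^sup>2 \<le> 2 * a\<^sup>2 + 2 * b\<^sup>2" for a b :: real
      using zero_le_power2[of "a - b"] by (simp add: power2_sum power2_diff)
    then show "AE t in gauss1. norm ((f t + g t)\<^sup>2) \<le> norm (2 * (f t)\<^sup>2 + 2 * (g t)\<^sup>2)" by simp
  qed (use assms in \<open>auto simp: L2_def\<close>)
qed (use assms in \<open>auto simp: L2_def\<close>)

lemma L2_diff: "L2 f \<Longrightarrow> L2 g \<Longrightarrow> L2 (\<lambda>t. f t - g t)"
  using L2_add[of f "\<lambda>t. - 1 * g t"] L2_cmult[of g "-1"] by simp

lemma L2_abs: "L2 f \<Longrightarrow> L2 (\<lambda>t. \<bar>f t\<bar>)" by (auto simp: L2_def)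

lemma abs_mult_le_sum_squares: "\<bar>a * b\<bar> \<le> a\<^sup>2 + b\<^sup>2" for a b :: real
proof -
  have "2 * \<bar>a\<bar> * \<bar>b\<bar> \<le> a\<^sup>2 + b\<^sup>2" using sum_squares_bound[of "\<bar>a\<bar>" "\<bar>b\<bar>"] by simp
  moreover have "0 \<le> \<bar>a\<bar> * \<bar>b\<bar>" by simp
  ultimately show ?thesis unfolding abs_mult by linarith
qed

lemma L2_integrable_mult:
  assumes "L2 f" "L2 g" shows "integrable gauss1 (\<lambda>t. f t * g t)"
proof (rule integrable_bound_L[of _ "\<lambda>t. (f t)\<^sup>2 + (g t)\<^sup>2"])
  show "AE t in gauss1. norm (f t * g t) \<le> norm ((f t)\<^sup>2 + (g t)\<^sup>2)"
    by (simp add: abs_mult_le_sum_squares)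
qed (use assms in \<open>auto simp: L2_def\<close>)

lemma L2_integrable: "L2 f \<Longrightarrow> integrable gauss1 f"
  using L2_integrable_mult[of f "\<lambda>_. 1"] by simp

lemma L2_integrable2:
  assumes "L2 f" "L2 g" and ab: "a\<^sup>2 + b\<^sup>2 = 1" and cd: "c\<^sup>2 + d\<^sup>2 = 1"
  shows "integrable gauss2 (\<lambda>p. f (a * fst p + b * snd p) * g (c * fst p + d * snd p))"
proof -
  have [measurable]: "f \<in> borel_measurable borel" "g \<in> borel_measurable borel"
    using assms by (auto simp: L2_def)
  show ?thesis
  proof (rule integrable_bound_L[of _
      "\<lambda>p. (f (a * fst p + b * snd p))\<^sup>2 + (g (c * fst p + d * snd p))\<^sup>2"])
    have "integrable gauss2 (\<lambda>p. (f (a * fst p + b * snd p))\<^sup>2)"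
      using gauss2_lin_integrable[OF ab, of "\<lambda>t. (f t)\<^sup>2"] assms by (simp add: L2_def)
    moreover have "integrable gauss2 (\<lambda>p. (g (c * fst p + d * snd p))\<^sup>2)"
      using gauss2_lin_integrable[OF cd, of "\<lambda>t. (g t)\<^sup>2"] assms by (simp add: L2_def)
    ultimately show "integrable gauss2 (\<lambda>p. (f (a * fst p + b * snd p))\<^sup>2 + (g (c * fst p + d * snd p))\<^sup>2)"
      by simp
    show "AE p in gauss2. norm (f (a * fst p + b * snd p) * g (c * fst p + d * snd p))
      \<le> norm ((f (a * fst p + b * snd p))\<^sup>2 + (g (c * fst p + d * snd p))\<^sup>2)"
      by (simp add: abs_mult_le_sum_squares)
  qed measurable
qed

text \<open>The density of \<open>N(c, q\<^sup>2)\<close> with \<open>q < 1\<close> is dominated by a multiple of the standard normal one.\<close>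

lemma L2_affine:
  assumes f: "L2 f" and q: "0 < q" "q < 1"
  shows "L2 (\<lambda>w. f (c + q * w))"
proof -
  have [measurable]: "f \<in> borel_measurable borel" using f by simp
  \<comment> \<open>The maximum over \<open>y\<close> of the ratio
    \<open>\<phi> ((y - c) / q) / \<phi> y\<close>, found by completing the square.\<close>
  define C where "C = exp (c\<^sup>2 / (1 - q\<^sup>2) / 2)"
  have q2: "1 - q\<^sup>2 > 0" "q\<^sup>2 > 0" using q by (auto simp: abs_square_less_1)
  have bound: "\<phi> ((y - c) / q) \<le> C * \<phi> y" for y
  proof -
    have "((y - c) / q)\<^sup>2 - y\<^sup>2 + c\<^sup>2 / (1 - q\<^sup>2) = ((1 - q\<^sup>2) * y - c)\<^sup>2 / (q\<^sup>2 * (1 - q\<^sup>2))"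
    proof -
      define Q R where "Q = q\<^sup>2" and "R = 1 - q\<^sup>2"
      have QR: "Q > 0" "R > 0" "R = 1 - Q" using q2 by (simp_all add: Q_def R_def)
      have "(R * y - c)\<^sup>2 = (y - c)\<^sup>2 * R - y\<^sup>2 * (Q * R) + c\<^sup>2 * Q"
        unfolding QR(3) by algebra
      then have "(R * y - c)\<^sup>2 / (Q * R) = (y - c)\<^sup>2 / Q - y\<^sup>2 + c\<^sup>2 / R"
        using QR(1,2) by (simp add: add_divide_distrib diff_divide_distrib)
      then show ?thesis by (simp add: Q_def R_def power_divide)
    qed
    also have "\<dots> \<ge> 0" using q2 by simp
    finally have nn: "0 \<le> ((y - c) / q)\<^sup>2 - y\<^sup>2 + c\<^sup>2 / (1 - q\<^sup>2)" .
    have "- A / 2 \<le> B / 2 + - Y / 2" if "0 \<le> A - Y + B" for A B Y :: real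
      using that by simp
    from this[OF nn] have "- ((y - c) / q)\<^sup>2 / 2 \<le> c\<^sup>2 / (1 - q\<^sup>2) / 2 + - y\<^sup>2 / 2" .
    then have "exp (- ((y - c) / q)\<^sup>2 / 2) \<le> C * exp (- y\<^sup>2 / 2)"
      unfolding C_def exp_add[symmetric] by simp
    then have "(1 / sqrt (2 * pi)) * exp (- ((y - c) / q)\<^sup>2 / 2) \<le> (1 / sqrt (2 * pi)) * (C * exp (- y\<^sup>2 / 2))"
      by (rule mult_left_mono) simp
    then show ?thesis by (simp add: std_normal_density_def mult.left_commute)
  qed
  have "integrable lborel (\<lambda>y. \<phi> y * (f y)\<^sup>2)"
    using f by (simp add: L2_def gauss1_def integrable_density)
  then have "integrable lborel (\<lambda>y. C * (\<phi> y * (f y)\<^sup>2))" by simp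
  then have "integrable lborel (\<lambda>y. \<phi> ((y - c) / q) * (f y)\<^sup>2)"
  proof (rule integrable_bound_L)
    show "AE y in lborel. norm (\<phi> ((y - c) / q) * (f y)\<^sup>2) \<le> norm (C * (\<phi> y * (f y)\<^sup>2))"
      using bound by (auto simp: abs_mult mult.assoc[symmetric] C_def intro!: mult_right_mono)
  qed measurable
  then have "integrable lborel (\<lambda>w. \<phi> ((c + q * w - c) / q) * (f (c + q * w))\<^sup>2)"
    using lborel_integrable_real_affine[of "\<lambda>y. \<phi> ((y - c) / q) * (f y)\<^sup>2" q c] q by simp
  then show ?thesis using q by (simp add: L2_def gauss1_def integrable_density)
qed

text \<open>Mehler's formula for the Ornstein-Uhlenbeck semigroup at time \<open>- ln r\<close>;
  probabilistically, the conditional mean of \<open>g (xs \<bullet> z)\<close> given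
  \<open>x \<bullet> z = s\<close> at correlation \<open>r\<close>.\<close>

definition OU :: "real \<Rightarrow> (real \<Rightarrow> real) \<Rightarrow> real \<Rightarrow> real" where
  "OU r g s = (LINT w|gauss1. g (r * s + kap r * w))"

lemma OU_integrable:
  assumes "L2 g" "0 < r" "r < 1"
  shows "integrable gauss1 (\<lambda>w. g (r * s + kap r * w))"
  using L2_integrable[OF L2_affine[OF assms(1)]] kap_bounds[OF assms(2,3)] by simp

lemma OU_measurable [measurable]:
  assumes [measurable]: "g \<in> borel_measurable borel"
  shows "OU r g \<in> borel_measurable borel"
  unfolding OU_def by measurable

text \<open>Jensen's inequality, in the form of a nonnegative variance, bounds the square of
  \<open>OU r g s\<close> by the conditional mean of the square of \<open>g\<close>.\<close>

lemma OU_L2: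
  assumes g: "L2 g" and r: "0 < r" "r < 1"
  shows "L2 (OU r g)"
  unfolding L2_def
proof
  have [measurable]: "g \<in> borel_measurable borel" using g by simp
  show "OU r g \<in> borel_measurable borel" by simp
  have int: "integrable gauss2 (\<lambda>p. (g (r * fst p + kap r * snd p))\<^sup>2)"
    using gauss2_lin_integrable[of r "kap r" "\<lambda>t. (g t)\<^sup>2"] g r kap_sq(2)[of r] by (simp add: L2_def)
  have "integrable gauss1 (\<lambda>s. LINT w|gauss1. (g (r * s + kap r * w))\<^sup>2)"
    using gauss11.integrable_fst'[OF int] by simp
  then show "integrable gauss1 (\<lambda>s. (OU r g s)\<^sup>2)"
  proof (rule integrable_bound_L)
    have "(OU r g s)\<^sup>2 \<le> (LINT w|gauss1. (g (r * s + kap r * w))\<^sup>2)" for s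
    proof -
      have "L2 (\<lambda>w. g (r * s + kap r * w))" using L2_affine[OF g] kap_bounds[OF r] by blast
      then show ?thesis
        using gauss1.variance_eq[of "\<lambda>w. g (r * s + kap r * w)"] gauss1.variance_positive[of "\<lambda>w. g (r * s + kap r * w)"]
        by (simp add: L2_integrable L2_def OU_def)
    qed
    then show "AE s in gauss1. norm ((OU r g s)\<^sup>2) \<le> norm (LINT w|gauss1. (g (r * s + kap r * w))\<^sup>2)"
      by (intro AE_I2) (smt (verit) real_norm_def zero_le_power2)
  qed simp
qed

text \<open>The bilinear form of \<open>OU r\<close>, written as a planar integral so that the
  endpoints are covered: it is the product of the means at \<open>r = 0\<close> and the inner
  product at \<open>r = 1\<close>.\<close>

definition corr :: "real \<Rightarrow> (real \<Rightarrow> real) \<Rightarrow> (real \<Rightarrow> real) \<Rightarrow> real" where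
  "corr r f g = (LINT p|gauss2. f (fst p) * g (r * fst p + kap r * snd p))"

abbreviation L2_inner :: "(real \<Rightarrow> real) \<Rightarrow> (real \<Rightarrow> real) \<Rightarrow> real" where
  "L2_inner f g \<equiv> (LINT s|gauss1. f s * g s)"

lemma corr_integrable:
  assumes "L2 f" "L2 g" "-1 \<le> r" "r \<le> 1"
  shows "integrable gauss2 (\<lambda>p. f (fst p) * g (r * fst p + kap r * snd p))"
  using L2_integrable2[of f g 1 0 r "kap r"] assms kap_sq(2) by simp

lemma corr_diff_left:
  assumes "L2 f" "L2 g" "L2 h" "-1 \<le> r" "r \<le> 1"
  shows "corr r (\<lambda>t. f t - g t) h = corr r f h - corr r g h"
  unfolding corr_def by (simp add: left_diff_distrib corr_integrable assms)

lemma corr_diff_right: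
  assumes "L2 f" "L2 g" "L2 h" "-1 \<le> r" "r \<le> 1"
  shows "corr r h (\<lambda>t. f t - g t) = corr r h f - corr r h g"
  unfolding corr_def by (simp add: right_diff_distrib corr_integrable assms)

lemma corr_OU:
  assumes "L2 f" "L2 g" "0 < r" "r < 1"
  shows "corr r f g = L2_inner f (OU r g)"
proof -
  have "corr r f g = (LINT s|gauss1. LINT w|gauss1. f s * g (r * s + kap r * w))"
    unfolding corr_def using gauss11.integral_fst'[OF corr_integrable[of f g r]] assms by simp
  then show ?thesis by (simp add: OU_def)
qed

text \<open>Self-adjointness of \<open>OU r\<close>, by exchangeability of the pair.\<close>

lemma corr_commute:
  assumes "f \<in> borel_measurable borel" "g \<in> borel_measurable borel" "-1 \<le> r" "r \<le> 1"
  shows "corr r f g = corr r g f"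
  using gauss2_swap_integral[of r "\<lambda>(s, y). f s * g y"] assms unfolding corr_def
  by (simp add: split_beta mult.commute)

text \<open>In the iterated integral the noise is \<open>b * kap a * w + kap b * v\<close>, a
  centred normal variable of variance \<open>b\<^sup>2 * (1 - a\<^sup>2) + (1 - b\<^sup>2) = 1 - (a
  * b)\<^sup>2\<close>.\<close>

lemma OU_semigroup:
  assumes g: "L2 g" and a: "0 < a" "a < 1" and b: "0 < b" "b < 1"
  shows "OU a (OU b g) s = OU (a * b) g s"
proof -
  have [measurable]: "g \<in> borel_measurable borel" using g by simp
  have ab: "0 < a * b" "a * b < 1" using a b mult_strict_mono[of a 1 b 1] by auto
  define k where "k = kap (a * b)"
  have k: "k > 0" "k\<^sup>2 = 1 - (a * b)\<^sup>2" using kap_bounds[OF ab] kap_sq(1)[of "a * b"] ab by (auto simp: k_def)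
  have cd: "(b * kap a / k)\<^sup>2 + (kap b / k)\<^sup>2 = 1"
  proof -
    have "b\<^sup>2 * (kap a)\<^sup>2 + (kap b)\<^sup>2 = b\<^sup>2 * (1 - a\<^sup>2) + (1 - b\<^sup>2)"
      using kap_sq(1)[of a] kap_sq(1)[of b] a b by simp
    also have "\<dots> = k\<^sup>2" unfolding k by (simp add: algebra_simps power_mult_distrib)
    finally have "(b\<^sup>2 * (kap a)\<^sup>2 + (kap b)\<^sup>2) / k\<^sup>2 = 1" using k(1) by simp
    then show ?thesis by (simp only: power_divide power_mult_distrib add_divide_distrib)
  qed
  define h where "h = (\<lambda>w. g (a * b * s + k * w))"
  have [measurable]: "h \<in> borel_measurable borel" unfolding h_def by measurable
  have h: "integrable gauss1 h" unfolding h_def k_def by (rule OU_integrable[OF g ab])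
  have eq: "h ((b * kap a / k) * w + (kap b / k) * v) = g (b * (a * s + kap a * w) + kap b * v)" for w v
    using k unfolding h_def by (intro arg_cong[where f = g]) (simp add: field_simps)
  have int: "integrable gauss2 (\<lambda>p. g (b * (a * s + kap a * fst p) + kap b * snd p))"
    using gauss2_lin_integrable[OF cd, of h, unfolded eq] h by simp
  have "OU a (OU b g) s = (LINT p|gauss2. g (b * (a * s + kap a * fst p) + kap b * snd p))"
    unfolding OU_def using gauss11.integral_fst'[OF int] by simp
  also have "\<dots> = (LINT w|gauss1. h w)"
    using gauss2_lin_integral[OF cd, of h, unfolded eq] by simp
  finally show ?thesis by (simp add: OU_def h_def k_def)
qed

text \<open>Self-adjointness moves one operator across, and the semigroup law multiplies the
  parameters.\<close>

lemma OU_inner: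
  assumes g: "L2 g" and a: "0 < a" "a < 1" and b: "0 < b" "b < 1"
  shows "L2_inner (OU a g) (OU b g) = corr (a * b) g g"
proof -
  have ab: "0 < a * b" "a * b < 1" using a b mult_strict_mono[of a 1 b 1] by auto
  have "L2_inner (OU a g) (OU b g) = corr b (OU a g) g"
    using g a b by (subst corr_OU) (auto intro: OU_L2)
  also have "\<dots> = corr b g (OU a g)" using g b by (intro corr_commute) auto
  also have "\<dots> = L2_inner g (OU b (OU a g))"
    using g a b by (subst corr_OU) (auto intro: OU_L2)
  also have "\<dots> = L2_inner g (OU (a * b) g)"
    using OU_semigroup[OF g b a] by (simp add: mult.commute)
  also have "\<dots> = corr (a * b) g g" using g ab by (simp add: corr_OU)
  finally show ?thesis .
qed

text \<open>A weighted arithmetic-geometric mean in place of Cauchy-Schwarz: the free weight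
  \<open>d\<close> balances a small squared norm against a merely bounded one.\<close>

lemma corr_bound:
  assumes f: "L2 f" and g: "L2 g" and r: "-1 \<le> r" "r \<le> 1" and d: "d > 0"
  shows "2 * \<bar>corr r f g\<bar> \<le> d * (LINT t|gauss1. (f t)\<^sup>2) + (LINT t|gauss1. (g t)\<^sup>2) / d"
proof -
  have [measurable]: "f \<in> borel_measurable borel" "g \<in> borel_measurable borel" using f g by auto
  have i1: "integrable gauss2 (\<lambda>p. (f (fst p))\<^sup>2)"
    using gauss2_fst_integrable[of "\<lambda>t. (f t)\<^sup>2"] f by (simp add: L2_def)
  have i2: "integrable gauss2 (\<lambda>p. (g (r * fst p + kap r * snd p))\<^sup>2)"
    using gauss2_lin_integrable[of r "kap r" "\<lambda>t. (g t)\<^sup>2"] g kap_sq(2)[OF r] by (simp add: L2_def)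
  have amgm: "\<bar>2 * (x * y)\<bar> \<le> d * x\<^sup>2 + y\<^sup>2 / d" for x y :: real
  proof -
    have "0 \<le> (d * \<bar>x\<bar> - \<bar>y\<bar>)\<^sup>2" by simp
    then have "2 * (d * (\<bar>x\<bar> * \<bar>y\<bar>)) \<le> d\<^sup>2 * x\<^sup>2 + y\<^sup>2" by (simp add: power2_diff power_mult_distrib mult.assoc)
    then have "2 * (d * (\<bar>x\<bar> * \<bar>y\<bar>)) / d \<le> (d\<^sup>2 * x\<^sup>2 + y\<^sup>2) / d" using d by (intro divide_right_mono) auto
    then show ?thesis using d by (simp add: abs_mult add_divide_distrib power2_eq_square)
  qed
  have "2 * \<bar>corr r f g\<bar> = \<bar>LINT p|gauss2. 2 * (f (fst p) * g (r * fst p + kap r * snd p))\<bar>"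
    unfolding corr_def by simp
  also have "\<dots> \<le> (LINT p|gauss2. \<bar>2 * (f (fst p) * g (r * fst p + kap r * snd p))\<bar>)"
    by (rule integral_abs_bound)
  also have "\<dots> \<le> (LINT p|gauss2. d * (f (fst p))\<^sup>2 + (g (r * fst p + kap r * snd p))\<^sup>2 / d)"
    using i1 i2 corr_integrable[OF f g r] by (intro integral_mono amgm integrable_abs) auto
  also have "\<dots> = d * (LINT t|gauss1. (f t)\<^sup>2) + (LINT t|gauss1. (g t)\<^sup>2) / d"
    using i1 i2 gauss2_fst_integral[of "\<lambda>t. (f t)\<^sup>2"] gauss2_lin_integral[of r "kap r" "\<lambda>t. (g t)\<^sup>2"] kap_sq(2)[OF r]
    by simp
  finally show ?thesis .
qed

text \<open>Truncate \<open>f\<close> at height \<open>N\<close>, approximate the truncation almost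
  everywhere by continuous functions, and clamp these to the same height so that dominated
  convergence applies. Each step costs \<open>e / 4\<close>, doubled when the square of the sum is
  split.\<close>

lemma L2_approx_bounded_continuous:
  assumes f: "L2 f" and e: "e > 0"
  shows "\<exists>g C. continuous_on UNIV g \<and> (\<forall>t. \<bar>g t\<bar> \<le> C) \<and> (LINT t|gauss1. (f t - g t)\<^sup>2) < e"
proof -
  have [measurable]: "f \<in> borel_measurable borel" using f by simp
  define clamp :: "real \<Rightarrow> real \<Rightarrow> real" where "clamp N y = max (- N) (min N y)" for N y
  have cl: "\<bar>clamp N y\<bar> \<le> N" if "N \<ge> 0" for N y using that by (auto simp: clamp_def)
  have [measurable]: "clamp N \<in> borel_measurable borel" for N unfolding clamp_def by measurable
  have "(\<lambda>N. LINT t|gauss1. (f t - clamp (real N) (f t))\<^sup>2) \<longlonglongrightarrow> (LINT t|gauss1. 0)"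
  proof (rule integral_dominated_convergence[where w = "\<lambda>t. (f t)\<^sup>2"])
    show "AE t in gauss1. (\<lambda>N. (f t - clamp (real N) (f t))\<^sup>2) \<longlonglongrightarrow> 0"
    proof (rule AE_I2)
      fix t
      have "\<forall>\<^sub>F N in sequentially. (f t - clamp (real N) (f t))\<^sup>2 = 0"
        using eventually_ge_at_top[of "nat \<lceil>\<bar>f t\<bar>\<rceil>"]
        by eventually_elim (auto simp: clamp_def nat_le_iff ceiling_le_iff max_def min_def)
      then show "(\<lambda>N. (f t - clamp (real N) (f t))\<^sup>2) \<longlonglongrightarrow> 0" by (rule tendsto_eventually)
    qed
    have "\<bar>f t - clamp (real N) (f t)\<bar> \<le> \<bar>f t\<bar>" for t N by (auto simp: clamp_def max_def min_def)
    then show "AE t in gauss1. norm ((f t - clamp (real N) (f t))\<^sup>2) \<le> (f t)\<^sup>2" for N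
      by (simp add: abs_le_square_iff)
  qed (use f in \<open>auto simp: L2_def\<close>)
  then have "\<forall>\<^sub>F N in sequentially. (LINT t|gauss1. (f t - clamp (real N) (f t))\<^sup>2) < e / 4"
    using e by (intro order_tendstoD(2)[where y = "\<integral>x. 0 \<partial>gauss1"]) auto
  from eventually_happens'[OF sequentially_bot this] obtain N :: nat where N: "(LINT t|gauss1. (f t - clamp N (f t))\<^sup>2) < e / 4" ..
  define fN where "fN t = clamp N (f t)" for t
  have [measurable]: "fN \<in> borel_measurable borel" unfolding fN_def by measurable
  have fN: "\<bar>fN t\<bar> \<le> N" for t unfolding fN_def by (rule cl) simp
  have "fN \<in> borel_measurable lebesgue" by (simp add: measurable_completion)
  then have "fN measurable_on UNIV" using lebesgue_measurable_imp_measurable_on[of fN UNIV] by simp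
  then obtain Z F where Z: "negligible Z" and F: "\<And>n::nat. continuous_on UNIV (F n)"
    and lim: "\<And>t. t \<notin> Z \<Longrightarrow> (\<lambda>n. F n t) \<longlonglongrightarrow> fN t"
    unfolding measurable_on_def by auto
  define G where "G n t = clamp N (F n t)" for n t
  have G: "continuous_on UNIV (G n)" "\<bar>G n t\<bar> \<le> N" for n t
    unfolding G_def using cl by (auto simp: clamp_def intro!: continuous_intros F)
  have [measurable]: "G n \<in> borel_measurable borel" for n by (rule borel_measurable_continuous_onI) (rule G)
  have "AE t in lebesgue. t \<notin> Z"
    using Z negligible_iff_null_sets AE_not_in by blast
  then have "AE t in lborel. t \<notin> Z" by (simp add: AE_completion_iff)
  then have aeZ: "AE t in gauss1. t \<notin> Z" unfolding gauss1_def by (auto simp: AE_density elim: eventually_mono)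
  have "(\<lambda>n. LINT t|gauss1. (fN t - G n t)\<^sup>2) \<longlonglongrightarrow> (LINT t|gauss1. 0)"
  proof (rule integral_dominated_convergence[where w = "\<lambda>t. (2 * real N)\<^sup>2"])
    show "AE t in gauss1. (\<lambda>n. (fN t - G n t)\<^sup>2) \<longlonglongrightarrow> 0"
      using aeZ
    proof eventually_elim
      case (elim t)
      have "(\<lambda>n. G n t) \<longlonglongrightarrow> clamp N (fN t)" unfolding G_def clamp_def by (intro tendsto_intros lim elim)
      moreover have "clamp N (fN t) = fN t" using fN[of t] by (auto simp: clamp_def)
      ultimately have "(\<lambda>n. G n t) \<longlonglongrightarrow> fN t" by simp
      from tendsto_power[OF tendsto_diff[OF tendsto_const[of "fN t"] this], of 2]
      show ?case by simp
    qed
    have "\<bar>fN t - G n t\<bar> \<le> \<bar>2 * real N\<bar>" for n t using fN[of t] G(2)[of n t] by linarith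
    then show "AE t in gauss1. norm ((fN t - G n t)\<^sup>2) \<le> (2 * real N)\<^sup>2" for n
      by (intro AE_I2) (simp only: abs_le_square_iff real_norm_def abs_power2)
  qed auto
  then have "\<forall>\<^sub>F n in sequentially. (LINT t|gauss1. (fN t - G n t)\<^sup>2) < e / 4"
    using e by (intro order_tendstoD(2)[where y = "\<integral>x. 0 \<partial>gauss1"]) auto
  from eventually_happens'[OF sequentially_bot this] obtain n where n: "(LINT t|gauss1. (fN t - G n t)\<^sup>2) < e / 4" ..
  have L: "L2 fN" "L2 (G n)"
    by (rule L2_bound[OF L2_const[of "real N"]]; use fN G(2) in simp)+
  have i: "integrable gauss1 (\<lambda>t. (f t - fN t)\<^sup>2)" "integrable gauss1 (\<lambda>t. (fN t - G n t)\<^sup>2)"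
    "integrable gauss1 (\<lambda>t. (f t - G n t)\<^sup>2)"
    using L2_diff[OF f L(1)] L2_diff[OF L] L2_diff[OF f L(2)] by (auto simp: L2_def)
  have "(LINT t|gauss1. (f t - G n t)\<^sup>2) \<le> (LINT t|gauss1. 2 * (f t - fN t)\<^sup>2 + 2 * (fN t - G n t)\<^sup>2)"
  proof (intro integral_mono)
    fix t
    have "(a + b)\<^sup>2 \<le> 2 * a\<^sup>2 + 2 * b\<^sup>2" for a b :: real
      using zero_le_power2[of "a - b"] by (simp add: power2_sum power2_diff)
    from this[of "f t - fN t" "fN t - G n t"]
    show "(f t - G n t)\<^sup>2 \<le> 2 * (f t - fN t)\<^sup>2 + 2 * (fN t - G n t)\<^sup>2" by simp
  qed (use i in auto)
  also have "\<dots> < e" using i N n by (simp add: fN_def)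
  finally show ?thesis using G[of n] by blast
qed

text \<open>For bounded continuous functions this is dominated convergence; the general case is a
  limit uniform in \<open>r\<close>, since \<open>corr_bound\<close> does not see \<open>r\<close>.
  The endpoints matter: \<open>r = 0\<close> gives the limit of the decay, \<open>r = 1\<close> the
  norm.\<close>

lemma corr_continuous:
  assumes f: "L2 f"
  shows "continuous_on {0..1} (\<lambda>r. corr r f f)"
proof (rule uniform_limit_theorem[where F = "at_right 0"])
  define A where "A = (LINT t|gauss1. (f t)\<^sup>2)"
  have A: "A \<ge> 0" by (simp add: A_def)
  define P where "P d g \<longleftrightarrow> (\<exists>C. continuous_on UNIV g \<and> (\<forall>t. \<bar>g t\<bar> \<le> C) \<and> (LINT t|gauss1. (f t - g t)\<^sup>2) < d\<^sup>2)" for d :: real and g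
  define G where "G d = (SOME g. P d g)" for d
  have G: "P d (G d)" if "d > 0" for d
  proof -
    have "\<exists>g. P d g" unfolding P_def using L2_approx_bounded_continuous[OF f, of "d\<^sup>2"] that by auto
    then show ?thesis unfolding G_def by (rule someI_ex)
  qed
  show "\<forall>\<^sub>F d in at_right 0. continuous_on {0..1} (\<lambda>r. corr r (G d) (G d))"
    using eventually_at_right_less[of 0]
  proof eventually_elim
    case (elim d)
    then obtain C where g: "continuous_on UNIV (G d)" "\<And>t. \<bar>G d t\<bar> \<le> C" using G[of d] by (auto simp: P_def)
    then have [measurable]: "G d \<in> borel_measurable borel" by (intro borel_measurable_continuous_onI)
    have C: "C \<ge> 0" using g(2)[of 0] by linarith
    show ?case unfolding continuous_on_sequentially comp_def
    proof safe
      fix r :: real and u :: "nat \<Rightarrow> real" assume u: "u \<longlonglongrightarrow> r"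
      show "(\<lambda>n. corr (u n) (G d) (G d)) \<longlonglongrightarrow> corr r (G d) (G d)"
        unfolding corr_def
      proof (rule integral_dominated_convergence[where w = "\<lambda>_. C * C"])
        show "AE p in gauss2. (\<lambda>n. G d (fst p) * G d (u n * fst p + kap (u n) * snd p))
           \<longlonglongrightarrow> G d (fst p) * G d (r * fst p + kap r * snd p)"
          by (intro AE_I2 tendsto_intros u continuous_on_tendsto_compose[OF g(1)]) auto
        show "AE p in gauss2. norm (G d (fst p) * G d (u n * fst p + kap (u n) * snd p)) \<le> C * C" for n
          using g(2) C by (auto simp: abs_mult intro!: mult_mono)
      qed auto
    qed
  qed
  show "uniform_limit {0..1} (\<lambda>d r. corr r (G d) (G d)) (\<lambda>r. corr r f f) (at_right 0)"
    unfolding uniform_limit_iff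
  proof (intro allI impI)
    fix e :: real assume e: "e > 0"
    \<comment> \<open>The two doubled errors below add up to \<open>d * (3 * A + 4)\<close>, which
      is at most \<open>2 * (d * c)\<close>.\<close>
    define c where "c = 2 * A + 2"
    have c: "c > 0" using A by (simp add: c_def)
    have "\<forall>\<^sub>F d in at_right 0. d \<in> {0<..<min 1 (e / c)}"
      using e c by (intro eventually_at_right_real) auto
    then show "\<forall>\<^sub>F d in at_right 0. \<forall>r\<in>{0..1}. dist (corr r (G d) (G d)) (corr r f f) < e"
    proof eventually_elim
      case (elim d)
      then have d: "0 < d" "d < 1" "d * c < e" using c by (auto simp: field_simps)
      define g where "g = G d"
      obtain C where g: "continuous_on UNIV g" "\<And>t. \<bar>g t\<bar> \<le> C" "(LINT t|gauss1. (f t - g t)\<^sup>2) < d\<^sup>2"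
        using G[OF d(1)] by (auto simp: P_def g_def)
      then have [measurable]: "g \<in> borel_measurable borel" by (intro borel_measurable_continuous_onI)
      have Lg: "L2 g" by (rule L2_bound[OF L2_const[of C]]) (use g(2) in \<open>auto intro: order_trans[OF _ abs_ge_self]\<close>)
      have Lfg: "L2 (\<lambda>t. f t - g t)" by (rule L2_diff[OF f Lg])
      have dd: "d\<^sup>2 \<le> 1" using d by (simp add: power_le_one)
      have "(LINT t|gauss1. (g t)\<^sup>2) \<le> (LINT t|gauss1. 2 * (f t)\<^sup>2 + 2 * (f t - g t)\<^sup>2)"
      proof (intro integral_mono)
        fix t
        have "b\<^sup>2 \<le> 2 * a\<^sup>2 + 2 * (a - b)\<^sup>2" for a b :: real
          using zero_le_power2[of "2 * a - b"] by (simp add: power2_diff power_mult_distrib)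
        then show "(g t)\<^sup>2 \<le> 2 * (f t)\<^sup>2 + 2 * (f t - g t)\<^sup>2" .
      qed (use f Lg Lfg in \<open>auto simp: L2_def\<close>)
      also have "\<dots> = 2 * A + 2 * (LINT t|gauss1. (f t - g t)\<^sup>2)"
        using f Lfg by (simp add: L2_def A_def)
      also have "\<dots> \<le> 2 * A + 2" using g(3) dd by linarith
      finally have g2: "(LINT t|gauss1. (g t)\<^sup>2) \<le> 2 * A + 2" .
      show ?case
      proof
        fix r :: real assume "r \<in> {0..1}"
        then have r: "-1 \<le> r" "r \<le> 1" by auto
        have split: "corr r f f - corr r g g = corr r f (\<lambda>t. f t - g t) + corr r (\<lambda>t. f t - g t) g"
          by (simp add: corr_diff_left corr_diff_right f Lg r)
        have "2 * \<bar>corr r f (\<lambda>t. f t - g t)\<bar> \<le> d * A + (LINT t|gauss1. (f t - g t)\<^sup>2) / d"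
          unfolding A_def by (rule corr_bound[OF f Lfg r d(1)])
        also have "(LINT t|gauss1. (f t - g t)\<^sup>2) / d \<le> d\<^sup>2 / d" using g(3) d by (intro divide_right_mono) auto
        finally have 1: "2 * \<bar>corr r f (\<lambda>t. f t - g t)\<bar> \<le> d * (A + 1)"
          using d by (simp add: power2_eq_square distrib_left)
        have "2 * \<bar>corr r (\<lambda>t. f t - g t) g\<bar> \<le> (1 / d) * (LINT t|gauss1. (f t - g t)\<^sup>2) + (LINT t|gauss1. (g t)\<^sup>2) / (1 / d)"
          using d by (intro corr_bound Lfg Lg r) auto
        also have "\<dots> \<le> (1 / d) * d\<^sup>2 + (2 * A + 2) / (1 / d)"
          using g(3) g2 d by (intro add_mono mult_left_mono divide_right_mono) auto
        finally have 2: "2 * \<bar>corr r (\<lambda>t. f t - g t) g\<bar> \<le> d * (2 * A + 3)"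
          using d by (simp add: power2_eq_square algebra_simps)
        have "2 * \<bar>corr r f f - corr r g g\<bar> \<le>
            2 * \<bar>corr r f (\<lambda>t. f t - g t)\<bar> + 2 * \<bar>corr r (\<lambda>t. f t - g t) g\<bar>"
          unfolding split
          using abs_triangle_ineq[of "corr r f (\<lambda>t. f t - g t)" "corr r (\<lambda>t. f t - g t) g"] by simp
        also have "\<dots> \<le> d * (A + 1) + d * (2 * A + 3)" using 1 2 by (rule add_mono)
        also have "\<dots> \<le> 2 * (d * c)" using A d by (simp add: c_def algebra_simps)
        finally show "dist (corr r (G d) (G d)) (corr r f f) < e"
          using d(3) by (simp add: dist_real_def g_def)
      qed
    qed
  qed
qed simp

text \<open>Subtract the chord. If the difference \<open>d\<close> were positive somewhere, take the
  leftmost point \<open>a\<close> at which it is maximal: \<open>d\<close> is strictly smaller at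
  \<open>a - e\<close> and no larger at \<open>a + e\<close>, against the midpoint inequality at
  \<open>a\<close>.\<close>

lemma midpoint_convex_imp_convex:
  fixes f :: "real \<Rightarrow> real"
  assumes cont: "continuous_on {x..y} f" and xy: "x < y"
    and mid: "\<And>s t. s \<in> {x..y} \<Longrightarrow> t \<in> {x..y} \<Longrightarrow> 2 * f ((s + t) / 2) \<le> f s + f t"
    and c: "c \<in> {x..y}"
  shows "f c \<le> f x + (f y - f x) / (y - x) * (c - x)"
proof (rule ccontr)
  define d where "d t = f t - (f x + (f y - f x) / (y - x) * (t - x))" for t
  assume "\<not> ?thesis"
  then have dc: "d c > 0" by (simp add: d_def)
  have dxy: "d x = 0" "d y = 0" using xy by (simp_all add: d_def)
  have dcont: "continuous_on {x..y} d" unfolding d_def by (intro continuous_intros cont)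
  have dmid: "2 * d ((s + t) / 2) \<le> d s + d t" if "s \<in> {x..y}" "t \<in> {x..y}" for s t
  proof -
    define m where "m = (f y - f x) / (y - x)"
    have "2 * (f x + m * ((s + t) / 2 - x)) = (f x + m * (s - x)) + (f x + m * (t - x))"
      by (simp add: algebra_simps add_divide_distrib[symmetric])
    moreover have "2 * F \<le> p + q \<Longrightarrow> 2 * A = B + C \<Longrightarrow> 2 * (F - A) \<le> (p - B) + (q - C)"
      for F p q A B C :: real by (simp add: right_diff_distrib)
    ultimately show ?thesis using mid[OF that] unfolding d_def m_def[symmetric] by blast
  qed
  obtain z where z: "z \<in> {x..y}" "\<And>t. t \<in> {x..y} \<Longrightarrow> d t \<le> d z"
    using continuous_attains_sup[OF _ _ dcont] c by fastforce
  define S where "S = {t \<in> {x..y}. d t = d z}"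
  have "closed S" unfolding S_def
    by (intro continuous_closed_preimage_constant[OF dcont]) auto
  moreover have "bounded S" unfolding S_def by (rule bounded_subset[of "{x..y}"]) auto
  ultimately have "compact S" by (simp add: compact_eq_bounded_closed)
  moreover have "S \<noteq> {}" using z by (auto simp: S_def)
  ultimately obtain a where a: "a \<in> S" "\<And>t. t \<in> S \<Longrightarrow> a \<le> t"
    using compact_attains_inf by metis
  have dz: "d z > 0" using z(2)[OF c] dc by simp
  have "a \<noteq> x" "a \<noteq> y" using a(1) dz dxy by (auto simp: S_def)
  then have axy: "x < a" "a < y" using a(1) by (auto simp: S_def)
  define e where "e = min (a - x) (y - a)"
  have e: "e > 0" "a - e \<in> {x..y}" "a + e \<in> {x..y}" using axy by (auto simp: e_def)
  have "a - e \<notin> S" using a(2)[of "a - e"] e(1) by auto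
  then have "d (a - e) < d z" using z(2)[OF e(2)] e(2) by (auto simp: S_def)
  moreover have "d (a + e) \<le> d z" using z(2)[OF e(3)] .
  moreover have "2 * d a \<le> d (a - e) + d (a + e)" using dmid[OF e(2,3)] by simp
  ultimately show False using a(1) by (simp add: S_def)
qed

section \<open>Positivity and strict decay of the correlation form\<close>

lemma corr_square:
  assumes "L2 f" "0 < r" "r < 1"
  shows "corr (r\<^sup>2) f f = (LINT s|gauss1. (OU r f s)\<^sup>2)"
  using OU_inner[OF assms assms(2,3)] by (simp add: power2_eq_square)

lemma corr_nonneg:
  assumes "L2 f" "0 < r" "r < 1"
  shows "0 \<le> corr r f f"
proof -
  have "0 < sqrt r" "sqrt r < 1" "(sqrt r)\<^sup>2 = r" using assms by auto
  then show ?thesis using corr_square[OF assms(1), of "sqrt r"] by simp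
qed

text \<open>If \<open>\<langle>f, OU t f\<rangle> = 0\<close> then \<open>OU (sqrt t) f = 0\<close>, so \<open>\<langle>f, OU u f\<rangle> = 0\<close> for all \<open>u < sqrt t\<close>;
  iterating brings \<open>u\<close> up to \<open>1\<close>.\<close>

lemma corr_eq_0_imp:
  assumes f: "L2 f" and r: "0 < r" "r < 1" and 0: "corr r f f = 0"
  shows "AE t in gauss1. f t = 0"
proof -
  have fm[measurable]: "f \<in> borel_measurable borel" using f by simp
  define P where "P t \<longleftrightarrow> corr t f f = 0" for t
  note cont = corr_continuous[OF f]
  have below: "P u" if t: "0 < t" "t < 1" "P t" and u: "0 < u" "u < sqrt t" for t u
  proof -
    have st: "0 < sqrt t" "sqrt t < 1" "(sqrt t)\<^sup>2 = t" using t by auto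
    have L: "L2 (OU (sqrt t) f)" using OU_L2[OF f st(1,2)] .
    have "(LINT s|gauss1. (OU (sqrt t) f s)\<^sup>2) = 0"
      using corr_square[OF f st(1,2)] t(3) st(3) by (simp add: P_def)
    then have z: "AE s in gauss1. OU (sqrt t) f s = 0"
      using L by (subst (asm) integral_nonneg_eq_0_iff_AE) (auto simp: L2_def)
    define b where "b = u / sqrt t"
    have b: "0 < b" "b < 1" "sqrt t * b = u" using u st by (auto simp: b_def)
    have "corr u f f = L2_inner (OU (sqrt t) f) (OU b f)"
      using OU_inner[OF f st(1,2) b(1,2)] b(3) by simp
    also have "\<dots> = (LINT s|gauss1. 0)"
      by (rule integral_cong_AE) (use z in \<open>auto elim: eventually_mono\<close>)
    finally show ?thesis by (simp add: P_def)
  qed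
  have limit: "P t" if t: "0 < t" "t \<le> 1" and "\<And>u. 0 < u \<Longrightarrow> u < t \<Longrightarrow> P u" for t
  proof -
    have "((\<lambda>r. corr r f f) \<longlongrightarrow> corr t f f) (at t within {0..1})"
      using cont t by (auto simp: continuous_on)
    then have "((\<lambda>r. corr r f f) \<longlongrightarrow> corr t f f) (at t within {0..t})"
      by (rule tendsto_within_subset) (use t in auto)
    then have "((\<lambda>r. corr r f f) \<longlongrightarrow> corr t f f) (at_left t)"
      using t by (simp add: at_within_Icc_at_left)
    moreover have "\<forall>\<^sub>F u in at_left t. corr u f f = 0"
      using that(3) eventually_at_left_real[OF t(1)] by (auto simp: P_def elim!: eventually_mono)
    then have "((\<lambda>r. corr r f f) \<longlongrightarrow> 0) (at_left t)" by (rule tendsto_eventually)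
    ultimately show ?thesis unfolding P_def
      using tendsto_unique[of "at_left t"] by (auto simp: trivial_limit_at_left_real)
  qed
  \<comment> \<open>\<open>below\<close> reaches every point under \<open>sqrt t\<close>; continuity
    adds \<open>sqrt t\<close> itself.\<close>
  have root: "P (sqrt t)" if t: "0 < t" "t < 1" "P t" for t
    by (rule limit) (use below[OF t] t in auto)
  have all: "P u" if u: "0 < u" "u < 1" for u
  proof -
    have small: "P v" if "0 < v" "v \<le> r" for v
    proof -
      have "r * 1 < sqrt r * 1" using r real_sqrt_less_mono[of "r\<^sup>2" r] by (simp add: power2_eq_square)
      then show ?thesis using below[OF r, of v] 0 that by (simp add: P_def)
    qed
    \<comment> \<open>Some \<open>u ^ (2 ^ n)\<close> falls below \<open>r\<close>, where
      \<open>P\<close> is known; \<open>n\<close> successive square roots lead back to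
      \<open>u\<close>.\<close>
    have "(\<lambda>n. u ^ n) \<longlonglongrightarrow> 0" using u by (intro LIMSEQ_realpow_zero) auto
    from eventually_happens'[OF sequentially_bot order_tendstoD(2)[OF this r(1)]]
    obtain n where n: "u ^ n < r" ..
    have "n \<le> 2 ^ n" by (simp add: less_imp_le)
    then have "u ^ (2 ^ n) \<le> u ^ n" using u by (intro power_decreasing) auto
    then have "u ^ (2 ^ n) \<le> r" using n by (rule order_trans[OF _ less_imp_le])
    then have "P (u ^ (2 ^ n))" using u by (intro small) auto
    then show "P u"
    proof (induction n)
      case (Suc n)
      have lt1: "u ^ (2 ^ n) < 1" using u by (simp add: power_less_one_iff)
      have "P (sqrt (u ^ (2 ^ Suc n)))"
        using Suc.prems u by (intro root) (auto simp: power_less_one_iff)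
      moreover have "sqrt (u ^ (2 ^ Suc n)) = u ^ (2 ^ n)"
        using u by (intro real_sqrt_unique) (simp_all add: power_mult[symmetric] mult.commute)
      ultimately show ?case using Suc.IH by simp
    qed simp
  qed
  have "P 1" by (rule limit) (simp_all add: all)
  then have "(LINT t|gauss1. (f t)\<^sup>2) = 0"
    using gauss2_fst_integral[of "\<lambda>t. (f t)\<^sup>2"] by (simp add: P_def corr_def power2_eq_square)
  then show ?thesis using f by (subst (asm) integral_nonneg_eq_0_iff_AE) (auto simp: L2_def)
qed

lemma OU_cmean:
  assumes "L2 f" "0 < r" "r < 1"
  shows "OU r (\<lambda>t. f t - c) s = OU r f s - c"
  unfolding OU_def using OU_integrable[OF assms] gauss1.prob_space by simp

text \<open>Injectivity of \<open>OU r\<close>. It ensures that the conditional mean of a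
  non-constant function is again non-constant, hence an admissible minimiser in
  \<open>F_class\<close>.\<close>

lemma OU_nonconst:
  assumes f: "L2 f" and r: "0 < r" "r < 1" and c: "AE s in gauss1. OU r f s = c"
  shows "AE t in gauss1. f t = c"
proof -
  have L: "L2 (\<lambda>t. f t - c)" using f by (intro L2_diff) auto
  have [measurable]: "f \<in> borel_measurable borel" using f by simp
  have r2: "0 < r\<^sup>2" "r\<^sup>2 < 1" using r by (auto simp: power_less_one_iff)
  have "corr (r\<^sup>2) (\<lambda>t. f t - c) (\<lambda>t. f t - c) = (LINT s|gauss1. 0)"
    unfolding corr_square[OF L r]
    by (rule integral_cong_AE) (use c in \<open>auto simp: OU_cmean[OF f r] elim: eventually_mono\<close>)
  then have "corr (r\<^sup>2) (\<lambda>t. f t - c) (\<lambda>t. f t - c) = 0" by simp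
  from corr_eq_0_imp[OF L r2 this] show ?thesis by simp
qed

text \<open>Slopes of a convex function near \<open>t0\<close> are bounded by chord slopes towards a
  point \<open>x0\<close> on the left and a point \<open>T\<close> on the right. As
  \<open>psi\<close> is positive and decays to 0, \<open>T\<close> can be chosen with
  \<open>psi T\<close> below half the minimum near \<open>t0\<close>, which makes the right-hand
  chords fall at a definite rate.\<close>

lemma convex_positive_decaying_steep:
  fixes psi :: "real \<Rightarrow> real"
  assumes cont: "continuous_on {0<..} psi"
    and mid: "\<And>s t. 0 < s \<Longrightarrow> 0 < t \<Longrightarrow> 2 * psi ((s + t) / 2) \<le> psi s + psi t"
    and pos: "\<And>t. 0 < t \<Longrightarrow> 0 < psi t"
    and lim: "(psi \<longlongrightarrow> 0) at_top" and t0: "0 < t0"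
  shows "steep_at psi t0"
proof -
  have conv: "psi b \<le> psi a + (psi c - psi a) / (c - a) * (b - a)" if "0 < a" "a < c" "a \<le> b" "b \<le> c" for a b c
    by (rule midpoint_convex_imp_convex)
       (use that in \<open>auto intro!: mid continuous_on_subset[OF cont]\<close>)
  define e where "e = t0 / 2"
  have e: "e > 0" "t0 - e > 0" "e = t0 - e" using t0 by (simp_all add: e_def)
  have "continuous_on {t0-e..t0+e} psi" by (rule continuous_on_subset[OF cont]) (use e in auto)
  then obtain m where m: "m \<in> {t0-e..t0+e}" "\<And>t. t \<in> {t0-e..t0+e} \<Longrightarrow> psi m \<le> psi t"
    using continuous_attains_inf[of "{t0-e..t0+e}" psi] e by auto
  have psim: "psi m > 0" using m e by (intro pos) auto
  have "\<forall>\<^sub>F t in at_top. psi t < psi m / 2 \<and> t > t0 + e"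
    using order_tendstoD(2)[OF lim, of "psi m / 2"] psim eventually_gt_at_top by (intro eventually_conj) auto
  then obtain T where T: "psi T < psi m / 2" "T > t0 + e" using eventually_happens'[OF trivial_limit_at_top_linorder] by blast
  \<comment> \<open>From any \<open>b\<close> in the window, \<open>psi\<close> drops by at least
    \<open>psi m / 2\<close> before \<open>T\<close>, over a distance of at most
    \<open>T - t0 + e\<close>. The constant \<open>L\<close> comes from
    \<open>a - x0 \<ge> t0 / 4\<close>, with \<open>psi a\<close> bounded below by 0.\<close>
  define c where "c = (psi m / 2) / (T - t0 + e)"
  define x0 where "x0 = t0 / 4"
  define L where "L = 4 * psi x0 / t0"
  have c: "c > 0" using psim T e by (simp add: c_def)
  show ?thesis
  proof (rule steep_atI[OF e(1) c])
    fix a b assume ab: "t0 - e < a" "a \<le> b" "b < t0 + e"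
    have a0: "0 < a" "0 < x0" "x0 < a" "t0 / 4 \<le> a - x0" using ab e t0 by (auto simp: x0_def e_def)
    have lower: "- L * (b - a) \<le> psi b - psi a"
    proof (cases "a = b")
      case False
      then have "a < b" using ab by simp
      have "psi a \<le> psi x0 + (psi b - psi x0) / (b - x0) * (a - x0)"
        using conv[of x0 b a] a0 \<open>a < b\<close> by auto
      then have "psi a * (b - x0) \<le> (psi x0 + (psi b - psi x0) / (b - x0) * (a - x0)) * (b - x0)"
        using a0 \<open>a < b\<close> by (intro mult_right_mono) auto
      also have "\<dots> = psi x0 * (b - x0) + (psi b - psi x0) * (a - x0)"
        using a0 \<open>a < b\<close> by (simp add: distrib_right)
      finally have "- (psi x0 - psi a) * (b - a) \<le> (psi b - psi a) * (a - x0)"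
        by (simp add: algebra_simps)
      moreover have "0 \<le> psi a * (b - a)" using pos[OF a0(1)] ab by simp
      ultimately have "- psi x0 * (b - a) \<le> (psi b - psi a) * (a - x0)" by (simp add: algebra_simps)
      then have "- psi x0 * (b - a) / (a - x0) \<le> psi b - psi a" using a0 by (subst pos_divide_le_eq) auto
      moreover have "psi x0 * (b - a) / (a - x0) \<le> psi x0 * (b - a) / (t0 / 4)"
        using a0 pos[OF a0(2)] ab t0 by (intro divide_left_mono) auto
      moreover have "psi x0 * (b - a) / (t0 / 4) = L * (b - a)" by (simp add: L_def)
      ultimately show ?thesis by simp
    qed simp
    have upper: "psi b - psi a \<le> - c * (b - a)"
    proof -
      have bm: "psi m \<le> psi b" using m(2)[of b] ab by auto
      have bT: "b < T" using ab T by auto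
      have "psi b \<le> psi a + (psi T - psi a) / (T - a) * (b - a)"
        using conv[of a T b] a0 ab T by auto
      then have "psi b * (T - a) \<le> (psi a + (psi T - psi a) / (T - a) * (b - a)) * (T - a)"
        using ab bT by (intro mult_right_mono) auto
      also have "\<dots> = psi a * (T - a) + (psi T - psi a) * (b - a)"
        using ab bT by (simp add: distrib_right)
      finally have 1: "(psi b - psi a) * (T - b) \<le> (psi T - psi b) * (b - a)" by (simp add: algebra_simps)
      have "(psi T - psi b) * (b - a) \<le> - (psi m / 2) * (b - a)"
        using bm T ab by (intro mult_right_mono) auto
      with 1 have "psi b - psi a \<le> - ((psi m / 2) * (b - a) / (T - b))"
        using bT by (simp add: field_simps)
      moreover have "(psi m / 2) * (b - a) / (T - t0 + e) \<le> (psi m / 2) * (b - a) / (T - b)"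
        using ab bT T e psim by (intro divide_left_mono) auto
      ultimately show ?thesis by (simp add: c_def)
    qed
    show "- L * (b - a) \<le> psi b - psi a \<and> psi b - psi a \<le> - c * (b - a)" using lower upper by blast
  qed
qed

text \<open>Centring \<open>f\<close> subtracts the constant \<open>m\<^sup>2\<close>, the limit as
  \<open>t\<close> grows, so that the centred form decays to 0. Midpoint convexity comes from the
  squared norm of \<open>OU a f0 - OU b f0\<close> with \<open>a = exp (- s / 2)\<close> and
  \<open>b = exp (- t / 2)\<close>; positivity is where non-constancy enters.\<close>

lemma corr_steep:
  assumes f: "L2 f" and nc: "\<not> (\<exists>c. AE t in gauss1. f t = c)" and t0: "0 < t0"
  shows "steep_at (\<lambda>t. corr (exp (- t)) f f) t0"
proof -
  define m where "m = (LINT t|gauss1. f t)"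
  define f0 where "f0 = (\<lambda>t. f t - m)"
  have L: "L2 f0" unfolding f0_def using f by (intro L2_diff) auto
  have [measurable]: "f \<in> borel_measurable borel" using f by simp
  have [measurable]: "f0 \<in> borel_measurable borel" using L by simp
  have int: "integrable gauss1 f" using f by (rule L2_integrable)
  have mean: "(LINT t|gauss1. f0 t) = 0" using int gauss1.prob_space by (simp add: f0_def m_def)
  define psi where "psi t = corr (exp (- t)) f0 f0" for t
  have ex: "0 < exp (- t)" "exp (- t) < 1" if "t > 0" for t :: real using that by auto
  have shift: "corr (exp (- t)) f f = psi t + m\<^sup>2" if "t > 0" for t
  proof -
    have r: "-1 \<le> exp (- t)" "exp (- t) \<le> 1" using ex[OF that] by (smt (verit) exp_gt_zero)+
    have c: "corr r (\<lambda>_. m) g = m * (LINT t|gauss1. g t)" if "-1 \<le> r" "r \<le> 1" "g \<in> borel_measurable borel" for r g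
      unfolding corr_def using gauss2_lin_integral[OF kap_sq(2)[OF that(1,2)] that(3)] by simp
    have "corr (exp (- t)) f0 f0 = corr (exp (- t)) f f0 - corr (exp (- t)) (\<lambda>_. m) f0"
      unfolding f0_def using f L r by (intro corr_diff_left) (auto simp: f0_def)
    also have "corr (exp (- t)) f f0 = corr (exp (- t)) f f - corr (exp (- t)) f (\<lambda>_. m)"
      unfolding f0_def using f r by (intro corr_diff_right) auto
    also have "corr (exp (- t)) f (\<lambda>_. m) = m * (LINT t|gauss1. f t)"
      using r c by (subst corr_commute) auto
    finally show ?thesis using c[OF r, of f0] mean by (simp add: psi_def m_def power2_eq_square)
  qed
  have "steep_at psi t0"
  proof (rule convex_positive_decaying_steep[OF _ _ _ _ t0])
    have "continuous_on {0<..} ((\<lambda>r. corr r f0 f0) \<circ> (\<lambda>t. exp (- t)))"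
      by (intro continuous_on_compose continuous_intros continuous_on_subset[OF corr_continuous[OF L]]) auto
    then show "continuous_on {0<..} psi" by (simp add: comp_def psi_def[abs_def])
    show "2 * psi ((s + t) / 2) \<le> psi s + psi t" if st: "0 < s" "0 < t" for s t
    proof -
      define a b where "a = exp (- s / 2)" and "b = exp (- t / 2)"
      have a: "0 < a" "a < 1" and b: "0 < b" "b < 1" using st by (auto simp: a_def b_def)
      have e: "exp (- s) = a * a" "exp (- t) = b * b" "exp (- ((s + t) / 2)) = a * b"
        by (simp_all add: a_def b_def exp_add[symmetric] add_divide_distrib)
      have La: "L2 (OU a f0)" and Lb: "L2 (OU b f0)" using OU_L2[OF L] a b by auto
      have "0 \<le> (LINT s|gauss1. (OU a f0 s - OU b f0 s)\<^sup>2)" by simp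
      also have "\<dots> = (LINT s|gauss1. OU a f0 s * OU a f0 s + OU b f0 s * OU b f0 s - 2 * (OU a f0 s * OU b f0 s))"
        by (rule integral_cong_pointwise) (simp add: power2_eq_square algebra_simps)
      also have "\<dots> = corr (a * a) f0 f0 + corr (b * b) f0 f0 - 2 * corr (a * b) f0 f0"
        by (simp add: L2_integrable_mult La Lb OU_inner[OF L, symmetric] a b)
      finally show ?thesis by (simp add: psi_def e)
    qed
    show "0 < psi t" if "0 < t" for t
    proof (rule ccontr)
      assume "\<not> 0 < psi t"
      then have "corr (exp (- t)) f0 f0 = 0"
        using corr_nonneg[OF L ex[OF that]] by (simp add: psi_def)
      then have "AE t in gauss1. f t = m"
        using corr_eq_0_imp[OF L ex[OF that]] by (simp add: f0_def)
      then show False using nc by blast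
    qed
    have "corr 0 f0 f0 = (LINT s|gauss1. LINT w|gauss1. f0 s * f0 w)"
      unfolding corr_def using gauss11.integral_fst'[OF corr_integrable[OF L L, of 0]] by simp
    then have c0: "corr 0 f0 f0 = 0" using mean by simp
    have "((\<lambda>r. corr r f0 f0) \<longlongrightarrow> corr 0 f0 f0) (at 0 within {0..1})"
      using corr_continuous[OF L] by (auto simp: continuous_on)
    moreover have "filterlim (\<lambda>t::real. exp (- t)) (at 0 within {0..1}) at_top"
      unfolding filterlim_at
      by (auto intro!: filterlim_compose[OF exp_at_bot] filterlim_uminus_at_bot_at_top
          eventually_mono[OF eventually_gt_at_top[of 0]])
    ultimately show "(psi \<longlongrightarrow> 0) at_top"
      unfolding psi_def[abs_def] c0 by (rule filterlim_compose)
  qed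
  then obtain e c K where ec: "e > 0" "c > 0" and K: "\<And>a b. t0 - e < a \<Longrightarrow> a \<le> b \<Longrightarrow> b < t0 + e \<Longrightarrow>
     - K * (b - a) \<le> psi b - psi a \<and> psi b - psi a \<le> - c * (b - a)"
    unfolding steep_at_def by metis
  have "steep_at (\<lambda>t. psi t + m\<^sup>2) t0" by (rule steep_atI[OF ec]) (use K in auto)
  then show ?thesis by (rule steep_at_cong[of _ _ "{0<..}"]) (use t0 shift in auto)
qed

section \<open>Optimal value and alignment for the squared loss\<close>

lemma INF_arg_min:
  fixes f :: "'a \<Rightarrow> real"
  assumes "m \<in> S" "\<And>y. y \<in> S \<Longrightarrow> f m \<le> f y"
  shows "(INF y\<in>S. f y) = f m" and "is_arg_min f (\<lambda>y. y \<in> S) m"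
  using assms by (auto intro!: cInf_eq_minimum simp: is_arg_min_def not_less)

lemma steep_at_add_const: "steep_at H r \<Longrightarrow> steep_at (\<lambda>t. H t + c) r"
  unfolding steep_at_def by simp

lemma F_class_L2: "\<sigma> \<in> F_class \<longleftrightarrow> L2 \<sigma> \<and> \<not> (\<exists>c. AE t in gauss1. \<sigma> t = c)"
  by (auto simp: F_class_def L2_def)

text \<open>Pythagoras: \<open>OU (x \<bullet> xs) \<sigma>s\<close> is the conditional mean of the
  target, so the risk is the squared distance to it plus a term independent of
  \<open>\<sigma>\<close>.\<close>

lemma risk2_eq:
  fixes x xs :: "real ^ 'n"
  assumes x: "norm x = 1" "norm xs = 1" "0 < x \<bullet> xs" "x \<bullet> xs < 1" and L: "L2 \<sigma>" "L2 \<sigma>s"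
  shows "risk2 \<sigma>s xs x \<sigma> = (LINT s|gauss1. (\<sigma> s - OU (x \<bullet> xs) \<sigma>s s)\<^sup>2) +
    ((LINT s|gauss1. (\<sigma>s s)\<^sup>2) - corr ((x \<bullet> xs)\<^sup>2) \<sigma>s \<sigma>s)"
proof -
  define r where "r = x \<bullet> xs"
  have r: "0 < r" "r < 1" "-1 \<le> r" "r \<le> 1" using x by (auto simp: r_def)
  have [measurable]: "\<sigma> \<in> borel_measurable borel" "\<sigma>s \<in> borel_measurable borel" using L by auto
  have LU: "L2 (OU r \<sigma>s)" using OU_L2[OF L(2)] r by simp
  have i1: "integrable gauss2 (\<lambda>p. (\<sigma> (fst p))\<^sup>2)"
    using gauss2_fst_integrable[of "\<lambda>t. (\<sigma> t)\<^sup>2"] L by (simp add: L2_def)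
  have i2: "integrable gauss2 (\<lambda>p. (\<sigma>s (r * fst p + kap r * snd p))\<^sup>2)"
    using gauss2_lin_integrable[of r "kap r" "\<lambda>t. (\<sigma>s t)\<^sup>2"] L kap_sq(2)[of r] r by (simp add: L2_def)
  have "risk2 \<sigma>s xs x \<sigma> = (LINT p|gauss2. (\<sigma> (fst p) - \<sigma>s (r * fst p + kap r * snd p))\<^sup>2)"
    unfolding risk2_def r_def
    using gauss_pair_integral[OF x, of "\<lambda>(s, y). (\<sigma> s - \<sigma>s y)\<^sup>2"] by simp
  also have "\<dots> = (LINT p|gauss2. (\<sigma> (fst p))\<^sup>2 + (\<sigma>s (r * fst p + kap r * snd p))\<^sup>2
      - 2 * (\<sigma> (fst p) * \<sigma>s (r * fst p + kap r * snd p)))"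
    by (rule integral_cong_pointwise) (simp add: power2_eq_square algebra_simps)
  also have "\<dots> = (LINT p|gauss2. (\<sigma> (fst p))\<^sup>2) + (LINT p|gauss2. (\<sigma>s (r * fst p + kap r * snd p))\<^sup>2)
      - 2 * corr r \<sigma> \<sigma>s"
    using i1 i2 corr_integrable[OF L r(3,4)] by (simp add: corr_def)
  also have "\<dots> = (LINT s|gauss1. (\<sigma> s)\<^sup>2) + (LINT s|gauss1. (\<sigma>s s)\<^sup>2) - 2 * L2_inner \<sigma> (OU r \<sigma>s)"
    using gauss2_fst_integral[of "\<lambda>t. (\<sigma> t)\<^sup>2"] gauss2_lin_integral[of r "kap r" "\<lambda>t. (\<sigma>s t)\<^sup>2"]
      kap_sq(2)[of r] r corr_OU[OF L r(1,2)] by simp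
  finally have risk: "risk2 \<sigma>s xs x \<sigma> = (LINT s|gauss1. (\<sigma> s)\<^sup>2) + (LINT s|gauss1. (\<sigma>s s)\<^sup>2) - 2 * L2_inner \<sigma> (OU r \<sigma>s)" .
  have "(LINT s|gauss1. (\<sigma> s - OU r \<sigma>s s)\<^sup>2) = (LINT s|gauss1. (\<sigma> s)\<^sup>2 + (OU r \<sigma>s s)\<^sup>2 - 2 * (\<sigma> s * OU r \<sigma>s s))"
    by (rule integral_cong_pointwise) (simp add: power2_eq_square algebra_simps)
  also have "\<dots> = (LINT s|gauss1. (\<sigma> s)\<^sup>2) + corr (r\<^sup>2) \<sigma>s \<sigma>s - 2 * L2_inner \<sigma> (OU r \<sigma>s)"
  proof -
    have "integrable gauss1 (\<lambda>s. (\<sigma> s)\<^sup>2)" "integrable gauss1 (\<lambda>s. (OU r \<sigma>s s)\<^sup>2)"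
      "integrable gauss1 (\<lambda>s. \<sigma> s * OU r \<sigma>s s)"
      using L LU L2_integrable_mult[OF L(1) LU] by (auto simp: L2_def)
    then show ?thesis by (simp add: corr_square[OF L(2) r(1,2)])
  qed
  finally show ?thesis unfolding r_def[symmetric] risk by simp
qed

lemma f2_minimum:
  fixes x xs :: "real ^ 'n"
  assumes x: "norm x = 1" "norm xs = 1" "0 < x \<bullet> xs" "x \<bullet> xs < 1" and s: "\<sigma>s \<in> F_class"
  shows "f2 \<sigma>s xs x = (LINT s|gauss1. (\<sigma>s s)\<^sup>2) - corr ((x \<bullet> xs)\<^sup>2) \<sigma>s \<sigma>s"
    and "\<exists>\<sigma>. is_arg_min (risk2 \<sigma>s xs x) (\<lambda>\<sigma>. \<sigma> \<in> F_class) \<sigma>"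
proof -
  let ?m = "OU (x \<bullet> xs) \<sigma>s"
  have L: "L2 \<sigma>s" using s by (simp add: F_class_L2)
  have Lm: "L2 ?m" using OU_L2[OF L x(3,4)] .
  have m: "?m \<in> F_class" using Lm OU_nonconst[OF L x(3,4)] s by (auto simp: F_class_L2)
  have val: "risk2 \<sigma>s xs x ?m = (LINT s|gauss1. (\<sigma>s s)\<^sup>2) - corr ((x \<bullet> xs)\<^sup>2) \<sigma>s \<sigma>s"
    using risk2_eq[OF x Lm L] by simp
  have min: "risk2 \<sigma>s xs x ?m \<le> risk2 \<sigma>s xs x \<sigma>" if "\<sigma> \<in> F_class" for \<sigma>
    unfolding val using risk2_eq[OF x _ L, of \<sigma>] that by (simp add: F_class_L2)
  show "f2 \<sigma>s xs x = (LINT s|gauss1. (\<sigma>s s)\<^sup>2) - corr ((x \<bullet> xs)\<^sup>2) \<sigma>s \<sigma>s"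
    unfolding f2_def using INF_arg_min(1)[of ?m F_class "risk2 \<sigma>s xs x", OF m min] val by simp
  show "\<exists>\<sigma>. is_arg_min (risk2 \<sigma>s xs x) (\<lambda>\<sigma>. \<sigma> \<in> F_class) \<sigma>"
    using INF_arg_min(2)[of ?m F_class "risk2 \<sigma>s xs x", OF m min] by blast
qed

lemma f2_RGA:
  fixes x xs :: "real ^ 'n"
  assumes x: "norm x = 1" "norm xs = 1" "0 < x \<bullet> xs" "x \<bullet> xs < 1" and s: "\<sigma>s \<in> F_class"
  shows "RGA 1 (f2 \<sigma>s xs) x xs"
proof (rule RGA_of_steep_profile[OF x])
  define A where "A = (LINT s|gauss1. (\<sigma>s s)\<^sup>2)"
  define h where "h t = A - corr (exp (- t)) \<sigma>s \<sigma>s" for t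
  show "f2 \<sigma>s xs y = A - corr ((y \<bullet> xs)\<^sup>2) \<sigma>s \<sigma>s" if "norm y = 1" "0 < y \<bullet> xs" "y \<bullet> xs < 1" for y
    using f2_minimum(1)[OF that(1) x(2) that(2,3) s] by (simp add: A_def)
  define r where "r = x \<bullet> xs"
  \<comment> \<open>The optimal value contains \<open>corr\<close> at
    \<open>r\<^sup>2 = exp (- t)\<close> with \<open>t = - 2 * ln r\<close>, the variable in which
    the form is convex.\<close>
  have "steep_at (\<lambda>t. corr (exp (- t)) \<sigma>s \<sigma>s + (- A)) (- 2 * ln r)"
    using s x by (intro steep_at_add_const corr_steep) (auto simp: F_class_L2 r_def)
  then have "steep_at (\<lambda>t. - h t) (- 2 * ln r)" by (simp add: h_def)
  then have "steep_at (\<lambda>r. h (- 2 * ln r)) r"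
    by (rule steep_at_compose[where S = "{0<..}" and tau' = "\<lambda>r. - 2 / r"])
       (use x in \<open>auto simp: r_def intro!: derivative_eq_intros continuous_intros\<close>)
  then show "steep_at (\<lambda>r. A - corr (r\<^sup>2) \<sigma>s \<sigma>s) (x \<bullet> xs)"
    unfolding r_def[symmetric]
  proof (rule steep_at_cong)
    fix t :: real assume "t \<in> {0<..}"
    then have "exp (2 * ln t) = t\<^sup>2" by (simp add: exp_double)
    then show "A - corr (t\<^sup>2) \<sigma>s \<sigma>s = h (- 2 * ln t)" by (simp add: h_def)
  qed (use x in \<open>auto simp: r_def\<close>)
qed

subsection \<open>The distribution function of the standard normal law\<close>

text \<open>The normal distribution function minus 1/2, normalised to be odd.\<close>

definition Phi :: "real \<Rightarrow> real" where "Phi y = (LBINT t=0..y. \<phi> t)"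

lemma isCont_std_normal: "isCont \<phi> t"
  unfolding std_normal_density_def[abs_def] by (intro continuous_intros) auto

lemma Phi_deriv: "(Phi has_real_derivative \<phi> y) (at y)"
proof -
  have "((\<lambda>u. LBINT t=ereal 0..ereal u. \<phi> t) has_vector_derivative \<phi> y)
      (at y within {- \<bar>y\<bar> - 1..\<bar>y\<bar> + 1})"
    by (rule interval_integral_FTC2)
       (auto intro!: continuous_at_imp_continuous_on isCont_std_normal)
  then have "(Phi has_real_derivative \<phi> y) (at y within {- \<bar>y\<bar> - 1..\<bar>y\<bar> + 1})"
    by (simp add: has_real_derivative_iff_has_vector_derivative Phi_def[abs_def] zero_ereal_def)
  moreover have "at y within {- \<bar>y\<bar> - 1..\<bar>y\<bar> + 1} = at y"
    by (rule at_within_interior) (auto simp: interior_atLeastAtMost_real)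
  ultimately show ?thesis by simp
qed

lemma Phi_deriv' [derivative_intros]:
  "(g has_real_derivative g') (at x within S) \<Longrightarrow>
    ((\<lambda>x. Phi (g x)) has_real_derivative \<phi> (g x) * g') (at x within S)"
  by (rule DERIV_chain2[OF Phi_deriv])

lemma isCont_Phi: "isCont Phi y"
  using Phi_deriv by (rule DERIV_isCont)

lemma Phi_measurable [measurable]: "Phi \<in> borel_measurable borel"
  by (intro borel_measurable_continuous_onI continuous_at_imp_continuous_on) (simp add: isCont_Phi)

lemma Phi_0 [simp]: "Phi 0 = 0" by (simp add: Phi_def zero_ereal_def[symmetric])

lemma std_normal_minus [simp]: "\<phi> (- t) = \<phi> t"
  by (simp add: std_normal_density_def)

lemma std_normal_pos [simp]: "0 < \<phi> t" by (rule normal_density_pos) simp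

lemma std_normal_le: "\<bar>s\<bar> \<le> \<bar>t\<bar> \<Longrightarrow> \<phi> t \<le> \<phi> s"
  by (simp add: std_normal_density_def abs_le_square_iff divide_right_mono)

lemma Phi_minus [simp]: "Phi (- y) = - Phi y"
proof -
  have "((\<lambda>y. Phi y + Phi (- y)) has_real_derivative 0) (at x)" for x
    by (auto intro!: derivative_eq_intros Phi_deriv)
  then have "Phi y + Phi (- y) = Phi 0 + Phi (- 0)" by (intro DERIV_isconst_all) auto
  then show ?thesis by simp
qed

lemma Phi_strict_mono: "a < b \<Longrightarrow> Phi a < Phi b"
  by (rule DERIV_pos_imp_increasing) (auto intro!: exI Phi_deriv std_normal_pos)

lemma Phi_mono: "a \<le> b \<Longrightarrow> Phi a \<le> Phi b"
  using Phi_strict_mono[of a b] by (cases "a = b") auto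

lemma gauss1_interval: "a \<le> b \<Longrightarrow> measure gauss1 {a..b} = Phi b - Phi a"
proof -
  assume ab: "a \<le> b"
  have "measure gauss1 {a..b} = (LINT t|gauss1. indicator {a..b} t)" by simp
  also have "\<dots> = (LINT t|lborel. \<phi> t * indicator {a..b} t)"
    unfolding gauss1_def by (subst integral_density) auto
  also have "\<dots> = Phi b - Phi a"
    by (rule integral_FTC_Icc_real[OF ab]) (auto intro: Phi_deriv isCont_std_normal)
  finally show ?thesis .
qed

lemma gauss1_singleton: "measure gauss1 {a} = 0"
  using gauss1_interval[of a a] by simp

lemma AE_gauss1_neq: "AE t in gauss1. t \<noteq> a"
proof (rule AE_not_in[of "{a}", simplified])
  show "{a} \<in> null_sets gauss1"
    using gauss1_singleton[of a] by (simp add: null_sets_def gauss1.emeasure_eq_measure)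
qed

lemma gauss1_uminus: "distr gauss1 borel uminus = gauss1"
proof -
  have "distr gauss1 borel uminus = distr (density lborel (\<lambda>t. ennreal (\<phi> t))) lborel uminus"
    by (rule distr_cong) (auto simp: gauss1_def)
  also have "\<dots> = density (distr lborel lborel uminus) (\<lambda>t. ennreal (\<phi> t))"
    by (subst density_distr) (auto simp: comp_def)
  also have "distr lborel lborel uminus = (lborel :: real measure)"
    using lborel_distr_uminus by (metis distr_cong sets_lborel)
  finally show ?thesis by (simp add: gauss1_def)
qed

lemma
  fixes f :: "real \<Rightarrow> real"
  assumes [measurable]: "f \<in> borel_measurable borel"
  shows gauss1_integral_minus: "(LINT t|gauss1. f (- t)) = (LINT t|gauss1. f t)"
    and gauss1_integrable_minus: "integrable gauss1 (\<lambda>t. f (- t)) \<longleftrightarrow> integrable gauss1 f"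
  by (subst (2) gauss1_uminus[symmetric], subst integral_distr, auto)
     (subst (asm) gauss1_uminus[symmetric], subst (asm) integrable_distr_eq, auto)+

text \<open>The intervals from \<open>- n\<close> to \<open>n\<close> have mass
  \<open>2 * Phi n\<close> and exhaust the line.\<close>

lemma Phi_at_top: "(Phi \<longlongrightarrow> 1/2) at_top"
proof -
  have "(\<lambda>n. measure gauss1 {- real n..real n}) \<longlonglongrightarrow> measure gauss1 (\<Union>n. {- real n..real n})"
    by (rule gauss1.finite_Lim_measure_incseq) (auto simp: incseq_def)
  moreover have "(\<Union>n. {- real n..real n}) = UNIV"
  proof -
    have "\<exists>n. - real n \<le> x \<and> x \<le> real n" for x
    proof -
      obtain n where "\<bar>x\<bar> \<le> real n" using real_arch_simple by blast
      then have "- real n \<le> x \<and> x \<le> real n" by auto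
      then show ?thesis ..
    qed
    then show ?thesis by auto
  qed
  ultimately have "(\<lambda>n. 2 * Phi (real n)) \<longlonglongrightarrow> 1"
    using gauss1.prob_space by (simp add: gauss1_interval)
  then have "(\<lambda>n. 2 * Phi (real n) / 2) \<longlonglongrightarrow> 1 / 2" by (intro tendsto_intros) auto
  then have lim: "(\<lambda>n. Phi (real n)) \<longlonglongrightarrow> 1 / 2" by simp
  show ?thesis
  proof (rule order_tendstoI)
    fix a :: real assume "a < 1/2"
    then obtain n where "a < Phi (real n)"
      using eventually_happens'[OF sequentially_bot order_tendstoD(1)[OF lim]] by blast
    then have "a < Phi x" if "real n \<le> x" for x using Phi_mono[OF that] by linarith
    then show "\<forall>\<^sub>F x in at_top. a < Phi x"
      by (rule eventually_mono[OF eventually_ge_at_top[of "real n"]])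
  next
    fix a :: real assume a: "1/2 < a"
    have "Phi (real n) \<le> 1/2" for n
      using gauss1.prob_le_1[of "{- real n..real n}"] by (simp add: gauss1_interval)
    then have "Phi x < a" for x
      using Phi_mono[of x "real (nat \<lceil>x\<rceil>)"] a by (smt (verit) real_nat_ceiling_ge)
    then show "\<forall>\<^sub>F x in at_top. Phi x < a" by simp
  qed
qed

lemma Phi_less_half: "Phi y < 1 / 2"
proof -
  have "Phi x \<le> 1/2" for x
    by (rule tendsto_lowerbound[OF Phi_at_top])
       (auto intro!: eventually_mono[OF eventually_ge_at_top[of x]] Phi_mono)
  from this[of "y + 1"] show ?thesis using Phi_strict_mono[of y "y + 1"] by simp
qed

text \<open>For \<open>y \<ge> 0\<close>, averaging the integrand at \<open>v\<close> and
  \<open>- v\<close> leaves the indicator of the interval from \<open>- y\<close> to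
  \<open>y\<close>; negative \<open>y\<close> follow by oddness.\<close>

lemma gauss1_sgn: "(LINT v|gauss1. sgn (y - v)) = 2 * Phi y"
proof -
  have *: "(LINT v|gauss1. sgn (y - v)) = 2 * Phi y" if y: "y \<ge> 0" for y
  proof -
    have [simp]: "integrable gauss1 (\<lambda>v. sgn (c + v))" "integrable gauss1 (\<lambda>v. sgn (c - v))" for c :: real
      by (auto intro!: gauss1.integrable_const_bound[of _ 1] simp: sgn_if)
    have "2 * (LINT v|gauss1. sgn (y - v)) = (LINT v|gauss1. sgn (y - v)) + (LINT v|gauss1. sgn (y - (- v)))"
      using gauss1_integral_minus[of "\<lambda>v. sgn (y - v)"] by simp
    also have "\<dots> = (LINT v|gauss1. sgn (y - v) + sgn (y + v))" by simp
    also have "\<dots> = (LINT v|gauss1. 2 * indicator {- y..y} v)"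
      by (rule integral_cong_AE)
         (use AE_gauss1_neq[of y] AE_gauss1_neq[of "- y"] y in \<open>auto simp: sgn_if indicator_def elim!: eventually_elim2\<close>)
    also have "\<dots> = 2 * (2 * Phi y)" using gauss1_interval[of "- y" y] y by simp
    finally show ?thesis by simp
  qed
  show ?thesis
  proof (cases "y \<ge> 0")
    case False
    have "(LINT v|gauss1. sgn (y - v)) = - (LINT v|gauss1. sgn (- y - v))"
      using gauss1_integral_minus[of "\<lambda>v. sgn (y - v)"]
      by (simp add: sgn_minus[symmetric] flip: Bochner_Integration.integral_minus) (simp add: add.commute)
    then show ?thesis using *[of "- y"] False by simp
  qed (rule *)
qed

subsection \<open>The absolute loss\<close>

lemma strict_mono_not_AE_const:
  fixes \<sigma> :: "real \<Rightarrow> real"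
  assumes "strict_mono \<sigma>"
  shows "\<not> (\<exists>c. AE t in gauss1. \<sigma> t = c)"
proof
  assume "\<exists>c. AE t in gauss1. \<sigma> t = c"
  then obtain c where c: "AE t in gauss1. \<sigma> t = c" by blast
  obtain a where a: "\<And>t. \<sigma> t = c \<Longrightarrow> t = a"
    using assms strict_mono_eq by metis
  have "AE t in gauss1. False" using c AE_gauss1_neq[of a] by eventually_elim (use a in blast)
  then show False by simp
qed

lemma F_plus_L2: "\<sigma> \<in> F_plus \<longleftrightarrow> L2 \<sigma> \<and> strict_mono \<sigma> \<and> (\<forall>t. lipschitz_near UNIV \<sigma> t)"
  by (auto simp: F_plus_def F_class_L2 dest: strict_mono_not_AE_const)

lemma lipschitz_near_compose:
  fixes \<sigma> M :: "real \<Rightarrow> real"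
  assumes M: "1-lipschitz_on UNIV M" and \<sigma>: "lipschitz_near UNIV \<sigma> (M t)"
  shows "lipschitz_near UNIV (\<lambda>t. \<sigma> (M t)) t"
proof -
  obtain e L where e: "e > 0" "L-lipschitz_on (cball (M t) e) \<sigma>"
    using \<sigma> by (auto simp: lipschitz_near_def)
  have "M ` cball t e \<subseteq> cball (M t) e"
  proof safe
    fix s assume "s \<in> cball t e"
    then show "M s \<in> cball (M t) e" using lipschitz_onD[OF M, of t s] by (simp add: order_trans[of _ "dist t s"])
  qed
  then have "L-lipschitz_on (M ` cball t e) \<sigma>" using e lipschitz_on_subset by blast
  then have "(L * 1)-lipschitz_on (cball t e) (\<sigma> \<circ> M)"
    using M by (intro lipschitz_on_compose lipschitz_on_subset[OF M]) auto
  then show ?thesis unfolding lipschitz_near_def comp_def using e by auto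
qed

lemma F_plus_compose:
  assumes \<sigma>: "\<sigma> \<in> F_plus" and M: "strict_mono M" "1-lipschitz_on UNIV M" and L: "L2 (\<lambda>t. \<sigma> (M t))"
  shows "(\<lambda>t. \<sigma> (M t)) \<in> F_plus"
  using assms lipschitz_near_compose[OF M(2)] by (auto simp: F_plus_L2 strict_mono_def)

lemma F_plus_scale:
  assumes \<sigma>: "\<sigma> \<in> F_plus" and r: "0 < r" "r < 1"
  shows "(\<lambda>t. \<sigma> (r * t)) \<in> F_plus"
proof (rule F_plus_compose[OF \<sigma>])
  show "strict_mono (\<lambda>t. r * t)" using r by (auto simp: strict_mono_def)
  show "1-lipschitz_on UNIV (\<lambda>t. r * t)"
  proof (rule lipschitz_onI)
    fix s t :: real
    have "r * \<bar>s - t\<bar> \<le> 1 * \<bar>s - t\<bar>" using r by (intro mult_right_mono) auto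
    then show "dist (r * s) (r * t) \<le> 1 * dist s t"
      using r by (simp add: dist_real_def right_diff_distrib[symmetric] abs_mult)
  qed simp
  show "L2 (\<lambda>t. \<sigma> (r * t))" using L2_affine[of \<sigma> r 0] \<sigma> r by (simp add: F_plus_L2)
qed

lemma L2_gauss2_integrable:
  assumes "L2 f" "a\<^sup>2 + b\<^sup>2 = 1"
  shows "integrable gauss2 (\<lambda>p. f (a * fst p + b * snd p))"
  using L2_integrable[OF assms(1)] gauss2_lin_integrable[OF assms(2)] assms(1) by simp

lemma integrable_sgn_mult:
  fixes f g :: "real \<times> real \<Rightarrow> real"
  assumes "integrable gauss2 f" "g \<in> borel_measurable gauss2"
  shows "integrable gauss2 (\<lambda>p. sgn (g p) * f p)"
  by (rule integrable_bound_L[OF assms(1)])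
     (use assms in \<open>auto simp: abs_mult abs_sgn_eq\<close>)

text \<open>The optimal absolute risk as a function of the tangent \<open>t = kap r / r\<close> of
  the angle; the factor \<open>2 * Phi (t * y)\<close> is the conditional mean of the sign of the
  noise given the target's argument \<open>y\<close>.\<close>

definition sgn_profile :: "(real \<Rightarrow> real) \<Rightarrow> real \<Rightarrow> real" where
  "sgn_profile f t = (LINT y|gauss1. f y * (2 * Phi (t * y)))"

text \<open>Reflecting so that the argument of \<open>f\<close> becomes the first coordinate turns the sign of the second
  coordinate into a sign whose conditional mean is explicit.\<close>

lemma sgn_profile_eq:
  assumes f: "L2 f" and r: "0 < r" "r < 1"
  shows "(LINT p|gauss2. sgn (snd p) * f (r * fst p + kap r * snd p)) = sgn_profile f (kap r / r)"
proof -
  have [measurable]: "f \<in> borel_measurable borel" using f by simp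
  have r1: "r\<^sup>2 + (kap r)\<^sup>2 = 1" using kap_sq(2)[of r] r by simp
  define h where "h = (\<lambda>p::real \<times> real. sgn (kap r * fst p - r * snd p) * f (fst p))"
  have "kap r * (r * s + kap r * w) - r * (kap r * s - r * w) = (r\<^sup>2 + (kap r)\<^sup>2) * w" for s w
    by (simp add: algebra_simps power2_eq_square)
  then have *: "kap r * (r * s + kap r * w) - r * (kap r * s - r * w) = w" for s w using r1 by simp
  have "(LINT p|gauss2. sgn (snd p) * f (r * fst p + kap r * snd p)) = (LINT p|gauss2. h p)"
    using gauss2_reflect_integral[OF r1, of h] unfolding h_def by (simp add: *)
  also have "\<dots> = (LINT y|gauss1. LINT v|gauss1. sgn (kap r * y - r * v) * f y)"
  proof -
    have "integrable gauss2 h" unfolding h_def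
      using L2_gauss2_integrable[OF f, of 1 0] by (intro integrable_sgn_mult) auto
    from gauss11.integral_fst'[OF this] show ?thesis by (simp add: h_def)
  qed
  also have "\<dots> = sgn_profile f (kap r / r)"
    unfolding sgn_profile_def
  proof (rule integral_cong_pointwise)
    fix y
    have "sgn (kap r * y - r * v) = sgn (kap r / r * y - v)" for v
    proof -
      have "kap r * y - r * v = r * (kap r / r * y - v)" using r by (simp add: algebra_simps)
      then show ?thesis using r by (simp add: sgn_mult)
    qed
    then show "(LINT v|gauss1. sgn (kap r * y - r * v) * f y) = f y * (2 * Phi (kap r / r * y))"
      by (simp add: gauss1_sgn mult.commute)
  qed
  finally show ?thesis .
qed

text \<open>Weak duality: \<open>\<bar>\<sigma> s - \<sigma>s y\<bar> \<ge> sgn w * (\<sigma>s y - \<sigma> s)\<close>, and \<open>sgn w\<close> has mean zero given \<open>s\<close>; equality holds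
  for the conditional median \<open>\<sigma> s = \<sigma>s (r * s)\<close>.\<close>

lemma f1_minimum:
  fixes x xs :: "real ^ 'n"
  assumes x: "norm x = 1" "norm xs = 1" "0 < x \<bullet> xs" "x \<bullet> xs < 1" and s: "\<sigma>s \<in> F_plus"
  shows "f1 \<sigma>s xs x = sgn_profile \<sigma>s (kap (x \<bullet> xs) / (x \<bullet> xs))"
    and "\<exists>\<sigma>. is_arg_min (risk1 \<sigma>s xs x) (\<lambda>\<sigma>. \<sigma> \<in> F_plus) \<sigma>"
proof -
  define r where "r = x \<bullet> xs"
  have r: "0 < r" "r < 1" using x by (auto simp: r_def)
  have r1: "r\<^sup>2 + (kap r)\<^sup>2 = 1" using kap_sq(2)[of r] r by simp
  have L: "L2 \<sigma>s" and mono: "strict_mono \<sigma>s" using s by (auto simp: F_plus_L2)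
  have [measurable]: "\<sigma>s \<in> borel_measurable borel" using L by simp
  let ?Y = "\<lambda>p. r * fst p + kap r * snd p"
  have iY: "integrable gauss2 (\<lambda>p. \<sigma>s (?Y p))" using L2_gauss2_integrable[OF L r1] .
  have risk: "risk1 \<sigma>s xs x \<sigma> = (LINT p|gauss2. \<bar>\<sigma> (fst p) - \<sigma>s (?Y p)\<bar>)" if "L2 \<sigma>" for \<sigma>
  proof -
    have [measurable]: "\<sigma> \<in> borel_measurable borel" using that by simp
    show ?thesis unfolding risk1_def r_def
      using gauss_pair_integral[OF x, of "\<lambda>(s, y). \<bar>\<sigma> s - \<sigma>s y\<bar>"] by simp
  qed
  have dual: "(LINT p|gauss2. sgn (snd p) * (\<sigma>s (?Y p) - \<sigma> (fst p))) = sgn_profile \<sigma>s (kap r / r)"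
    and int: "integrable gauss2 (\<lambda>p. sgn (snd p) * (\<sigma>s (?Y p) - \<sigma> (fst p)))"
    and iS: "integrable gauss2 (\<lambda>p. \<sigma> (fst p))" if L\<sigma>: "L2 \<sigma>" for \<sigma>
  proof -
    have [measurable]: "\<sigma> \<in> borel_measurable borel" using that by simp
    show iS: "integrable gauss2 (\<lambda>p. \<sigma> (fst p))" using L2_gauss2_integrable[OF L\<sigma>, of 1 0] by simp
    show "integrable gauss2 (\<lambda>p. sgn (snd p) * (\<sigma>s (?Y p) - \<sigma> (fst p)))"
      using iS iY by (intro integrable_sgn_mult) auto
    have i1: "integrable gauss2 (\<lambda>p. sgn (snd p) * \<sigma> (fst p))" using iS by (intro integrable_sgn_mult) auto
    have i2: "integrable gauss2 (\<lambda>p. sgn (snd p) * \<sigma>s (?Y p))" using iY by (intro integrable_sgn_mult) auto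
    have "(LINT w|gauss1. sgn w) = 0" using gauss1_sgn[of 0] by (simp add: sgn_minus)
    then have "(LINT p|gauss2. sgn (snd p) * \<sigma> (fst p)) = 0"
      using gauss11.integral_fst'[OF i1] by simp
    then show "(LINT p|gauss2. sgn (snd p) * (\<sigma>s (?Y p) - \<sigma> (fst p))) = sgn_profile \<sigma>s (kap r / r)"
      using i1 i2 sgn_profile_eq[OF L r] by (simp add: right_diff_distrib)
  qed
  have lower: "sgn_profile \<sigma>s (kap r / r) \<le> risk1 \<sigma>s xs x \<sigma>" if "\<sigma> \<in> F_plus" for \<sigma>
  proof -
    have L\<sigma>: "L2 \<sigma>" using that by (simp add: F_plus_L2)
    show ?thesis unfolding dual[OF L\<sigma>, symmetric] risk[OF L\<sigma>]
    proof (rule integral_mono)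
      show "sgn (snd p) * (\<sigma>s (?Y p) - \<sigma> (fst p)) \<le> \<bar>\<sigma> (fst p) - \<sigma>s (?Y p)\<bar>" for p
        by (auto simp: sgn_if)
    qed (use int[OF L\<sigma>] iS[OF L\<sigma>] iY in auto)
  qed
  let ?m = "\<lambda>t. \<sigma>s (r * t)"
  have m: "?m \<in> F_plus" by (rule F_plus_scale[OF s r])
  then have Lm: "L2 ?m" by (simp add: F_plus_L2)
  have "\<bar>?m (fst p) - \<sigma>s (?Y p)\<bar> = sgn (snd p) * (\<sigma>s (?Y p) - ?m (fst p))" for p
  proof -
    have "0 < kap r" using kap_bounds r by blast
    then have "snd p > 0 \<Longrightarrow> r * fst p < ?Y p" "snd p < 0 \<Longrightarrow> ?Y p < r * fst p"
      by (auto simp: mult_less_0_iff)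
    then have "snd p > 0 \<Longrightarrow> \<sigma>s (r * fst p) < \<sigma>s (?Y p)" "snd p < 0 \<Longrightarrow> \<sigma>s (?Y p) < \<sigma>s (r * fst p)"
      using strict_monoD[OF mono] by blast+
    moreover have "snd p = 0 \<Longrightarrow> \<sigma>s (?Y p) = \<sigma>s (r * fst p)" by simp
    ultimately show ?thesis by (cases "snd p" "0::real" rule: linorder_cases) simp_all
  qed
  then have val: "risk1 \<sigma>s xs x ?m = sgn_profile \<sigma>s (kap r / r)"
    unfolding risk[OF Lm] dual[OF Lm, symmetric] by simp
  show "f1 \<sigma>s xs x = sgn_profile \<sigma>s (kap (x \<bullet> xs) / (x \<bullet> xs))"
    unfolding f1_def r_def[symmetric] val[symmetric] by (rule INF_arg_min(1)[OF m]) (simp add: val lower)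
  show "\<exists>\<sigma>. is_arg_min (risk1 \<sigma>s xs x) (\<lambda>\<sigma>. \<sigma> \<in> F_plus) \<sigma>"
    by (rule exI, rule INF_arg_min(2)[OF m]) (simp add: val lower)
qed

lemma L2_ident: "L2 (\<lambda>t. t)"
  using integrable_std_normal_moment[of 2] by (simp add: L2_def gauss1_def integrable_density)

text \<open>Only \<open>Phi\<close> depends on \<open>t\<close>, and the increment \<open>G\<close>
  is odd in \<open>y\<close>, so pairing \<open>y\<close> with \<open>- y\<close> replaces
  \<open>\<sigma> y\<close> by \<open>\<sigma> y - \<sigma> (- y)\<close>. By the mean value theorem
  in \<open>t\<close> the integrand becomes \<open>(b - a) * (D y * \<phi> (z * y))\<close>, where
  \<open>D\<close> is positive off 0 and \<open>\<phi> (z * y)\<close> lies between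
  \<open>\<phi> (B * y)\<close> and \<open>\<phi> 0\<close>.\<close>

lemma sgn_profile_steep:
  assumes s: "\<sigma> \<in> F_plus" and t0: "0 < t0"
  shows "steep_at (\<lambda>t. - sgn_profile \<sigma> t) t0"
proof -
  have L: "L2 \<sigma>" and mono: "strict_mono \<sigma>" using s by (auto simp: F_plus_L2)
  have [measurable]: "\<sigma> \<in> borel_measurable borel" using L by simp
  define D where "D y = y * (\<sigma> y - \<sigma> (- y))" for y
  have [measurable]: "D \<in> borel_measurable borel" unfolding D_def by measurable
  have L': "L2 (\<lambda>y. \<sigma> (- y))" using L gauss1_integrable_minus[of "\<lambda>y. (\<sigma> y)\<^sup>2"] by (simp add: L2_def)
  have D: "D y > 0" if "y \<noteq> 0" for y
    using that strict_monoD[OF mono, of y "- y"] strict_monoD[OF mono, of "- y" y]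
    by (cases "y > 0") (auto simp: D_def mult_neg_neg)
  then have D0: "D y \<ge> 0" for y by (cases "y = 0") (auto simp: D_def less_imp_le)
  have iD: "integrable gauss1 D"
    unfolding D_def by (intro L2_integrable_mult L2_ident L2_diff L L')
  \<comment> \<open>The right end of the window around \<open>t0\<close>, hence an upper bound for
    every intermediate point \<open>z\<close>.\<close>
  define B where "B = 2 * t0"
  have iDB: "integrable gauss1 (\<lambda>y. D y * \<phi> (B * y))"
  proof (rule integrable_bound_L[of _ "\<lambda>y. D y * \<phi> 0"])
    show "AE y in gauss1. norm (D y * \<phi> (B * y)) \<le> norm (D y * \<phi> 0)"
      using D0 by (auto simp: abs_mult intro!: mult_left_mono std_normal_le)
  qed (use iD in auto)
  define c where "c = (LINT y|gauss1. D y * \<phi> (B * y))"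
  define K where "K = (LINT y|gauss1. D y * \<phi> 0)"
  have "c \<noteq> 0"
  proof
    assume "c = 0"
    then have "AE y in gauss1. D y * \<phi> (B * y) = 0"
      using iDB D0 unfolding c_def by (subst (asm) integral_nonneg_eq_0_iff_AE) auto
    then have "AE y in gauss1. False"
      using AE_gauss1_neq[of 0]
    proof eventually_elim
      case (elim y)
      then show False using D[of y] std_normal_pos[of "B * y"] by simp
    qed
    then show False by simp
  qed
  moreover have "c \<ge> 0" unfolding c_def using D0 by simp
  ultimately have c: "c > 0" by simp
  have iP: "integrable gauss1 (\<lambda>y. \<sigma> y * (2 * Phi (t * y)))" for t
  proof (rule integrable_bound_L[OF L2_integrable[OF L]])
    have "\<bar>2 * Phi y\<bar> \<le> 1" for y using Phi_less_half[of y] Phi_less_half[of "- y"] by auto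
    then show "AE y in gauss1. norm (\<sigma> y * (2 * Phi (t * y))) \<le> norm (\<sigma> y)"
      by (auto simp: abs_mult intro!: mult_left_le)
  qed simp
  show ?thesis
  proof (rule steep_atI[OF t0 c])
    fix a b assume ab: "t0 - t0 < a" "a \<le> b" "b < t0 + t0"
    define G where "G y = Phi (b * y) - Phi (a * y)" for y
    have [measurable]: "G \<in> borel_measurable borel" unfolding G_def by measurable
    have Gm: "G (- y) = - G y" for y by (simp add: G_def)
    have iG: "integrable gauss1 (\<lambda>y. \<sigma> y * G y)"
    proof -
      have "integrable gauss1 (\<lambda>y. (1 / 2) * (\<sigma> y * (2 * Phi (b * y)) - \<sigma> y * (2 * Phi (a * y))))"
        using iP by (intro integrable_mult_right Bochner_Integration.integrable_diff)
      then show ?thesis by (simp add: G_def right_diff_distrib)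
    qed
    have iG': "integrable gauss1 (\<lambda>y. \<sigma> (- y) * G y)"
      using gauss1_integrable_minus[of "\<lambda>y. \<sigma> y * G y"] iG by (simp add: Gm)
    have "sgn_profile \<sigma> b - sgn_profile \<sigma> a = (LINT y|gauss1. \<sigma> y * (2 * Phi (b * y)) - \<sigma> y * (2 * Phi (a * y)))"
      unfolding sgn_profile_def using iP by simp
    also have "\<dots> = (LINT y|gauss1. 2 * (\<sigma> y * G y))"
      by (rule integral_cong_pointwise) (simp add: G_def algebra_simps)
    also have "\<dots> = (LINT y|gauss1. \<sigma> y * G y) + (LINT y|gauss1. \<sigma> y * G y)" by simp
    also have "(LINT y|gauss1. \<sigma> y * G y) + (LINT y|gauss1. \<sigma> y * G y) =
        (LINT y|gauss1. \<sigma> y * G y) - (LINT y|gauss1. \<sigma> (- y) * G y)"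
      using gauss1_integral_minus[of "\<lambda>y. \<sigma> y * G y"]
      by (simp add: Gm)
    also have "\<dots> = (LINT y|gauss1. (\<sigma> y - \<sigma> (- y)) * G y)"
      using iG iG' by (simp add: left_diff_distrib)
    finally have diff: "sgn_profile \<sigma> b - sgn_profile \<sigma> a = (LINT y|gauss1. (\<sigma> y - \<sigma> (- y)) * G y)" .
    have iDG: "integrable gauss1 (\<lambda>y. (\<sigma> y - \<sigma> (- y)) * G y)"
      using iG iG' by (simp add: left_diff_distrib)
    have bounds: "(b - a) * (D y * \<phi> (B * y)) \<le> (\<sigma> y - \<sigma> (- y)) * G y \<and>
        (\<sigma> y - \<sigma> (- y)) * G y \<le> (b - a) * (D y * \<phi> 0)" for y
    proof (cases "a = b")
      case False
      then have lt: "a < b" using ab by simp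
      have "\<exists>z>a. z < b \<and> Phi (b * y) - Phi (a * y) = (b - a) * (\<phi> (z * y) * y)"
        by (rule MVT2[OF lt]) (auto intro!: derivative_eq_intros Phi_deriv)
      then obtain z where z: "a < z" "z < b" "G y = (b - a) * (\<phi> (z * y) * y)"
        by (auto simp: G_def)
      have e: "(\<sigma> y - \<sigma> (- y)) * G y = (b - a) * (D y * \<phi> (z * y))"
        unfolding z(3) D_def by (simp add: algebra_simps)
      have "\<bar>z * y\<bar> \<le> \<bar>B * y\<bar>" using z ab t0 by (auto simp: B_def abs_mult intro!: mult_right_mono)
      then have "\<phi> (B * y) \<le> \<phi> (z * y)" by (rule std_normal_le)
      moreover have "\<phi> (z * y) \<le> \<phi> 0" by (rule std_normal_le) simp
      ultimately show ?thesis unfolding e using D0[of y] lt by (auto intro!: mult_left_mono)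
    qed (simp add: G_def)
    have "(LINT y|gauss1. (b - a) * (D y * \<phi> (B * y))) \<le> (LINT y|gauss1. (\<sigma> y - \<sigma> (- y)) * G y)"
      using iDB iDG bounds by (intro integral_mono) auto
    moreover have "(LINT y|gauss1. (\<sigma> y - \<sigma> (- y)) * G y) \<le> (LINT y|gauss1. (b - a) * (D y * \<phi> 0))"
      using iD iDG bounds by (intro integral_mono) auto
    ultimately have "(b - a) * c \<le> sgn_profile \<sigma> b - sgn_profile \<sigma> a"
      "sgn_profile \<sigma> b - sgn_profile \<sigma> a \<le> (b - a) * K"
      unfolding diff c_def K_def by (simp_all only: integral_mult_right_zero)
    then show "- K * (b - a) \<le> - sgn_profile \<sigma> b - - sgn_profile \<sigma> a \<and>
      - sgn_profile \<sigma> b - - sgn_profile \<sigma> a \<le> - c * (b - a)"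
      by (auto simp: mult.commute)
  qed
qed

lemma f1_RGA:
  fixes x xs :: "real ^ 'n"
  assumes x: "norm x = 1" "norm xs = 1" "0 < x \<bullet> xs" "x \<bullet> xs < 1" and s: "\<sigma>s \<in> F_plus"
  shows "RGA 1 (f1 \<sigma>s xs) x xs"
proof (rule RGA_of_steep_profile[OF x])
  show "f1 \<sigma>s xs y = sgn_profile \<sigma>s (kap (y \<bullet> xs) / (y \<bullet> xs))" if "norm y = 1" "0 < y \<bullet> xs" "y \<bullet> xs < 1" for y
    by (rule f1_minimum(1)[OF that(1) x(2) that(2,3) s])
  define r where "r = x \<bullet> xs"
  have r: "0 < r" "r < 1" using x by (auto simp: r_def)
  have k: "0 < kap t" "t\<^sup>2 < 1" if "t \<in> {0<..<1}" for t using kap_bounds that by (auto simp: abs_square_less_1)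
  show "steep_at (\<lambda>t. sgn_profile \<sigma>s (kap t / t)) (x \<bullet> xs)" unfolding r_def[symmetric]
  proof (rule steep_at_compose[where h = "sgn_profile \<sigma>s" and tau = "\<lambda>t. kap t / t" and S = "{0<..<1}" and tau' = "\<lambda>t. - (1 / (kap t * t\<^sup>2))"])
    show "steep_at (\<lambda>t. - sgn_profile \<sigma>s t) (kap r / r)"
      using r k by (intro sgn_profile_steep s) auto
    show "((\<lambda>t. kap t / t) has_real_derivative - (1 / (kap t * t\<^sup>2))) (at t)" if t: "t \<in> {0<..<1}" for t
    proof -
      have "((\<lambda>t. kap t / t) has_real_derivative (- (2 * t) / 2 / kap t * t - kap t * 1) / (t * t)) (at t)"
        using k[OF t] t by (auto intro!: derivative_eq_intros simp: field_simps)
      moreover have "(- (2 * t) / 2 / kap t * t - kap t * 1) / (t * t) = - (1 / (kap t * t\<^sup>2))"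
      proof -
        have "kap t * kap t = 1 - t\<^sup>2" using k[OF t] by simp
        then show ?thesis using k[OF t] t by (simp add: divide_simps power2_eq_square)
      qed
      ultimately show ?thesis by simp
    qed
    show "isCont (\<lambda>t. - (1 / (kap t * t\<^sup>2))) r" using k[of r] r by (intro continuous_intros) auto
    show "- (1 / (kap r * r\<^sup>2)) < 0" using k[of r] r by simp
  qed (use r in auto)
qed

subsection \<open>The conditional median in phase retrieval\<close>

text \<open>For \<open>m \<ge> 0\<close>, the distribution function at \<open>m\<close> of the
  absolute value of a normal variable with mean \<open>r * s\<close> and standard deviation
  \<open>kap r\<close>. As a formula it is odd and strictly increasing in \<open>m\<close> on the
  whole line, so the median equation needs no sign condition.\<close>

definition folded :: "real \<Rightarrow> real \<Rightarrow> real \<Rightarrow> real" where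
  "folded r s m = Phi ((m - r * s) / kap r) + Phi ((m + r * s) / kap r)"

definition med :: "real \<Rightarrow> real \<Rightarrow> real" where
  "med r s = (THE m. folded r s m = 1 / 2)"

lemma Phi_minus_divide [simp]: "Phi (- a / b) = - Phi (a / b)"
  by (metis Phi_minus minus_divide_left)

lemma gauss1_open_interval: "a \<le> b \<Longrightarrow> measure gauss1 {a<..<b} = Phi b - Phi a"
  using AE_gauss1_neq[of a] AE_gauss1_neq[of b]
  by (subst gauss1_interval[symmetric])
     (auto intro!: gauss1.finite_measure_eq_AE elim!: eventually_elim2)

lemma gauss1_folded:
  assumes r: "0 < r" "r < 1" and m: "0 \<le> m"
  shows "measure gauss1 {w. \<bar>r * s + kap r * w\<bar> \<le> m} = folded r s m"
    and "measure gauss1 {w. \<bar>r * s + kap r * w\<bar> < m} = folded r s m"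
proof -
  have k: "0 < kap r" using kap_bounds r by blast
  have le: "(- m - r * s) / kap r \<le> (m - r * s) / kap r" using m k by (intro divide_right_mono) auto
  have "{w. \<bar>r * s + kap r * w\<bar> \<le> m} = {(- m - r * s) / kap r..(m - r * s) / kap r}"
    using k by (auto simp: field_simps abs_le_iff)
  moreover have "{w. \<bar>r * s + kap r * w\<bar> < m} = {(- m - r * s) / kap r<..<(m - r * s) / kap r}"
    using k by (auto simp: field_simps abs_less_iff)
  moreover have "Phi ((- m - r * s) / kap r) = - Phi ((m + r * s) / kap r)"
    by (metis Phi_minus_divide minus_add_distrib uminus_add_conv_diff add.commute diff_conv_add_uminus)
  ultimately show "measure gauss1 {w. \<bar>r * s + kap r * w\<bar> \<le> m} = folded r s m"
    "measure gauss1 {w. \<bar>r * s + kap r * w\<bar> < m} = folded r s m"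
    using gauss1_interval[OF le] gauss1_open_interval[OF le] by (simp_all add: folded_def)
qed

lemma folded_strict_mono:
  assumes "0 < r" "r < 1" "m < m'" shows "folded r s m < folded r s m'"
  unfolding folded_def
  by (rule add_strict_mono; rule Phi_strict_mono;
      rule divide_strict_right_mono[OF _ kap_bounds(1)[OF assms(1,2)]]; use assms in simp)

lemma folded_mono:
  assumes "0 < r" "r < 1" "m \<le> m'" shows "folded r s m \<le> folded r s m'"
  using folded_strict_mono[OF assms(1,2), of m m'] assms(3) by (cases "m = m'") (auto simp: less_imp_le)

lemma Phi_quarter: "\<exists>c>0. \<forall>x\<ge>c. 1 / 4 < Phi x"
proof -
  have "\<forall>\<^sub>F x in at_top. 1 / 4 < Phi x" by (rule order_tendstoD(1)[OF Phi_at_top]) simp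
  then obtain N where "\<forall>x\<ge>N. 1 / 4 < Phi x" by (auto simp: eventually_at_top_linorder)
  then show ?thesis by (intro exI[of _ "max 1 N"]) auto
qed

lemma folded_med:
  assumes r: "0 < r" "r < 1" shows "folded r s (med r s) = 1 / 2"
proof -
  have k: "0 < kap r" using kap_bounds r by blast
  obtain c where c: "c > 0" "\<And>x. x \<ge> c \<Longrightarrow> 1 / 4 < Phi x" using Phi_quarter by blast
  \<comment> \<open>Large enough that both arguments of \<open>Phi\<close> are at least
    \<open>c\<close>, so each term exceeds 1/4.\<close>
  define m where "m = kap r * c + \<bar>r * s\<bar>"
  have "c \<le> (m - r * s) / kap r" "c \<le> (m + r * s) / kap r"
    using k by (auto simp: m_def field_simps)
  from add_mono[OF this[THEN c(2), THEN less_imp_le]]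
  have "1 / 2 \<le> folded r s m" by (simp add: folded_def)
  moreover have "folded r s 0 = 0" by (simp add: folded_def)
  moreover have "continuous_on {0..m} (folded r s)"
    unfolding folded_def[abs_def] using k
    by (intro continuous_intros continuous_on_compose2[OF continuous_at_imp_continuous_on[of UNIV Phi]])
       (auto simp: isCont_Phi)
  moreover have "0 \<le> m" using k c by (simp add: m_def)
  ultimately obtain z where z: "folded r s z = 1 / 2"
    using IVT'[of "folded r s" 0 "1 / 2" m] by auto
  show ?thesis unfolding med_def
  proof (rule theI)
    show "folded r s z = 1 / 2" by (rule z)
    show "y = z" if "folded r s y = 1 / 2" for y
      using that z folded_strict_mono[OF r, of y z s] folded_strict_mono[OF r, of z y s]
      by (cases y z rule: linorder_cases) auto
  qed
qed

lemma less_med_iff: "0 < r \<Longrightarrow> r < 1 \<Longrightarrow> m < med r s \<longleftrightarrow> folded r s m < 1 / 2"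
  using folded_med[of r s] folded_strict_mono[of r m "med r s" s] folded_mono[of r "med r s" m s] by fastforce

lemma med_le_iff: "0 < r \<Longrightarrow> r < 1 \<Longrightarrow> med r s \<le> m \<longleftrightarrow> 1 / 2 \<le> folded r s m"
  using less_med_iff[of r m s] by auto

lemma med_minus [simp]: "med r (- s) = med r s"
  by (simp add: med_def folded_def add.commute)

lemma med_abs [simp]: "med r \<bar>s\<bar> = med r s" by (simp add: abs_if)

text \<open>At \<open>m = r * s\<close> the first term of \<open>folded\<close> vanishes and the
  second is below 1/2.\<close>

lemma med_gt:
  assumes r: "0 < r" "r < 1" and s: "0 \<le> s" shows "r * s < med r s"
  using Phi_less_half[of "(r * s + r * s) / kap r"] by (simp add: less_med_iff[OF r] folded_def)

lemma std_normal_less: "\<bar>s\<bar> < \<bar>t\<bar> \<Longrightarrow> \<phi> t < \<phi> s"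
proof -
  assume "\<bar>s\<bar> < \<bar>t\<bar>"
  then have "s\<^sup>2 < t\<^sup>2" by (metis abs_ge_zero power2_abs power_strict_mono zero_less_numeral)
  then show ?thesis by (simp add: std_normal_density_def divide_strict_right_mono)
qed

text \<open>Moving the mean away from 0 lowers the mass of a symmetric interval: the derivative in
  \<open>s\<close> compares the density at the farther endpoint with that at the nearer one. At mean
  0 it vanishes, hence the criterion that looks only at interior points.\<close>

lemma med_strict_mono:
  assumes r: "0 < r" "r < 1" and s: "0 \<le> s" "s < s'" shows "med r s < med r s'"
proof -
  have k: "0 < kap r" using kap_bounds r by blast
  define m where "m = med r s"
  have m: "m > 0" using med_gt[OF r s(1)] r s by (smt (verit) m_def mult_nonneg_nonneg)
  have "folded r s' m < folded r s m"
  proof (rule DERIV_neg_imp_decreasing_open[OF s(2)])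
    show "\<exists>y. ((\<lambda>s. folded r s m) has_real_derivative y) (at x) \<and> y < 0" if x: "s < x" "x < s'" for x
    proof (intro exI conjI)
      show "((\<lambda>s. folded r s m) has_real_derivative
         (r / kap r) * (\<phi> ((m + r * x) / kap r) - \<phi> ((m - r * x) / kap r))) (at x)"
      proof -
        define k where "k = kap r"
        have "k > 0" using kap_bounds r by (simp add: k_def)
        then have "((\<lambda>s. Phi ((m - r * s) / k) + Phi ((m + r * s) / k)) has_real_derivative
          (r / k) * (\<phi> ((m + r * x) / k) - \<phi> ((m - r * x) / k))) (at x)"
          by (auto intro!: derivative_eq_intros simp: field_simps)
        then show ?thesis by (simp only: folded_def k_def)
      qed
      have rx: "r * x > 0" using r x s by simp
      then have "\<bar>m - r * x\<bar> < \<bar>m + r * x\<bar>" using m by (auto simp: abs_if)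
      then have "\<bar>(m - r * x) / kap r\<bar> < \<bar>(m + r * x) / kap r\<bar>"
        using k by (simp add: divide_strict_right_mono)
      then have lt: "\<phi> ((m + r * x) / kap r) < \<phi> ((m - r * x) / kap r)"
        by (rule std_normal_less)
      show "(r / kap r) * (\<phi> ((m + r * x) / kap r) - \<phi> ((m - r * x) / kap r)) < 0"
        by (rule mult_pos_neg[OF divide_pos_pos[OF r(1) k]]) (use lt in simp)
    qed
    show "continuous_on {s..s'} (\<lambda>s. folded r s m)"
      unfolding folded_def using k
      by (intro continuous_intros continuous_on_compose2[OF continuous_at_imp_continuous_on[of UNIV Phi]])
         (auto simp: isCont_Phi)
  qed
  then show ?thesis using folded_med[OF r, of s] by (simp add: less_med_iff[OF r] m_def)
qed

text \<open>Raising \<open>m\<close> together with the mean by \<open>r * (s' - s)\<close> keeps the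
  first term of \<open>folded\<close> fixed and does not lower the second.\<close>

lemma med_lipschitz:
  assumes r: "0 < r" "r < 1" and s: "s \<le> s'"
  shows "med r s' \<le> med r s + r * (s' - s)"
proof -
  have k: "0 < kap r" using kap_bounds r by blast
  have "folded r s (med r s) \<le> folded r s' (med r s + r * (s' - s))"
    unfolding folded_def
  proof (rule add_mono)
    show "Phi ((med r s - r * s) / kap r) \<le> Phi ((med r s + r * (s' - s) - r * s') / kap r)"
      by (simp add: algebra_simps)
    show "Phi ((med r s + r * s) / kap r) \<le> Phi ((med r s + r * (s' - s) + r * s') / kap r)"
      using s r k by (intro Phi_mono divide_right_mono) (auto simp: algebra_simps)
  qed
  then show ?thesis using folded_med[OF r, of s] by (simp add: med_le_iff[OF r])
qed

text \<open>On the negative axis, where the link function is never evaluated, the median is continued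
  linearly to keep it strictly increasing.\<close>

definition med_ext :: "real \<Rightarrow> real \<Rightarrow> real" where
  "med_ext r s = (if s < 0 then med r 0 + r * s else med r s)"

lemma med_ext_abs [simp]: "med_ext r \<bar>s\<bar> = med r s" by (simp add: med_ext_def)

lemma med_ext_increment:
  assumes r: "0 < r" "r < 1" and s: "s < t"
  shows "med_ext r s < med_ext r t" and "med_ext r t - med_ext r s \<le> r * (t - s)"
proof -
  consider "t < 0" | "s < 0" "0 \<le> t" | "0 \<le> s" using s by linarith
  then have "med_ext r s < med_ext r t \<and> med_ext r t - med_ext r s \<le> r * (t - s)"
  proof cases
    case 1
    then show ?thesis using s r by (simp add: med_ext_def algebra_simps)
  next
    case 2
    have "r * s < 0" using r 2 by (simp add: mult_pos_neg)
    moreover have "med r 0 \<le> med r t" using 2 med_strict_mono[OF r, of 0 t] by (cases "t = 0") auto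
    moreover have "med r t \<le> med r 0 + r * t" using med_lipschitz[OF r, of 0 t] 2 by simp
    ultimately show ?thesis using 2 by (simp add: med_ext_def algebra_simps)
  next
    case 3
    then show ?thesis using s med_strict_mono[OF r, of s t] med_lipschitz[OF r, of s t] by (simp add: med_ext_def)
  qed
  then show "med_ext r s < med_ext r t" and "med_ext r t - med_ext r s \<le> r * (t - s)" by auto
qed

lemma med_ext_strict_mono: "0 < r \<Longrightarrow> r < 1 \<Longrightarrow> strict_mono (med_ext r)"
  by (rule strict_monoI) (rule med_ext_increment)

lemma med_ext_lipschitz:
  assumes r: "0 < r" "r < 1" shows "1-lipschitz_on UNIV (med_ext r)"
proof (rule lipschitz_onI)
  have *: "\<bar>med_ext r s - med_ext r t\<bar> \<le> \<bar>s - t\<bar>" if "s < t" for s t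
  proof -
    have "r * (t - s) \<le> t - s" using mult_right_mono[of r 1 "t - s"] r that by simp
    then have "med_ext r t - med_ext r s \<le> t - s"
      by (rule order_trans[OF med_ext_increment(2)[OF r that]])
    then show ?thesis using med_ext_increment(1)[OF r that] that by simp
  qed
  show "dist (med_ext r s) (med_ext r t) \<le> 1 * dist s t" for s t
    using *[of s t] *[of t s] by (cases s t rule: linorder_cases) (auto simp: dist_real_def abs_minus_commute)
qed simp

lemma med_ext_measurable [measurable]:
  assumes "0 < r" "r < 1" shows "med_ext r \<in> borel_measurable borel"
  using strict_mono_mono[OF med_ext_strict_mono[OF assms]] by (rule borel_measurable_mono)

lemma F_plus_med_ext:
  assumes f: "f \<in> F_plus" and r: "0 < r" "r < 1"
  shows "(\<lambda>t. f (med_ext r t)) \<in> F_plus"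
proof (rule F_plus_compose[OF f med_ext_strict_mono[OF r] med_ext_lipschitz[OF r]])
  have L: "L2 f" and mono: "mono f" using f by (auto simp: F_plus_L2 strict_mono_mono)
  have [measurable]: "f \<in> borel_measurable borel" using L by simp
  note [measurable] = med_ext_measurable[OF r]
  define m where "m = med r 0"
  \<comment> \<open>For \<open>t \<ge> 0\<close> the value lies between \<open>f m\<close> and
    \<open>f (m + r * t)\<close>, and for \<open>t < 0\<close> it is the latter;
    \<open>r < 1\<close> brings this affine argument within reach of
    \<open>L2_affine\<close>.\<close>
  have L1: "L2 (\<lambda>t. \<bar>f m\<bar> + \<bar>f (m + r * t)\<bar>)"
    by (intro L2_add L2_abs L2_const L2_affine L r)
  show "L2 (\<lambda>t. f (med_ext r t))"
  proof (rule L2_bound[OF L1])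
    fix t
    show "\<bar>f (med_ext r t)\<bar> \<le> \<bar>\<bar>f m\<bar> + \<bar>f (m + r * t)\<bar>\<bar>"
    proof (cases "t < 0")
      case False
      have "m \<le> med r t" using False med_strict_mono[OF r, of 0 t] by (cases "t = 0") (auto simp: m_def)
      moreover have "med r t \<le> m + r * t" using med_lipschitz[OF r, of 0 t] False by (simp add: m_def)
      ultimately have "f m \<le> f (med r t)" "f (med r t) \<le> f (m + r * t)" using mono by (auto dest: monoD)
      then show ?thesis using False by (simp add: med_ext_def)
    qed (simp add: med_ext_def m_def)
  qed measurable
qed

lemma L2_comp_abs:
  assumes L: "L2 f" shows "L2 (\<lambda>t. f \<bar>t\<bar>)"
proof -
  have [measurable]: "f \<in> borel_measurable borel" using L by simp
  have "L2 (\<lambda>y. f (- y))" using L gauss1_integrable_minus[of "\<lambda>y. (f y)\<^sup>2"] by (simp add: L2_def)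
  then have "L2 (\<lambda>t. \<bar>f t\<bar> + \<bar>f (- t)\<bar>)" by (intro L2_add L2_abs L)
  then show ?thesis by (rule L2_bound) (auto simp: abs_if)
qed

section \<open>Optimality of the conditional median link\<close>

definition riskPR2 :: "(real \<Rightarrow> real) \<Rightarrow> real \<Rightarrow> (real \<Rightarrow> real) \<Rightarrow> real" where
  "riskPR2 f r g = (LINT p|gauss2. \<bar>g \<bar>fst p\<bar> - f \<bar>r * fst p + kap r * snd p\<bar>\<bar>)"

lemma risk1PR_eq:
  fixes x xs :: "real ^ 'n"
  assumes x: "norm x = 1" "norm xs = 1" "0 < x \<bullet> xs" "x \<bullet> xs < 1" and L: "L2 f" "L2 g"
  shows "risk1PR f xs x g = riskPR2 f (x \<bullet> xs) g"
proof -
  have [measurable]: "f \<in> borel_measurable borel" "g \<in> borel_measurable borel" using L by auto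
  show ?thesis unfolding risk1PR_def riskPR2_def
    using gauss_pair_integral[OF x, of "\<lambda>(s, y). \<bar>g \<bar>s\<bar> - f \<bar>y\<bar>\<bar>"] by simp
qed

lemma riskPR2_integrable:
  assumes L: "L2 f" "L2 g" and r: "0 < r" "r < 1"
  shows "integrable gauss2 (\<lambda>p. g \<bar>fst p\<bar>)" "integrable gauss2 (\<lambda>p. f \<bar>r * fst p + kap r * snd p\<bar>)"
  using L2_gauss2_integrable[OF L2_comp_abs[OF L(2)], of 1 0]
    L2_gauss2_integrable[OF L2_comp_abs[OF L(1)] kap_sq(2), of r] r by auto

text \<open>The duality used for the absolute loss, with \<open>sg\<close> equal to 1 above the
  conditional median and to -1 elsewhere. It has mean zero given the first coordinate, so the
  pairing with \<open>sg\<close> is the same for every link; it bounds the risk from below and is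
  attained by the median link.\<close>

lemma riskPR2_minimum:
  assumes f: "f \<in> F_plus" and g: "g \<in> F_plus" and r: "0 < r" "r < 1"
  shows "riskPR2 f r (\<lambda>t. f (med_ext r t)) \<le> riskPR2 f r g"
proof -
  let ?Y = "\<lambda>p. \<bar>r * fst p + kap r * snd p\<bar>"
  have mono: "mono f" and L: "L2 f" using f by (auto simp: F_plus_L2 strict_mono_mono)
  have [measurable]: "f \<in> borel_measurable borel" using L by simp
  note [measurable] = med_ext_measurable[OF r]
  define sg :: "real \<times> real \<Rightarrow> real" where "sg p = 1 - 2 * indicator {p. ?Y p \<le> med_ext r \<bar>fst p\<bar>} p" for p :: "real \<times> real"
  have [measurable]: "sg \<in> borel_measurable gauss2" unfolding sg_def by measurable
  have sg1: "\<bar>sg p\<bar> = 1" "sg p * d \<le> \<bar>d\<bar>" for p d by (auto simp: sg_def indicator_def)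
  have int: "integrable gauss2 (\<lambda>p. sg p * h p)" if "integrable gauss2 h" for h
    by (rule integrable_bound_L[OF that]) (use that in \<open>auto simp: abs_mult sg1\<close>)
  have zero: "(LINT p|gauss2. sg p * g \<bar>fst p\<bar>) = 0" if L: "L2 g" for g
  proof -
    have [measurable]: "g \<in> borel_measurable borel" using L by simp
    have "integrable gauss2 (\<lambda>p. sg p * g \<bar>fst p\<bar>)"
      using int riskPR2_integrable(1)[OF L L r] by blast
    from gauss11.integral_fst'[OF this]
    have "(LINT p|gauss2. sg p * g \<bar>fst p\<bar>) = (LINT s|gauss1. LINT w|gauss1. sg (s, w) * g \<bar>s\<bar>)" by simp
    also have "\<dots> = (LINT s|gauss1. 0)"
    proof (rule integral_cong_pointwise)
      fix s
      have m0: "0 \<le> med r s" using med_gt[OF r, of "\<bar>s\<bar>"] r by (smt (verit) abs_ge_zero med_abs mult_nonneg_nonneg)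
      have "(LINT w|gauss1. sg (s, w)) = (LINT w|gauss1. 1 - 2 * indicator {w. \<bar>r * s + kap r * w\<bar> \<le> med r s} w)"
        by (rule integral_cong_pointwise) (simp add: sg_def indicator_def)
      also have "\<dots> = 1 - 2 * measure gauss1 {w. \<bar>r * s + kap r * w\<bar> \<le> med r s}"
      proof -
        have "integrable gauss1 (indicat_real {w. \<bar>r * s + kap r * w\<bar> \<le> med r s})"
          by (intro gauss1.integrable_const_bound[of _ 1]) (auto simp: indicator_def)
        then show ?thesis using gauss1.prob_space by simp
      qed
      also have "\<dots> = 0" using gauss1_folded(1)[OF r m0] folded_med[OF r, of s] by simp
      finally show "(LINT w|gauss1. sg (s, w) * g \<bar>s\<bar>) = 0" by simp
    qed
    finally show ?thesis by simp
  qed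
  have dual: "(LINT p|gauss2. sg p * (f (?Y p) - g \<bar>fst p\<bar>)) = (LINT p|gauss2. sg p * f (?Y p))"
    and ig: "integrable gauss2 (\<lambda>p. sg p * (f (?Y p) - g \<bar>fst p\<bar>))" if Lg: "L2 g" for g
    using int[OF riskPR2_integrable(1)[OF L Lg r]] int[OF riskPR2_integrable(2)[OF L Lg r]] zero[OF Lg]
    by (simp_all add: right_diff_distrib)
  let ?m = "\<lambda>t. f (med_ext r t)"
  have Lm: "L2 ?m" and Lg: "L2 g" using F_plus_med_ext[OF f r] g by (auto simp: F_plus_L2)
  have "\<bar>?m \<bar>fst p\<bar> - f (?Y p)\<bar> = sg p * (f (?Y p) - ?m \<bar>fst p\<bar>)" for p
    using monoD[OF mono, of "?Y p" "med_ext r \<bar>fst p\<bar>"] monoD[OF mono, of "med_ext r \<bar>fst p\<bar>" "?Y p"]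
    by (cases "?Y p \<le> med_ext r \<bar>fst p\<bar>") (auto simp: sg_def)
  then have "riskPR2 f r ?m = (LINT p|gauss2. sg p * (f (?Y p) - ?m \<bar>fst p\<bar>))"
    unfolding riskPR2_def by simp
  also have "\<dots> = (LINT p|gauss2. sg p * (f (?Y p) - g \<bar>fst p\<bar>))" by (rule trans[OF dual[OF Lm] dual[OF Lg, symmetric]])
  also have "\<dots> \<le> riskPR2 f r g"
    unfolding riskPR2_def
  proof (rule integral_mono[OF ig[OF Lg]])
    show "sg p * (f (?Y p) - g \<bar>fst p\<bar>) \<le> \<bar>g \<bar>fst p\<bar> - f (?Y p)\<bar>" for p
      using sg1(2)[of p "f (?Y p) - g \<bar>fst p\<bar>"] by (simp add: abs_minus_commute)
  qed (use riskPR2_integrable[OF L Lg r] in auto)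
  finally show ?thesis .
qed

definition valPR :: "(real \<Rightarrow> real) \<Rightarrow> real \<Rightarrow> real" where
  "valPR f r = riskPR2 f r (\<lambda>t. f (med_ext r t))"

lemma f1PR_minimum:
  fixes x xs :: "real ^ 'n"
  assumes x: "norm x = 1" "norm xs = 1" "0 < x \<bullet> xs" "x \<bullet> xs < 1" and s: "f \<in> F_plus"
  shows "f1PR f xs x = valPR f (x \<bullet> xs)"
    and "\<exists>r. is_arg_min (risk1PR f xs x) (\<lambda>r. r \<in> F_plus) r"
proof -
  let ?m = "\<lambda>t. f (med_ext (x \<bullet> xs) t)"
  have m: "?m \<in> F_plus" by (rule F_plus_med_ext[OF s x(3,4)])
  have eq: "risk1PR f xs x g = riskPR2 f (x \<bullet> xs) g" if "g \<in> F_plus" for g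
    using that s by (intro risk1PR_eq x) (auto simp: F_plus_L2)
  have le: "risk1PR f xs x ?m \<le> risk1PR f xs x g" if "g \<in> F_plus" for g
    unfolding eq[OF m] eq[OF that] by (rule riskPR2_minimum[OF s that x(3,4)])
  show "f1PR f xs x = valPR f (x \<bullet> xs)"
    unfolding f1PR_def valPR_def eq[OF m, symmetric] by (rule INF_arg_min(1)[where f = "risk1PR f xs x", OF m le])
  show "\<exists>r. is_arg_min (risk1PR f xs x) (\<lambda>r. r \<in> F_plus) r"
    by (rule exI, rule INF_arg_min(2)[where f = "risk1PR f xs x", OF m le])
qed

subsection \<open>Layer-cake representation of the phase retrieval risk\<close>

lemma lipschitz_near_isCont:
  fixes f :: "real \<Rightarrow> real"
  assumes "lipschitz_near UNIV f t" shows "isCont f t"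
proof -
  obtain e L where e: "e > 0" "L-lipschitz_on (cball t e) f" using assms by (auto simp: lipschitz_near_def)
  then have "continuous_on (cball t e) f" by (intro lipschitz_on_continuous_on)
  then show ?thesis using e(1) by (intro continuous_on_interior[of "cball t e"]) auto
qed

lemma F_plus_isCont: "f \<in> F_plus \<Longrightarrow> isCont f t"
  by (auto simp: F_plus_L2 intro: lipschitz_near_isCont)

lemma F_plus_interval_measure:
  assumes f: "f \<in> F_plus"
  shows "sigma_finite_measure (interval_measure f)"
    and "a \<le> b \<Longrightarrow> emeasure (interval_measure f) {a<..b} = ennreal (f b - f a)"
proof -
  have mono: "\<And>x y. x \<le> y \<Longrightarrow> f x \<le> f y"
    using f by (auto simp: F_plus_L2 dest: strict_mono_mono monoD)
  have cont: "\<And>a. continuous (at_right a) f"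
    using F_plus_isCont[OF f] by (rule continuous_at_imp_continuous_at_within)
  show "sigma_finite_measure (interval_measure f)" by (rule sigma_finite_interval_measure[OF mono cont])
  show "a \<le> b \<Longrightarrow> emeasure (interval_measure f) {a<..b} = ennreal (f b - f a)"
    by (rule emeasure_interval_measure_Ioc[OF _ mono cont])
qed

text \<open>The set is the half-open interval between the two points. The Stieltjes measure takes
  the place of the derivative of \<open>f\<close>.\<close>

lemma layer_cake_dist:
  assumes f: "f \<in> F_plus"
  shows "measure (interval_measure f) {t. (t \<le> u) \<noteq> (t \<le> v)} = \<bar>f u - f v\<bar>"
    and "emeasure (interval_measure f) {t. (t \<le> u) \<noteq> (t \<le> v)} < \<infinity>"
proof -
  have *: "emeasure (interval_measure f) {t. (t \<le> u) \<noteq> (t \<le> v)} = ennreal \<bar>f u - f v\<bar>"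
  proof (cases "u \<le> v")
    case True
    then have "{t. (t \<le> u) \<noteq> (t \<le> v)} = {u<..v}" by auto
    moreover have "f u \<le> f v" using f True by (auto simp: F_plus_L2 dest: strict_mono_mono monoD)
    ultimately show ?thesis using F_plus_interval_measure(2)[OF f True] by simp
  next
    case False
    then have "{t. (t \<le> u) \<noteq> (t \<le> v)} = {v<..u}" by auto
    moreover have "v \<le> u" using False by simp
    then have "f v \<le> f u" using f by (auto simp: F_plus_L2 dest: strict_mono_mono monoD)
    ultimately show ?thesis using F_plus_interval_measure(2)[OF f, of v u] False by simp
  qed
  show "measure (interval_measure f) {t. (t \<le> u) \<noteq> (t \<le> v)} = \<bar>f u - f v\<bar>"
    unfolding measure_def * by simp
  show "emeasure (interval_measure f) {t. (t \<le> u) \<noteq> (t \<le> v)} < \<infinity>" unfolding * by simp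
qed

lemma med_measurable [measurable]:
  assumes "0 < r" "r < 1" shows "med r \<in> borel_measurable borel"
proof -
  note [measurable] = med_ext_measurable[OF assms]
  have "(\<lambda>s. med_ext r \<bar>s\<bar>) \<in> borel_measurable borel" by measurable
  then show ?thesis by simp
qed

text \<open>The probability that the level \<open>t\<close> separates the median from the observed
  absolute value. The parameter \<open>r\<close> selects the median and \<open>b\<close> the law of
  the pair; they are kept apart so that the link can be frozen while the correlation varies.\<close>

definition disagree :: "real \<Rightarrow> real \<Rightarrow> real \<Rightarrow> real" where
  "disagree r b t = measure gauss2 {p. (t \<le> med r (fst p)) \<noteq> (t \<le> \<bar>b * fst p + kap b * snd p\<bar>)}"

lemma riskPR2_layer_cake:
  assumes f: "f \<in> F_plus" and r: "0 < r" "r < 1" and b: "0 < b" "b < 1"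
  shows "integrable (interval_measure f) (disagree r b)"
    and "riskPR2 f b (\<lambda>t. f (med_ext r t)) = (LINT t|interval_measure f. disagree r b t)"
proof -
  let ?M = "interval_measure f"
  interpret M: sigma_finite_measure ?M by (rule F_plus_interval_measure(1)[OF f])
  interpret P: pair_sigma_finite gauss2 ?M
    by (intro pair_sigma_finite.intro gauss11.sigma_finite_measure_axioms M.sigma_finite_measure_axioms)
  note [measurable] = med_measurable[OF r]
  have L: "L2 f" using f by (simp add: F_plus_L2)
  have Lm: "L2 (\<lambda>t. f (med_ext r t))" using F_plus_med_ext[OF f r] by (simp add: F_plus_L2)
  define S where "S p = {t. (t \<le> med r (fst p)) \<noteq> (t \<le> \<bar>b * fst p + kap b * snd p\<bar>)}" for p :: "real \<times> real"
  define g where "g p t = indicat_real (S p) t" for p t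
  have gm[measurable]: "case_prod g \<in> borel_measurable (gauss2 \<Otimes>\<^sub>M ?M)"
    unfolding g_def S_def indicator_def split_beta by measurable
  have Sm[measurable]: "S p \<in> sets ?M" for p unfolding S_def by measurable
  have gi: "integrable ?M (g p)" "(LINT t|?M. g p t) = \<bar>f (med r (fst p)) - f \<bar>b * fst p + kap b * snd p\<bar>\<bar>" for p
    using layer_cake_dist[OF f, of "med r (fst p)" "\<bar>b * fst p + kap b * snd p\<bar>"] Sm[of p]
    unfolding g_def S_def[symmetric] by (auto simp: integrable_indicator_iff)
  have ab: "\<bar>g p t\<bar> = g p t" for p t by (simp add: g_def)
  have int: "integrable (gauss2 \<Otimes>\<^sub>M ?M) (case_prod g)"
  proof (rule P.Fubini_integrable)
    have "integrable gauss2 (\<lambda>p. \<bar>f (med r (fst p)) - f \<bar>b * fst p + kap b * snd p\<bar>\<bar>)"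
      using riskPR2_integrable[OF L Lm b] by simp
    then show "integrable gauss2 (\<lambda>p. LINT t|?M. norm (case (p, t) of (x, xa) \<Rightarrow> g x xa))"
      by (simp add: ab gi)
  qed (simp_all add: gi)
  have dis: "(LINT p|gauss2. g p t) = disagree r b t" for t
  proof -
    have "(LINT p|gauss2. g p t) = (LINT p|gauss2. indicat_real {p. (t \<le> med r (fst p)) \<noteq> (t \<le> \<bar>b * fst p + kap b * snd p\<bar>)} p)"
      by (rule integral_cong_pointwise) (simp add: g_def S_def indicator_def)
    also have "\<dots> = disagree r b t" by (simp add: disagree_def space_pair_measure)
    finally show ?thesis .
  qed
  show "integrable ?M (disagree r b)" using P.integrable_snd[OF int] by (simp add: dis)
  have "riskPR2 f b (\<lambda>t. f (med_ext r t)) = (LINT p|gauss2. LINT t|?M. g p t)"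
    unfolding riskPR2_def by (simp add: gi)
  also have "\<dots> = (LINT t|?M. disagree r b t)"
    using P.integral_fst'[OF int] P.integral_snd[OF int] by (simp add: dis)
  finally show "riskPR2 f b (\<lambda>t. f (med_ext r t)) = (LINT t|?M. disagree r b t)" .
qed

lemma med_mono: "0 < r \<Longrightarrow> r < 1 \<Longrightarrow> \<bar>s\<bar> \<le> \<bar>s'\<bar> \<Longrightarrow> med r s \<le> med r s'"
  using med_strict_mono[of r "\<bar>s\<bar>" "\<bar>s'\<bar>"] med_abs[of r s] med_abs[of r s']
  by (cases "\<bar>s\<bar> = \<bar>s'\<bar>") (metis order_refl, simp add: less_imp_le)

text \<open>Turns the event on the median into one on the first coordinate, so that levels give
  rectangles. The bounds on \<open>N\<close> later confine it to a compact interval away from 0,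
  where a uniform slope bound is available.\<close>

lemma med_threshold:
  assumes r: "0 < r" "r < 1" and t: "0 < t"
  obtains N where "0 \<le> N" "N \<le> t / r" "\<forall>s. t \<le> med r s \<longleftrightarrow> N \<le> \<bar>s\<bar>" "med r 1 \<le> t \<longrightarrow> 1 \<le> N"
proof (cases "t \<le> med r 0")
  case True
  have "med r 0 < med r 1" by (rule med_strict_mono[OF r]) auto
  moreover have "t \<le> med r s" for s using True med_mono[OF r, of 0 s] by simp
  ultimately show ?thesis using that[of 0] True t r by auto
next
  case False
  have tr: "0 \<le> t / r" using t r by simp
  have "continuous_on UNIV (med_ext r)" by (rule lipschitz_on_continuous_on[OF med_ext_lipschitz[OF r]])
  then have c: "continuous_on {0..t / r} (med_ext r)" by (rule continuous_on_subset) simp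
  have "t \<le> med_ext r (t / r)" using med_gt[OF r tr] r tr by (simp add: med_ext_def)
  moreover have "med_ext r 0 \<le> t" using False by (simp add: med_ext_def)
  ultimately obtain N where N: "0 \<le> N" "N \<le> t / r" "med_ext r N = t"
    using IVT'[of "med_ext r" 0 t "t / r"] c tr by blast
  have mN: "med r N = t" using N by (simp add: med_ext_def)
  have iff: "t \<le> med r s \<longleftrightarrow> N \<le> \<bar>s\<bar>" for s
  proof
    assume "t \<le> med r s"
    then show "N \<le> \<bar>s\<bar>" using med_strict_mono[OF r, of "\<bar>s\<bar>" N] mN by fastforce
  next
    assume "N \<le> \<bar>s\<bar>"
    then show "t \<le> med r s" using med_mono[OF r, of N s] mN N by simp
  qed
  have "1 \<le> N" if "med r 1 \<le> t" using that med_strict_mono[OF r N(1), of 1] mN by fastforce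
  then show ?thesis using that[of N] N iff by blast
qed

subsection \<open>Dependence of the rectangle probabilities on the correlation\<close>

text \<open>The mass of a rectangle at correlation \<open>b\<close>, as a gauge integral to which
  the Leibniz rule and the fundamental theorem of calculus apply.\<close>

definition rect :: "real \<Rightarrow> real \<Rightarrow> real \<Rightarrow> real" where
  "rect b N t = integral {- N..N} (\<lambda>s. \<phi> s * folded b s t)"

lemma continuous_on_Phi: "continuous_on S Phi"
  by (intro continuous_at_imp_continuous_on) (simp add: isCont_Phi)

lemma continuous_on_std_normal: "continuous_on S \<phi>"
  by (intro continuous_at_imp_continuous_on) (simp add: isCont_std_normal)

lemma folded_continuous: "0 < b \<Longrightarrow> b < 1 \<Longrightarrow> continuous_on S (\<lambda>s. folded b s t)"
  using kap_bounds(1)[of b] unfolding folded_def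
  by (intro continuous_intros continuous_on_compose2[OF continuous_on_Phi]) auto

lemma measure_rect:
  assumes b: "0 < b" "b < 1" and N: "0 \<le> N" and t: "0 \<le> t"
  shows "measure gauss2 {p. \<bar>fst p\<bar> < N \<and> \<bar>b * fst p + kap b * snd p\<bar> < t} = rect b N t"
proof -
  let ?A = "{p. \<bar>fst p\<bar> < N \<and> \<bar>b * fst p + kap b * snd p\<bar> < t}"
  have [measurable]: "(\<lambda>s. folded b s t) \<in> borel_measurable borel"
    by (rule borel_measurable_continuous_onI[OF folded_continuous[OF b]])
  have i: "integrable gauss2 (indicat_real ?A)"
    by (intro gauss11.integrable_const_bound[of _ 1]) (auto simp: indicator_def)
  have "measure gauss2 ?A = (LINT p|gauss2. indicat_real ?A p)" by (simp add: space_pair_measure)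
  also have "\<dots> = (LINT s|gauss1. LINT w|gauss1. indicat_real ?A (s, w))"
    using gauss11.integral_fst'[OF i] by simp
  also have "\<dots> = (LINT s|gauss1. indicat_real {- N<..<N} s * folded b s t)"
  proof (rule integral_cong_pointwise)
    fix s
    have "(LINT w|gauss1. indicat_real ?A (s, w)) =
        (LINT w|gauss1. indicat_real {- N<..<N} s * indicat_real {w. \<bar>b * s + kap b * w\<bar> < t} w)"
      by (rule integral_cong_pointwise) (auto simp: indicator_def)
    also have "\<dots> = indicat_real {- N<..<N} s * folded b s t"
      using gauss1_folded(2)[OF b t, of s] by simp
    finally show "(LINT w|gauss1. indicat_real ?A (s, w)) = indicat_real {- N<..<N} s * folded b s t" .
  qed
  also have "\<dots> = (LINT s|gauss1. indicat_real {- N..N} s * folded b s t)"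
    by (rule integral_cong_AE)
       (use AE_gauss1_neq[of N] AE_gauss1_neq[of "- N"] in \<open>auto simp: indicator_def elim!: eventually_elim2\<close>)
  also have "\<dots> = (LINT s:{- N..N}|lborel. \<phi> s * folded b s t)"
    unfolding gauss1_def set_lebesgue_integral_def
    by (subst integral_density) (auto intro!: Bochner_Integration.integral_cong)
  also have "\<dots> = rect b N t" unfolding rect_def
    by (intro set_borel_integral_eq_integral(2) borel_integrable_atLeastAtMost'
        continuous_intros folded_continuous b continuous_on_std_normal)
  finally show ?thesis .
qed

text \<open>The event is the symmetric difference of two strips, of mass
  \<open>P A + P B - 2 * P (A \<inter> B)\<close>. Only the intersection, a rectangle, depends on
  the correlation; the marginals cancel.\<close>

lemma disagree_diff:
  assumes r: "0 < r" "r < 1" and b: "0 < b" "b < 1" and b': "0 < b'" "b' < 1" and t: "0 < t"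
    and N: "0 \<le> N" "\<forall>s. t \<le> med r s \<longleftrightarrow> N \<le> \<bar>s\<bar>"
  shows "disagree r b t - disagree r b' t = - 2 * (rect b N t - rect b' N t)"
proof -
  have N2: "t \<le> med r s \<longleftrightarrow> N \<le> \<bar>s\<bar>" for s using N(2) by blast
  have *: "disagree r c t = measure gauss1 {s. \<bar>s\<bar> < N} + measure gauss1 {s. \<bar>s\<bar> < t} - 2 * rect c N t"
    if c: "0 < c" "c < 1" for c
  proof -
    let ?A = "{p. \<bar>fst p\<bar> < N} :: (real \<times> real) set"
    let ?B = "{p. \<bar>c * fst p + kap c * snd p\<bar> < t}"
    have "Measurable.pred gauss2 (\<lambda>p. \<bar>fst p\<bar> < N)" "Measurable.pred gauss2 (\<lambda>p. \<bar>c * fst p + kap c * snd p\<bar> < t)"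
      by measurable
    then have A: "?A \<in> sets gauss2" and B: "?B \<in> sets gauss2" by (simp_all add: pred_def space_pair_measure)
    have c1: "c\<^sup>2 + (kap c)\<^sup>2 = 1" using kap_sq(2)[of c] c by simp
    have mA: "measure gauss2 ?A = measure gauss1 {s. \<bar>s\<bar> < N}"
    proof -
      have "measure gauss2 ?A = (LINT p|gauss2. indicat_real ?A p)" by (simp add: space_pair_measure)
      also have "\<dots> = (LINT p|gauss2. indicat_real {s. \<bar>s\<bar> < N} (fst p))"
        by (rule integral_cong_pointwise) (simp add: indicator_def)
      also have "\<dots> = (LINT s|gauss1. indicat_real {s. \<bar>s\<bar> < N} s)" by (rule gauss2_fst_integral) measurable
      finally show ?thesis by simp
    qed
    have mB: "measure gauss2 ?B = measure gauss1 {s. \<bar>s\<bar> < t}"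
    proof -
      have "measure gauss2 ?B = (LINT p|gauss2. indicat_real ?B p)" by (simp add: space_pair_measure)
      also have "\<dots> = (LINT p|gauss2. indicat_real {s. \<bar>s\<bar> < t} (c * fst p + kap c * snd p))"
        by (rule integral_cong_pointwise) (simp add: indicator_def)
      also have "\<dots> = (LINT s|gauss1. indicat_real {s. \<bar>s\<bar> < t} s)" by (rule gauss2_lin_integral[OF c1]) measurable
      finally show ?thesis by simp
    qed
    have AB: "measure gauss2 (?A \<inter> ?B) = rect c N t"
      using measure_rect[OF c N(1), of t] t by (simp add: Collect_conj_eq)
    have "{p. (t \<le> med r (fst p)) \<noteq> (t \<le> \<bar>c * fst p + kap c * snd p\<bar>)} = (?A - ?B) \<union> (?B - ?A)"
      unfolding N2 by auto
    then have "disagree r c t = measure gauss2 ((?A - ?B) \<union> (?B - ?A))" by (simp add: disagree_def)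
    also have "\<dots> = measure gauss2 (?A - ?B) + measure gauss2 (?B - ?A)"
      using A B by (intro gauss11.finite_measure_Union) auto
    also have "\<dots> = measure gauss2 ?A + measure gauss2 ?B - 2 * measure gauss2 (?A \<inter> ?B)"
      using gauss11.finite_measure_Diff'[OF A B] gauss11.finite_measure_Diff'[OF B A] by (simp add: Int_commute)
    finally show ?thesis unfolding mA mB AB .
  qed
  show ?thesis using *[OF b] *[OF b'] by simp
qed

text \<open>Twice the difference of the bivariate normal densities of correlation \<open>b\<close>
  at \<open>(s, t)\<close> and \<open>(s, - t)\<close>. This is Plackett's identity: the derivative
  of the density in the correlation is its mixed second derivative, so a rectangle leaves only its
  corner values.\<close>

definition rect_slope :: "real \<Rightarrow> real \<Rightarrow> real \<Rightarrow> real" where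
  "rect_slope b s t = 2 * (\<phi> t / kap b *
     (\<phi> ((s - b * t) / kap b) - \<phi> ((s + b * t) / kap b)))"

lemma std_normal_deriv: "(\<phi> has_real_derivative - t * \<phi> t) (at t)"
proof -
  have "((\<lambda>t. c * exp (- t\<^sup>2 / 2)) has_real_derivative - t * (c * exp (- t\<^sup>2 / 2))) (at t)" for c :: real
    by (auto intro!: derivative_eq_intros)
  then show ?thesis unfolding std_normal_density_def[abs_def] .
qed

lemma kap_deriv:
  assumes "0 < b" "b < 1" shows "(kap has_real_derivative - b / kap b) (at b)"
proof -
  have "1 - b\<^sup>2 > 0" using assms by (simp add: abs_square_less_1)
  then show ?thesis by (auto intro!: derivative_eq_intros simp: field_simps)
qed

text \<open>Both sides are the density of the pair at \<open>(s, t)\<close>.\<close>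

lemma std_normal_exchange:
  assumes b: "0 < b" "b < 1"
  shows "\<phi> s * \<phi> ((t - b * s) / kap b) =
    \<phi> t * \<phi> ((s - b * t) / kap b)"
proof -
  define k where "k = kap b"
  have k: "k > 0" "k\<^sup>2 = 1 - b\<^sup>2" using kap_bounds[OF b] kap_sq(1)[of b] b by (auto simp: k_def)
  have "s\<^sup>2 * k\<^sup>2 + (t - b * s)\<^sup>2 = t\<^sup>2 * k\<^sup>2 + (s - b * t)\<^sup>2" unfolding k by algebra
  then have "(s\<^sup>2 * k\<^sup>2 + (t - b * s)\<^sup>2) / k\<^sup>2 = (t\<^sup>2 * k\<^sup>2 + (s - b * t)\<^sup>2) / k\<^sup>2" by simp
  then have "s\<^sup>2 + ((t - b * s) / k)\<^sup>2 = t\<^sup>2 + ((s - b * t) / k)\<^sup>2"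
    using k(1) by (simp add: add_divide_distrib power_divide)
  then have "- s\<^sup>2 / 2 + - ((t - b * s) / k)\<^sup>2 / 2 = - t\<^sup>2 / 2 + - ((s - b * t) / k)\<^sup>2 / 2"
    by (simp add: field_simps)
  then have "exp (- s\<^sup>2 / 2) * exp (- ((t - b * s) / k)\<^sup>2 / 2) = exp (- t\<^sup>2 / 2) * exp (- ((s - b * t) / k)\<^sup>2 / 2)"
    unfolding exp_add[symmetric] by simp
  then show ?thesis by (simp add: std_normal_density_def k_def)
qed

text \<open>Differentiation under the integral gives \<open>fx\<close>. Exchanging the roles of
  \<open>s\<close> and \<open>t\<close> in the joint density exhibits \<open>fx b\<close> as the
  derivative in \<open>s\<close> of \<open>G\<close>, and \<open>G\<close> is odd, whence the factor
  2 in the slope.\<close>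

lemma rect_deriv:
  assumes b: "0 < b" "b < 1" and N: "0 \<le> N"
  shows "((\<lambda>b. rect b N t) has_real_derivative rect_slope b N t) (at b)"
proof -
  define fx where "fx b s = \<phi> s *
    (\<phi> ((t - b * s) / kap b) * ((t * b - s) / kap b ^ 3) +
     \<phi> ((t + b * s) / kap b) * ((t * b + s) / kap b ^ 3))" for b s
  have k3: "(- s * k - (t - b * s) * (- b / k)) / (k * k) = (t * b - s) / k ^ 3"
    if "k > 0" "k\<^sup>2 = 1 - b\<^sup>2" for k b s t :: real
  proof -
    have "(- s * k - (t - b * s) * (- b / k)) * k = - s * k\<^sup>2 + (t - b * s) * b"
      using that(1) by (simp add: field_simps power2_eq_square)
    also have "\<dots> = t * b - s" unfolding that(2) by (simp add: algebra_simps power2_eq_square)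
    finally have "t * b - s = (- s * k - (t - b * s) * (- b / k)) * k" ..
    then show ?thesis using that(1) by (simp add: power3_eq_cube)
  qed
  have arg: "((\<lambda>b. (t - b * s) / kap b) has_real_derivative (t * b - s) / kap b ^ 3) (at b)"
    if b: "0 < b" "b < 1" for b s
  proof -
    have k: "kap b > 0" "(kap b)\<^sup>2 = 1 - b\<^sup>2" using kap_bounds[OF b] kap_sq(1)[of b] b by auto
    have "((\<lambda>b. t - b * s) has_real_derivative - s) (at b)" by (auto intro!: derivative_eq_intros)
    from DERIV_divide[OF this kap_deriv[OF b]] k(1)
    have "((\<lambda>b. (t - b * s) / kap b) has_real_derivative (- s * kap b - (t - b * s) * (- b / kap b)) / (kap b * kap b)) (at b)"
      by simp
    then show ?thesis unfolding k3[OF k] .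
  qed
  have df: "((\<lambda>b. \<phi> s * folded b s t) has_real_derivative fx b s) (at b)"
    if b: "0 < b" "b < 1" for b s
    unfolding folded_def fx_def using DERIV_chain2[OF Phi_deriv arg[OF b, of s]] DERIV_chain2[OF Phi_deriv arg[OF b, of "- s"]]
    by (auto intro!: DERIV_cmult DERIV_add)
  have "((\<lambda>b. integral (cbox (- N) N) (\<lambda>s. \<phi> s * folded b s t)) has_field_derivative
      integral (cbox (- N) N) (fx b)) (at b within {0<..<1})"
  proof (rule leibniz_rule_field_derivative)
    show "((\<lambda>b. \<phi> s * folded b s t) has_real_derivative fx b s) (at b within {0<..<1})"
      if "b \<in> {0<..<1}" for b s using df[of b s] that by (auto intro: has_field_derivative_at_within)
    show "(\<lambda>s. \<phi> s * folded b s t) integrable_on cbox (- N) N" if "b \<in> {0<..<1}" for b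
      using that by (intro integrable_continuous continuous_intros folded_continuous continuous_on_std_normal) auto
    show "continuous_on ({0<..<1} \<times> cbox (- N) N) (\<lambda>(b, s). fx b s)"
      unfolding fx_def split_beta
      using kap_bounds by (intro continuous_intros continuous_on_compose2[OF continuous_on_std_normal[of UNIV]])
        (force simp: less_imp_neq[symmetric])+
  qed (use b in auto)
  moreover have "integral (cbox (- N) N) (fx b) = rect_slope b N t"
  proof -
    define k where "k = kap b"
    have k: "k > 0" "k\<^sup>2 = 1 - b\<^sup>2" using kap_bounds[OF b] kap_sq(1)[of b] b by (auto simp: k_def)
    define G where "G s = \<phi> t / k * (\<phi> ((s - b * t) / k) - \<phi> ((s + b * t) / k))" for s
    have fxe: "fx b s = \<phi> t / k *
        (- ((s - b * t) / k) * \<phi> ((s - b * t) / k) * (1 / k)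
        - (- ((s + b * t) / k) * \<phi> ((s + b * t) / k) * (1 / k)))" for s
    proof -
      have e1: "\<phi> s * \<phi> ((t - b * s) / k) = \<phi> t * \<phi> ((s - b * t) / k)"
        using std_normal_exchange[OF b] by (simp add: k_def)
      have "\<phi> s * \<phi> ((t + b * s) / k) = \<phi> t * \<phi> ((- s - b * t) / k)"
        using std_normal_exchange[OF b, of "- s" t] by (simp add: k_def)
      also have "(- s - b * t) / k = - ((s + b * t) / k)" by (simp add: minus_divide_left)
      finally have e2: "\<phi> s * \<phi> ((t + b * s) / k) = \<phi> t * \<phi> ((s + b * t) / k)"
        by simp
      have alg: "(T * X) * ((t * b - s) / k ^ 3) + (T * Z) * ((t * b + s) / k ^ 3) =
          T / k * (- ((s - b * t) / k) * X * (1 / k) - (- ((s + b * t) / k) * Z * (1 / k)))" for T X Z :: real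
        using k(1) by (simp add: field_simps power3_eq_cube)
      have "fx b s = (\<phi> s * \<phi> ((t - b * s) / k)) * ((t * b - s) / k ^ 3) +
          (\<phi> s * \<phi> ((t + b * s) / k)) * ((t * b + s) / k ^ 3)"
        unfolding fx_def k_def by (simp only: distrib_left mult.assoc)
      then show ?thesis unfolding e1 e2 alg .
    qed
    have "(fx b has_integral (G N - G (- N))) {- N..N}"
    proof (rule fundamental_theorem_of_calculus)
      have "(G has_real_derivative fx b s) (at s)" for s
        unfolding G_def[abs_def] fxe using k(1)
        by (intro DERIV_cmult DERIV_diff DERIV_chain2[OF std_normal_deriv]) (auto intro!: derivative_eq_intros)
      then show "(G has_vector_derivative fx b s) (at s within {- N..N})" for s
        by (simp add: has_real_derivative_iff_has_vector_derivative has_vector_derivative_at_within)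
    qed (use N in simp)
    then have "integral {- N..N} (fx b) = G N - G (- N)" by (rule integral_unique)
    moreover have "G (- N) = - G N"
    proof -
      have "(- N - b * t) / k = - ((N + b * t) / k)" "(- N + b * t) / k = - ((N - b * t) / k)"
        by (simp_all add: minus_divide_left)
      then show ?thesis unfolding G_def by (simp only: std_normal_minus) (simp add: algebra_simps)
    qed
    ultimately show ?thesis by (simp add: rect_slope_def G_def k_def)
  qed
  moreover have "at b within {0<..<1} = at b" using b by (intro at_within_open) auto
  ultimately show ?thesis by (simp add: rect_def)
qed

subsection \<open>Steepness of the optimal phase retrieval risk\<close>

lemma rect_slope_nonneg:
  assumes b: "0 < b" "b < 1" and "0 \<le> s" "0 \<le> t"
  shows "0 \<le> rect_slope b s t"
proof -
  have k: "kap b > 0" using kap_bounds[OF b] by simp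
  have "0 \<le> b * t" using assms by simp
  then have "\<bar>s - b * t\<bar> \<le> \<bar>s + b * t\<bar>" using assms(3) by (auto simp: abs_if)
  then have "\<bar>(s - b * t) / kap b\<bar> \<le> \<bar>(s + b * t) / kap b\<bar>" using k by (simp add: divide_right_mono)
  then have "\<phi> ((s + b * t) / kap b) \<le> \<phi> ((s - b * t) / kap b)" by (rule std_normal_le)
  then show ?thesis unfolding rect_slope_def by (intro mult_nonneg_nonneg divide_nonneg_pos k) auto
qed

lemma rect_slope_pos:
  assumes b: "0 < b" "b < 1" and "0 < s" "0 < t"
  shows "0 < rect_slope b s t"
proof -
  have k: "kap b > 0" using kap_bounds[OF b] by simp
  have "0 < b * t" using assms by simp
  then have "\<bar>s - b * t\<bar> < \<bar>s + b * t\<bar>" using assms(3) by (auto simp: abs_if)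
  then have "\<bar>(s - b * t) / kap b\<bar> < \<bar>(s + b * t) / kap b\<bar>" using k by (simp add: divide_strict_right_mono)
  then have "\<phi> ((s + b * t) / kap b) < \<phi> ((s - b * t) / kap b)" by (rule std_normal_less)
  then show ?thesis unfolding rect_slope_def by (intro mult_pos_pos divide_pos_pos k std_normal_pos) auto
qed

lemma kap_antimono: "0 \<le> b \<Longrightarrow> b \<le> q \<Longrightarrow> kap q \<le> kap b"
  by (simp add: power_mono)

text \<open>The factor \<open>\<phi> t\<close> is kept in the bound because it makes the bound
  integrable over all positive levels with respect to the Stieltjes measure of
  \<open>f\<close>.\<close>

lemma rect_slope_le:
  assumes b: "0 < b" "b \<le> q" "q < 1"
  shows "rect_slope b s t \<le> 2 * \<phi> 0 / kap q * \<phi> t"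
proof -
  have k: "kap q > 0" "kap q \<le> kap b" using kap_bounds[of q] kap_antimono[of b q] b by auto
  have "\<phi> ((s - b * t) / kap b) - \<phi> ((s + b * t) / kap b) \<le> \<phi> 0"
    by (rule order_trans[OF _ std_normal_le[of 0 "(s - b * t) / kap b"]]) simp_all
  then have "rect_slope b s t \<le> 2 * (\<phi> t / kap b * \<phi> 0)"
    unfolding rect_slope_def using k by (intro mult_left_mono divide_nonneg_pos) auto
  also have "\<dots> \<le> 2 * (\<phi> t / kap q * \<phi> 0)"
    using k by (intro mult_left_mono mult_right_mono divide_left_mono) auto
  finally show ?thesis by (simp add: mult_ac)
qed

text \<open>Compactness and pointwise positivity; the box stays away from both axes, where the slope
  vanishes.\<close>

lemma rect_slope_bounded_below:
  assumes "0 < p" "p \<le> q" "q < 1" "0 < s1" "s1 \<le> s2" "0 < t1" "t1 \<le> t2"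
  shows "\<exists>c>0. \<forall>b\<in>{p..q}. \<forall>s\<in>{s1..s2}. \<forall>t\<in>{t1..t2}. c \<le> rect_slope b s t"
proof -
  let ?K = "{p..q} \<times> {s1..s2} \<times> {t1..t2}"
  let ?f = "\<lambda>z. rect_slope (fst z) (fst (snd z)) (snd (snd z))"
  have "compact ?K" by (intro compact_Times compact_Icc)
  moreover have "?K \<noteq> {}" using assms by auto
  moreover have "continuous_on ?K ?f"
  proof -
    have "kap (fst z) \<noteq> 0" if "z \<in> ?K" for z using that assms kap_bounds(1)[of "fst z"] by auto
    then show ?thesis unfolding rect_slope_def
      by (intro continuous_intros continuous_on_compose2[OF continuous_on_std_normal[of UNIV]]) auto
  qed
  ultimately obtain z where z: "z \<in> ?K" "\<And>y. y \<in> ?K \<Longrightarrow> ?f z \<le> ?f y"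
    using continuous_attains_inf[of ?K ?f] by blast
  have "0 < ?f z" using z(1) assms by (intro rect_slope_pos) auto
  then show ?thesis using z(2) by (intro exI[of _ "?f z"]) force
qed

lemma rect_increment:
  assumes ab: "0 < a" "a \<le> b" "b < 1" and N: "0 \<le> N"
    and c: "\<And>z. a \<le> z \<Longrightarrow> z \<le> b \<Longrightarrow> c \<le> rect_slope z N t" and C: "\<And>z. a \<le> z \<Longrightarrow> z \<le> b \<Longrightarrow> rect_slope z N t \<le> C"
  shows "c * (b - a) \<le> rect b N t - rect a N t" and "rect b N t - rect a N t \<le> C * (b - a)"
proof -
  have "c * (b - a) \<le> rect b N t - rect a N t \<and> rect b N t - rect a N t \<le> C * (b - a)"
  proof (cases "a = b")
    case False
    then have "a < b" using ab by simp
    then obtain z where z: "a < z" "z < b" "rect b N t - rect a N t = (b - a) * rect_slope z N t"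
      using MVT2[of a b "\<lambda>b. rect b N t" "\<lambda>b. rect_slope b N t"] rect_deriv[OF _ _ N] ab by force
    show ?thesis unfolding z(3) mult.commute[of _ "b - a"]
      using z(1,2) \<open>a < b\<close> by (intro conjI mult_left_mono c C) auto
  qed simp
  then show "c * (b - a) \<le> rect b N t - rect a N t" and "rect b N t - rect a N t \<le> C * (b - a)" by auto
qed

text \<open>By \<open>\<phi> t = \<integral>y\<ge>t. y * \<phi> y\<close> and Tonelli, this is a moment bound on \<open>f\<close>.\<close>

lemma std_normal_integrable_interval_measure:
  assumes f: "f \<in> F_plus"
  shows "integrable (interval_measure f) (\<lambda>t. \<phi> t * indicator {0<..} t)"
proof (rule integrableI_nonneg)
  let ?M = "interval_measure f"
  interpret M: sigma_finite_measure ?M by (rule F_plus_interval_measure(1)[OF f])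
  interpret P: pair_sigma_finite ?M lborel
    by (intro pair_sigma_finite.intro M.sigma_finite_measure_axioms lborel.sigma_finite_measure_axioms)
  have L: "L2 f" and mono: "mono f" using f by (auto simp: F_plus_L2 strict_mono_mono)
  have [measurable]: "f \<in> borel_measurable borel" using L by simp
  have "filterlim (\<lambda>t::real. t\<^sup>2 / 2) at_top at_top"
  proof (rule filterlim_at_top_mono[OF filterlim_ident])
    show "\<forall>\<^sub>F t::real in at_top. t \<le> t\<^sup>2 / 2"
      using eventually_ge_at_top[of 2]
    proof eventually_elim
      case (elim t)
      then have "2 * t \<le> t * t" by (intro mult_right_mono) auto
      then show ?case by (simp add: power2_eq_square)
    qed
  qed
  then have "filterlim (\<lambda>t::real. - (t\<^sup>2 / 2)) at_bot at_top" by (simp add: filterlim_uminus_at_bot)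
  then have "((\<lambda>t::real. exp (- (t\<^sup>2 / 2))) \<longlongrightarrow> 0) at_top" by (rule filterlim_compose[OF exp_at_bot])
  from tendsto_minus[OF tendsto_mult_right_zero[OF this, of "1 / sqrt (2 * pi)"]]
  have lim: "((\<lambda>t. - \<phi> t) \<longlongrightarrow> 0) at_top"
    by (simp add: std_normal_density_def)
  have tail: "ennreal (\<phi> t) = (\<integral>\<^sup>+y. ennreal (y * \<phi> y) * indicator {t..} y \<partial>lborel)"
    if t: "0 < t" for t
  proof -
    have "((\<lambda>y. - \<phi> y) has_real_derivative y * \<phi> y) (at y)" for y
      using DERIV_minus[OF std_normal_deriv, of y] by simp
    then have "(\<integral>\<^sup>+y. ennreal (y * \<phi> y) * indicator {t..} y \<partial>lborel) = 0 - (- \<phi> t)"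
      using t by (intro nn_integral_FTC_atLeast lim) auto
    then show ?thesis by simp
  qed
  define h where "h t y = ennreal (y * \<phi> y) * indicator {z. 0 < fst z \<and> fst z \<le> snd z} (t, y)" for t y :: real
  have hm: "case_prod h \<in> borel_measurable (?M \<Otimes>\<^sub>M lborel)"
    unfolding h_def split_beta indicator_def by measurable
  have step1: "(\<integral>\<^sup>+t. ennreal (\<phi> t * indicator {0<..} t) \<partial>?M) = (\<integral>\<^sup>+t. (\<integral>\<^sup>+y. h t y \<partial>lborel) \<partial>?M)"
  proof (rule nn_integral_cong)
    fix t
    show "ennreal (\<phi> t * indicator {0<..} t) = (\<integral>\<^sup>+y. h t y \<partial>lborel)"
    proof (cases "0 < t")
      case True
      then show ?thesis by (simp add: tail h_def) (auto intro!: nn_integral_cong simp: indicator_def)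
    qed (simp add: h_def)
  qed
  have step2: "(\<integral>\<^sup>+t. (\<integral>\<^sup>+y. h t y \<partial>lborel) \<partial>?M) = (\<integral>\<^sup>+y. (\<integral>\<^sup>+t. h t y \<partial>?M) \<partial>lborel)"
    by (rule P.Fubini'[OF hm, symmetric])
  \<comment> \<open>After the exchange the inner integral is
    \<open>y * \<phi> y * (f y - f 0)\<close> for positive \<open>y\<close>, a product of two
    square-integrable functions against the Gaussian density.\<close>
  have step3: "(\<integral>\<^sup>+y. (\<integral>\<^sup>+t. h t y \<partial>?M) \<partial>lborel) \<le>
      (\<integral>\<^sup>+y. ennreal (\<phi> y * \<bar>y * (f \<bar>y\<bar> - f 0)\<bar>) \<partial>lborel)"
  proof (rule nn_integral_mono)
    fix y :: real
    show "(\<integral>\<^sup>+t. h t y \<partial>?M) \<le> ennreal (\<phi> y * \<bar>y * (f \<bar>y\<bar> - f 0)\<bar>)"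
    proof (cases "0 < y")
      case True
      have "(\<integral>\<^sup>+t. h t y \<partial>?M) = (\<integral>\<^sup>+t. ennreal (y * \<phi> y) * indicator {0<..y} t \<partial>?M)"
        by (auto intro!: nn_integral_cong simp: h_def indicator_def)
      also have "\<dots> = ennreal (y * \<phi> y) * emeasure ?M {0<..y}"
        by (rule nn_integral_cmult_indicator) simp
      also have "\<dots> = ennreal (y * \<phi> y) * ennreal (f y - f 0)"
        using F_plus_interval_measure(2)[OF f, of 0 y] True by simp
      also have "\<dots> = ennreal (\<phi> y * \<bar>y * (f \<bar>y\<bar> - f 0)\<bar>)"
        using True monoD[OF mono, of 0 y] by (subst ennreal_mult[symmetric]) (auto simp: abs_mult mult_ac)
      finally show ?thesis by simp
    next
      case False
      have "h t y = 0" for t using False by (auto simp: h_def indicator_def)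
      then show ?thesis by simp
    qed
  qed
  have step4: "(\<integral>\<^sup>+y. ennreal (\<phi> y * \<bar>y * (f \<bar>y\<bar> - f 0)\<bar>) \<partial>lborel) < \<infinity>"
  proof -
    have "integrable gauss1 (\<lambda>y. \<bar>y * (f \<bar>y\<bar> - f 0)\<bar>)"
      by (rule integrable_abs[OF L2_integrable_mult[OF L2_ident L2_diff[OF L2_comp_abs[OF L] L2_const]]])
    then have "integrable lborel (\<lambda>y. \<phi> y * \<bar>y * (f \<bar>y\<bar> - f 0)\<bar>)"
      unfolding gauss1_def by (subst (asm) integrable_density) auto
    then show ?thesis by (simp add: integrable_iff_bounded abs_mult)
  qed
  show "(\<integral>\<^sup>+t. ennreal (\<phi> t * indicator {0<..} t) \<partial>?M) < \<infinity>"
    unfolding step1 step2 by (rule le_less_trans[OF step3 step4])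
qed auto

text \<open>Both the median and the absolute value are nonnegative, so levels
  \<open>t \<le> 0\<close> never separate them and only the positive axis contributes.\<close>

lemma disagree_nonpos:
  assumes r: "0 < r" "r < 1" and t: "t \<le> 0" shows "disagree r b t = 0"
proof -
  have "0 < med r s" for s using med_gt[OF r, of "\<bar>s\<bar>"] r by (smt (verit) abs_ge_zero med_abs mult_nonneg_nonneg)
  then have "t \<le> med r s" for s using t by (meson less_imp_le order_trans)
  moreover have "t \<le> \<bar>y\<bar>" for y using t by (rule order_trans) simp
  ultimately show ?thesis by (simp add: disagree_def)
qed

text \<open>Envelope argument: for \<open>a \<le> b\<close> the difference of the optimal risks lies between the differences at fixed
  links, with the link optimal at \<open>b\<close> from below and at \<open>a\<close> from above.\<close>

lemma valPR_steep:
  assumes f: "f \<in> F_plus" and r: "0 < r" "r < 1"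
  shows "steep_at (valPR f) r"
proof -
  let ?M = "interval_measure f"
  \<comment> \<open>A compact window of correlations inside the open unit interval, on which the
    slope bounds hold uniformly.\<close>
  define p where "p = r / 2"
  define q where "q = (1 + r) / 2"
  define e where "e = min (r - p) (q - r)"
  have pq: "0 < p" "p < r" "r < q" "q < 1" "0 < e" using r by (auto simp: p_def q_def e_def)
  obtain c0 where c0: "c0 > 0" "\<And>x. x \<ge> c0 \<Longrightarrow> 1 / 4 < Phi x" using Phi_quarter by blast
  \<comment> \<open>This bounds \<open>med a 1\<close> for every correlation \<open>a\<close>, so
    levels above \<open>t1\<close> have threshold \<open>N \<ge> 1\<close> whichever link is
    used.\<close>
  define t1 where "t1 = 1 + c0"
  define t2 where "t2 = t1 + 1"
  have t12: "0 < t1" "t1 < t2" "0 < t2" using c0 by (auto simp: t1_def t2_def)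
  have med1: "med a 1 \<le> t1" if a: "0 < a" "a < 1" for a
  proof -
    have k: "kap a > 0" "kap a \<le> 1" using kap_bounds[OF a] by auto
    have "c0 * kap a \<le> c0 * 1" using k c0 by (intro mult_left_mono) auto
    then have "c0 \<le> c0 / kap a" using k by (simp add: field_simps)
    then have "1 / 2 \<le> folded a 0 c0" using c0(2)[of "c0 / kap a"] by (simp add: folded_def)
    then have "med a 0 \<le> c0" by (simp add: med_le_iff[OF a])
    then show ?thesis using med_lipschitz[OF a, of 0 1] a by (simp add: t1_def)
  qed
  \<comment> \<open>Levels up to \<open>t2\<close> have threshold at most \<open>t2 / p\<close>,
    because \<open>N \<le> t / x\<close> and \<open>x \<ge> p\<close>.\<close>
  have s12: "1 \<le> t2 / p" using t12 pq c0 by (simp add: t1_def t2_def field_simps)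
  obtain c where c: "c > 0" "\<And>b s t. b \<in> {p..q} \<Longrightarrow> s \<in> {1..t2 / p} \<Longrightarrow> t \<in> {t1..t2} \<Longrightarrow> c \<le> rect_slope b s t"
    using rect_slope_bounded_below[of p q 1 "t2 / p" t1 t2] pq s12 t12 by auto
  define C where "C = 2 * \<phi> 0 / kap q"
  have diff: "integrable ?M (\<lambda>t. disagree a b t - disagree a b' t)"
    "riskPR2 f b (\<lambda>t. f (med_ext a t)) - riskPR2 f b' (\<lambda>t. f (med_ext a t)) = (LINT t|?M. disagree a b t - disagree a b' t)"
    if "0 < a" "a < 1" "0 < b" "b < 1" "0 < b'" "b' < 1" for a b b'
    using riskPR2_layer_cake[OF f that(1,2,3,4)] riskPR2_layer_cake[OF f that(1,2,5,6)] by simp_all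
  define m where "m = f t2 - f t1"
  have m: "m > 0" using f t12 by (auto simp: m_def F_plus_L2 dest: strict_monoD)
  have mI: "measure ?M {t1<..t2} = m"
    using F_plus_interval_measure(2)[OF f, of t1 t2] t12 m by (simp add: measure_def m_def)
  have iI: "integrable ?M (indicat_real {t1<..t2})"
    using F_plus_interval_measure(2)[OF f, of t1 t2] t12 by (simp add: integrable_indicator_iff)
  define J where "J = (LINT t|?M. \<phi> t * indicator {0<..} t)"
  note iJ = std_normal_integrable_interval_measure[OF f]
  show ?thesis
  proof (rule steep_atI[where c = "2 * c * m" and L = "2 * C * J", OF pq(5)])
    fix a b assume ab: "r - e < a" "a \<le> b" "b < r + e"
    have in_pq: "p < a" "b < q" using ab by (auto simp: e_def)
    have a: "0 < a" "a < 1" and b: "0 < b" "b < 1" using in_pq ab pq by auto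
    have inc: "c * (b - a) * indicator {t1<..t2} t \<le> - (disagree x b t - disagree x a t) / 2 \<and>
        - (disagree x b t - disagree x a t) / 2 \<le> C * (b - a) * (\<phi> t * indicator {0<..} t)"
      if x: "0 < x" "x < 1" "p \<le> x" for x t
    proof (cases "0 < t")
      case True
      obtain N where N: "0 \<le> N" "N \<le> t / x" "\<forall>s. t \<le> med x s \<longleftrightarrow> N \<le> \<bar>s\<bar>" "med x 1 \<le> t \<longrightarrow> 1 \<le> N"
        by (rule med_threshold[OF x(1,2) True])
      have d: "- (disagree x b t - disagree x a t) / 2 = rect b N t - rect a N t"
        using disagree_diff[OF x(1,2) b a True N(1,3)] by simp
      have up: "rect b N t - rect a N t \<le> (C * \<phi> t) * (b - a)"
        and lo0: "0 * (b - a) \<le> rect b N t - rect a N t"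
        using rect_slope_le[of _ q N t] rect_slope_nonneg[of _ N t] a b ab in_pq pq N(1) True
        by (intro rect_increment[of a b N 0 t "C * \<phi> t"]; force simp: C_def)+
      have lo: "c * (b - a) \<le> rect b N t - rect a N t" if t: "t1 < t" "t \<le> t2"
      proof (rule rect_increment(1)[of a b N c t "C * \<phi> t"])
        have "1 \<le> N" using N(4) med1[OF x(1,2)] t by simp
        moreover have "t / x \<le> t2 / p" using t x pq True by (intro frac_le) auto
        ultimately have "N \<in> {1..t2 / p}" using N(2) by simp
        then show "c \<le> rect_slope z N t" if "a \<le> z" "z \<le> b" for z
          using that in_pq t by (intro c(2)) auto
        show "rect_slope z N t \<le> C * \<phi> t" if "a \<le> z" "z \<le> b" for z
          using rect_slope_le[of z q N t] that a in_pq pq by (simp add: C_def)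
      qed (use a b ab N in auto)
      show ?thesis unfolding d using up lo0 lo True by (auto simp: indicator_def mult_ac)
    next
      case False
      then show ?thesis using disagree_nonpos[OF x(1,2), of t] t12 by (simp add: indicator_def)
    qed
    have lower: "- (2 * C * J) * (b - a) \<le> (LINT t|?M. disagree x b t - disagree x a t)"
      and upper: "(LINT t|?M. disagree x b t - disagree x a t) \<le> - (2 * c * m) * (b - a)"
      if x: "0 < x" "x < 1" "p \<le> x" for x
    proof -
      have half: "- X / 2 = - (1 / 2) * X" for X :: real by simp
      note i = diff(1)[OF x(1,2) b a]
      have i2: "integrable ?M (\<lambda>t. - (disagree x b t - disagree x a t) / 2)"
        unfolding half by (rule integrable_mult_right[OF i])
      have eq: "(LINT t|?M. - (disagree x b t - disagree x a t) / 2) = - (LINT t|?M. disagree x b t - disagree x a t) / 2"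
        unfolding half by (rule integral_mult_right_zero)
      have "(LINT t|?M. c * (b - a) * indicator {t1<..t2} t) \<le> (LINT t|?M. - (disagree x b t - disagree x a t) / 2)"
        using iI i2 inc[OF x] by (intro integral_mono) auto
      then have 1: "c * (b - a) * m \<le> - (LINT t|?M. disagree x b t - disagree x a t) / 2"
        unfolding eq using mI by simp
      have "(LINT t|?M. - (disagree x b t - disagree x a t) / 2) \<le> (LINT t|?M. C * (b - a) * (\<phi> t * indicator {0<..} t))"
        using iJ i2 inc[OF x] by (intro integral_mono) auto
      then have 2: "- (LINT t|?M. disagree x b t - disagree x a t) / 2 \<le> C * (b - a) * J"
        unfolding eq J_def by simp
      show "- (2 * C * J) * (b - a) \<le> (LINT t|?M. disagree x b t - disagree x a t)"
        using 2 by (simp add: field_simps)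
      show "(LINT t|?M. disagree x b t - disagree x a t) \<le> - (2 * c * m) * (b - a)"
        using 1 by (simp add: field_simps)
    qed
    have "valPR f b - valPR f a \<le> (LINT t|?M. disagree a b t - disagree a a t)"
      using riskPR2_minimum[OF f F_plus_med_ext[OF f a] b] diff(2)[OF a b a] by (simp add: valPR_def)
    also have "\<dots> \<le> - (2 * c * m) * (b - a)" using upper[OF a] in_pq by simp
    finally have up: "valPR f b - valPR f a \<le> - (2 * c * m) * (b - a)" .
    have "- (2 * C * J) * (b - a) \<le> (LINT t|?M. disagree b b t - disagree b a t)"
      using lower[OF b] in_pq ab by simp
    also have "\<dots> \<le> valPR f b - valPR f a"
      using riskPR2_minimum[OF f F_plus_med_ext[OF f b] a] diff(2)[OF b b a] by (simp add: valPR_def)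
    finally show "- (2 * C * J) * (b - a) \<le> valPR f b - valPR f a \<and>
      valPR f b - valPR f a \<le> - (2 * c * m) * (b - a)" using up by blast
  qed (use c m in simp)
qed

lemma f1PR_RGA:
  fixes x xs :: "real ^ 'n"
  assumes x: "norm x = 1" "norm xs = 1" "0 < x \<bullet> xs" "x \<bullet> xs < 1" and s: "f \<in> F_plus"
  shows "RGA 1 (f1PR f xs) x xs"
  by (rule RGA_of_steep_profile[OF x valPR_steep[OF s x(3,4)]]) (rule f1PR_minimum(1)[OF _ x(2) _ _ s])

section \<open>Acute angles and the combined statement\<close>

lemma theta_acute:
  assumes "norm x = 1" "norm xs = 1" "theta x xs \<in> {0<..<pi/2}"
  shows "0 < x \<bullet> xs" and "x \<bullet> xs < 1"
proof -
  have "\<bar>x \<bullet> xs\<bar> \<le> 1" using Cauchy_Schwarz_ineq2[of x xs] assms by simp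
  then have eq: "x \<bullet> xs = cos (theta x xs)" by (simp add: theta_def cos_arccos abs_le_iff)
  show "0 < x \<bullet> xs" unfolding eq using assms(3) by (intro cos_gt_zero) auto
  show "x \<bullet> xs < 1" unfolding eq using assms(3) cos_monotone_0_pi[of 0 "theta x xs"] by simp
qed

text \<open>The existence clauses certify that the infima defining the three optimal values are
  minima at the points considered.\<close>

theorem theorem5p9:
  fixes xs :: "real ^ 'n"
  assumes "xs \<in> sphere 0 1"
  shows
    "(\<forall>\<sigma>s \<in> F_class. \<forall>x \<in> sphere 0 1. theta x xs \<in> {0<..<pi/2} \<longrightarrow>
        (\<exists>\<sigma>. is_arg_min (risk2 \<sigma>s xs x) (\<lambda>\<sigma>. \<sigma> \<in> F_class) \<sigma>) \<and>
        RGA 1 (f2 \<sigma>s xs) x xs) \<and>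
     (\<forall>\<sigma>s \<in> F_plus. \<forall>x \<in> sphere 0 1. theta x xs \<in> {0<..<pi/2} \<longrightarrow>
        (\<exists>\<sigma>. is_arg_min (risk1 \<sigma>s xs x) (\<lambda>\<sigma>. \<sigma> \<in> F_plus) \<sigma>) \<and>
        RGA 1 (f1 \<sigma>s xs) x xs) \<and>
     (\<forall>rs \<in> F_plus. \<forall>x \<in> sphere 0 1. theta x xs \<in> {0<..<pi/2} \<longrightarrow>
        (\<exists>r. is_arg_min (risk1PR rs xs x) (\<lambda>r. r \<in> F_plus) r) \<and>
        RGA 1 (f1PR rs xs) x xs)"
proof -
  have xs: "norm xs = 1" using assms by simp
  have "(\<exists>\<sigma>. is_arg_min (risk2 \<sigma>s xs x) (\<lambda>\<sigma>. \<sigma> \<in> F_class) \<sigma>) \<and> RGA 1 (f2 \<sigma>s xs) x xs"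
    if "\<sigma>s \<in> F_class" "x \<in> sphere 0 1" "theta x xs \<in> {0<..<pi/2}" for \<sigma>s x
  proof -
    have x: "norm x = 1" using that by simp
    note acute = theta_acute[OF x xs that(3)]
    show ?thesis using f2_minimum(2)[OF x xs acute that(1)] f2_RGA[OF x xs acute that(1)] by blast
  qed
  moreover have "(\<exists>\<sigma>. is_arg_min (risk1 \<sigma>s xs x) (\<lambda>\<sigma>. \<sigma> \<in> F_plus) \<sigma>) \<and> RGA 1 (f1 \<sigma>s xs) x xs"
    if "\<sigma>s \<in> F_plus" "x \<in> sphere 0 1" "theta x xs \<in> {0<..<pi/2}" for \<sigma>s x
  proof -
    have x: "norm x = 1" using that by simp
    note acute = theta_acute[OF x xs that(3)]
    show ?thesis using f1_minimum(2)[OF x xs acute that(1)] f1_RGA[OF x xs acute that(1)] by blast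
  qed
  moreover have "(\<exists>r. is_arg_min (risk1PR rs xs x) (\<lambda>r. r \<in> F_plus) r) \<and> RGA 1 (f1PR rs xs) x xs"
    if "rs \<in> F_plus" "x \<in> sphere 0 1" "theta x xs \<in> {0<..<pi/2}" for rs x
  proof -
    have x: "norm x = 1" using that by simp
    note acute = theta_acute[OF x xs that(3)]
    show ?thesis using f1PR_minimum(2)[OF x xs acute that(1)] f1PR_RGA[OF x xs acute that(1)] by blast
  qed
  ultimately show ?thesis by blast
qed

end
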